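(* Let $\lambda=(\lambda_0\ge\cdots\ge\lambda_n\ge0)$ be a partition with at most $n+1$ parts. As a $\mathfrak{p}$-module via the restriction morphism $\mathfrak{p}\to\mathfrak{sp}_{2n+1}$, the module $S_{\langle\lambda\rangle}\mathbb{C}^{2n+1}$ is isomorphic to the $\mathfrak{p}$-module $V'_\lambda$.
   Context: Work over $\mathbb{C}$. Let $\{e_0,\dots,e_{2n+1}\}$ be a basis of $\tilde E=\mathbb{C}^{2n+2}$ and write $\bar\imath=2n+1-i$. Let $\tilde\omega$ be the symplectic form on $\tilde E$ with $\tilde\omega(e_i,e_j)=0$ unless $j=\bar\imath$ and $\tilde\omega(e_i,e_{\bar\imath})=1$ for $0\le i\le n$. Let $\mathfrak{sp}_{2n+2}$ be the Lie algebra of the symplectic group of $\tilde\omega$, with the Cartan subalgebra of diagonal matrices and the Borel subalgebra of upper triangular matrices in this basis (defining the positive roots). For $0\le i\le n$ let $\varepsilon_i$ be the weight giving the $i$-th diagonal entry. Let $V_\lambda$ be the simple $\mathfrak{sp}_{2n+2}$-module of highest weight $\lambda_0\varepsilon_0+\cdots+\lambda_n\varepsilon_n$. Let $\widetilde{\mathfrak{sp}}_{2n+1}=\{X\in\mathfrak{sp}_{2n+2}\mid Xe_n=0\}$ (the intermediate odd symplectic Lie algebra) and $\mathfrak{p}=\{X\in\mathfrak{sp}_{2n+2}\mid X(\mathbb{C}e_n)\subset\mathbb{C}e_n\}$. Let $V'_\lambda$ be the $\widetilde{\mathfrak{sp}}_{2n+1}$-submodule of $V_\lambda$ generated by a highest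 weight vector. Since $\mathfrak p$ is the sum of $\widetilde{\mathfrak{sp}}_{2n+1}$ and a line in the Cartan subalgebra, $V'_\lambda$ is also a $\mathfrak{p}$-submodule. Here $\mathbb{C}^{2n+1}$ is identified with $E=e_n^{\perp}$ (orthogonal with respect to $\tilde\omega$), equipped with the form $\omega=\tilde\omega|_E$, of rank $2n$ and with kernel $\mathbb{C}e_n$. $\mathfrak{sp}_{2n+1}$ is the Lie algebra of $\mathrm{Sp}_{2n+1}$, the stabilizer of $\omega$ in $\mathrm{GL}(E)$. The morphism $\mathfrak{p}\to\mathfrak{sp}_{2n+1}$ is $X\mapsto X|_E$. For a vector space $V$ with a skew-form $\omega$ and a partition $\lambda$ with $|\lambda|=d$, let $S_\lambda V\subset V^{\otimes d}$ be the Schur power (image of a Young symmetrizer). For $1\le p<q\le d$ let $\varphi_{pq}:V^{\otimes d}\to V^{\otimes(d-2)}$ be the contraction $v_1\otimes\cdots\otimes v_d\mapsto\omega(v_p,v_q)\,v_1\otimes\cdots\widehat{v_p}\cdots\widehat{v_q}\cdots\otimes v_d$. Then $S_{\langle\lambda\rangle}V=S_\lambda V\cap\bigcap_{p<q}\ker\varphi_{pq}$. *)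

theory Defs
  imports
    "Jordan_Normal_Form.Matrix"
    "HOL-Combinatorics.Permutations"
    "HOL-Library.Function_Algebras"
    "HOL-Library.FuncSet"
begin

section \<open>Modules over a Lie algebra of matrices\<close>

text \<open>A module is carried by a subspace \<open>V\<close> of an ambient complex vector space. The set \<open>g\<close> is a
  Lie algebra of square matrices with the commutator as bracket.\<close>

locale lie_module = vector_space scale
  for scale :: "complex \<Rightarrow> 'v::ab_group_add \<Rightarrow> 'v" +
  fixes g :: "complex mat set" and V :: "'v set" and act :: "complex mat \<Rightarrow> 'v \<Rightarrow> 'v"
  assumes carrier_subspace: "subspace V"
    and act_closed: "X \<in> g \<Longrightarrow> v \<in> V \<Longrightarrow> act X v \<in> V"
    and act_add: "X \<in> g \<Longrightarrow> u \<in> V \<Longrightarrow> v \<in> V \<Longrightarrow> act X (u + v) = act X u + act X v"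
    and act_scale: "X \<in> g \<Longrightarrow> v \<in> V \<Longrightarrow> act X (scale c v) = scale c (act X v)"
    and add_act: "X \<in> g \<Longrightarrow> Y \<in> g \<Longrightarrow> v \<in> V \<Longrightarrow> act (X + Y) v = act X v + act Y v"
    and smult_act: "X \<in> g \<Longrightarrow> v \<in> V \<Longrightarrow> act (c \<cdot>\<^sub>m X) v = scale c (act X v)"
    and bracket_act: "X \<in> g \<Longrightarrow> Y \<in> g \<Longrightarrow> v \<in> V \<Longrightarrow>
      act (X * Y - Y * X) v = act X (act Y v) - act Y (act X v)"

definition lie_submodule ::
  "(complex \<Rightarrow> 'v::ab_group_add \<Rightarrow> 'v) \<Rightarrow> complex mat set \<Rightarrow> 'v set \<Rightarrow> (complex mat \<Rightarrow> 'v \<Rightarrow> 'v) \<Rightarrow>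
    'v set \<Rightarrow> bool" where
  "lie_submodule scale g V act W \<longleftrightarrow>
    module.subspace scale W \<and> W \<subseteq> V \<and> (\<forall>X\<in>g. \<forall>w\<in>W. act X w \<in> W)"

definition simple_lie_module ::
  "(complex \<Rightarrow> 'v::ab_group_add \<Rightarrow> 'v) \<Rightarrow> complex mat set \<Rightarrow> 'v set \<Rightarrow> (complex mat \<Rightarrow> 'v \<Rightarrow> 'v) \<Rightarrow>
    bool" where
  "simple_lie_module scale g V act \<longleftrightarrow>
    lie_module scale g V act \<and> V \<noteq> {0} \<and>
    (\<forall>W. lie_submodule scale g V act W \<longrightarrow> W = {0} \<or> W = V)"

definition generated_submodule ::
  "(complex \<Rightarrow> 'v::ab_group_add \<Rightarrow> 'v) \<Rightarrow> complex mat set \<Rightarrow> 'v set \<Rightarrow> (complex mat \<Rightarrow> 'v \<Rightarrow> 'v) \<Rightarrow>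
    'v \<Rightarrow> 'v set" where
  "generated_submodule scale g V act v = \<Inter>{W. lie_submodule scale g V act W \<and> v \<in> W}"

definition isomorphic_lie_modules ::
  "complex mat set \<Rightarrow>
   (complex \<Rightarrow> 'v::ab_group_add \<Rightarrow> 'v) \<Rightarrow> 'v set \<Rightarrow> (complex mat \<Rightarrow> 'v \<Rightarrow> 'v) \<Rightarrow>
   (complex \<Rightarrow> 'w::ab_group_add \<Rightarrow> 'w) \<Rightarrow> 'w set \<Rightarrow> (complex mat \<Rightarrow> 'w \<Rightarrow> 'w) \<Rightarrow> bool" where
  "isomorphic_lie_modules g scale1 V1 act1 scale2 V2 act2 \<longleftrightarrow>
    lie_module scale1 g V1 act1 \<and> lie_module scale2 g V2 act2 \<and>
    (\<exists>f. bij_betw f V1 V2 \<and>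
         (\<forall>u\<in>V1. \<forall>v\<in>V1. f (u + v) = f u + f v) \<and>
         (\<forall>c. \<forall>v\<in>V1. f (scale1 c v) = scale2 c (f v)) \<and>
         (\<forall>X\<in>g. \<forall>v\<in>V1. f (act1 X v) = act2 X (f v)))"


section \<open>The symplectic and odd symplectic Lie algebras\<close>

text \<open>The basis \<open>e\<^sub>0, \<dots>, e\<^sub>2\<^sub>n\<^sub>+\<^sub>1\<close> consists of the vectors \<open>unit_vec (2 * n + 2) i\<close>.\<close>

definition symp_form :: "nat \<Rightarrow> complex vec \<Rightarrow> complex vec \<Rightarrow> complex" where
  "symp_form n u v =
    (\<Sum>i\<le>n. u $ i * v $ (2 * n + 1 - i) - u $ (2 * n + 1 - i) * v $ i)"

lemma symp_form_unit_vec: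
  assumes "i < 2 * n + 2" "j < 2 * n + 2"
  shows "symp_form n (unit_vec (2 * n + 2) i) (unit_vec (2 * n + 2) j) =
    (if j = 2 * n + 1 - i then if i \<le> n then 1 else - 1 else 0)"
proof -
  have "symp_form n (unit_vec (2 * n + 2) i) (unit_vec (2 * n + 2) j) =
      (\<Sum>k\<le>n. (if k = i then if j = 2 * n + 1 - i then 1 else 0 else 0) -
              (if k = j then if i = 2 * n + 1 - j then 1 else 0 else 0))"
    unfolding symp_form_def using assms by (intro sum.cong) (auto simp: unit_vec_def)
  also have "\<dots> = (if i \<le> n then if j = 2 * n + 1 - i then 1 else 0 else 0) -
                 (if j \<le> n then if i = 2 * n + 1 - j then 1 else 0 else 0)"
    by (simp add: sum_subtractf)
  also have "\<dots> = (if j = 2 * n + 1 - i then if i \<le> n then 1 else - 1 else 0)"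
    using assms by auto
  finally show ?thesis .
qed

definition sp :: "nat \<Rightarrow> complex mat set" where
  "sp n = {X \<in> carrier_mat (2 * n + 2) (2 * n + 2).
    \<forall>u\<in>carrier_vec (2 * n + 2). \<forall>v\<in>carrier_vec (2 * n + 2).
      symp_form n (X *\<^sub>v u) v + symp_form n u (X *\<^sub>v v) = 0}"

definition intermediate_sp :: "nat \<Rightarrow> complex mat set" where
  "intermediate_sp n =
    {X \<in> sp n. X *\<^sub>v unit_vec (2 * n + 2) n = 0\<^sub>v (2 * n + 2)}"

definition line_stabilizer :: "nat \<Rightarrow> complex mat set" where
  "line_stabilizer n =
    {X \<in> sp n. let L = {c \<cdot>\<^sub>v unit_vec (2 * n + 2) n | c. True} in (\<lambda>v. X *\<^sub>v v) ` L \<subseteq> L}"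

text \<open>\<open>E\<close> is the orthogonal of \<open>e\<^sub>n\<close>; it is the model of \<open>\<complex>\<^bsup>2n+1\<^esup>\<close>, the form being the restriction
  of \<^const>\<open>symp_form\<close>.\<close>

definition odd_space :: "nat \<Rightarrow> complex vec set" where
  "odd_space n =
    {v \<in> carrier_vec (2 * n + 2). symp_form n (unit_vec (2 * n + 2) n) v = 0}"

definition linear_endo :: "nat \<Rightarrow> (complex vec \<Rightarrow> complex vec) \<Rightarrow> bool" where
  "linear_endo n f \<longleftrightarrow> f \<in> odd_space n \<rightarrow>\<^sub>E odd_space n \<and>
    (\<forall>u\<in>odd_space n. \<forall>v\<in>odd_space n. f (u + v) = f u + f v) \<and>
    (\<forall>c. \<forall>v\<in>odd_space n. f (c \<cdot>\<^sub>v v) = c \<cdot>\<^sub>v f v)"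

definition odd_sp :: "nat \<Rightarrow> (complex vec \<Rightarrow> complex vec) set" where
  "odd_sp n = {f. linear_endo n f \<and>
    (\<forall>u\<in>odd_space n. \<forall>v\<in>odd_space n. symp_form n (f u) v + symp_form n u (f v) = 0)}"

definition restriction :: "nat \<Rightarrow> complex mat \<Rightarrow> complex vec \<Rightarrow> complex vec" where
  "restriction n X = restrict (\<lambda>v. X *\<^sub>v v) (odd_space n)"

lemma symp_form_smult_left:
  assumes "u \<in> carrier_vec (2 * n + 2)"
  shows "symp_form n (c \<cdot>\<^sub>v u) v = c * symp_form n u v"
  unfolding symp_form_def sum_distrib_left
  by (intro sum.cong) (use assms in \<open>auto simp: algebra_simps\<close>)

lemma symp_form_add_right:
  assumes "u \<in> carrier_vec (2 * n + 2)" "v \<in> carrier_vec (2 * n + 2)"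
  shows "symp_form n w (u + v) = symp_form n w u + symp_form n w v"
  unfolding symp_form_def sum.distrib [symmetric]
  by (intro sum.cong) (use assms in \<open>auto simp: algebra_simps\<close>)

lemma restriction_in_odd_sp:
  assumes "X \<in> line_stabilizer n"
  shows "restriction n X \<in> odd_sp n"
proof -
  let ?e = "unit_vec (2 * n + 2) n :: complex vec"
  have X: "X \<in> carrier_mat (2 * n + 2) (2 * n + 2)" and "X \<in> sp n"
    using assms by (auto simp: line_stabilizer_def sp_def)
  then have inv: "symp_form n (X *\<^sub>v u) v + symp_form n u (X *\<^sub>v v) = 0"
    if "u \<in> carrier_vec (2 * n + 2)" "v \<in> carrier_vec (2 * n + 2)" for u v
    using that by (auto simp: sp_def)
  have "X *\<^sub>v (1 \<cdot>\<^sub>v ?e) \<in> {c \<cdot>\<^sub>v ?e | c. True}"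
    using assms unfolding line_stabilizer_def Let_def by blast
  then obtain c where c: "X *\<^sub>v ?e = c \<cdot>\<^sub>v ?e" by auto
  have stable: "X *\<^sub>v v \<in> odd_space n" if v: "v \<in> odd_space n" for v
  proof -
    have vc: "v \<in> carrier_vec (2 * n + 2)" and "symp_form n ?e v = 0"
      using v by (auto simp: odd_space_def)
    then have "symp_form n ?e (X *\<^sub>v v) = 0"
      using inv [of ?e v] c by (simp add: symp_form_smult_left)
    then show ?thesis using X vc by (auto simp: odd_space_def)
  qed
  have sub: "odd_space n \<subseteq> carrier_vec (2 * n + 2)" by (auto simp: odd_space_def)
  have add: "u + v \<in> odd_space n" if "u \<in> odd_space n" "v \<in> odd_space n" for u v
    using that by (auto simp: odd_space_def symp_form_add_right)
  have scale: "a \<cdot>\<^sub>v v \<in> odd_space n" if "v \<in> odd_space n" for a v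
  proof -
    have "symp_form n ?e (a \<cdot>\<^sub>v v) = a * symp_form n ?e v"
      unfolding symp_form_def sum_distrib_left
      by (intro sum.cong) (use that in \<open>auto simp: odd_space_def algebra_simps\<close>)
    then show ?thesis using that by (auto simp: odd_space_def)
  qed
  show ?thesis
    unfolding odd_sp_def linear_endo_def restriction_def
    using X sub stable add scale inv
    by (auto simp: subset_iff mult_add_distrib_mat_vec mult_mat_vec)
qed


section \<open>Tensor powers\<close>

text \<open>A tensor in \<open>(\<complex>\<^sup>N)\<^bsup>\<otimes>d\<^esup>\<close> is given by its coordinates in the basis
  \<open>e\<^sub>w\<^sub>0 \<otimes> \<dots> \<otimes> e\<^sub>w\<^sub>d\<^sub>-\<^sub>1\<close>, which is indexed by the words \<open>w\<close> of length \<open>d\<close> with letters less than \<open>N\<close>;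
  it is extended by zero to all words. For a subspace \<open>V\<close> of \<open>\<complex>\<^sup>N\<close>, the tensor power \<open>V\<^bsup>\<otimes>d\<^esup>\<close> is
  the span of the tensors \<open>v\<^sub>0 \<otimes> \<dots> \<otimes> v\<^sub>d\<^sub>-\<^sub>1\<close> with all \<open>v\<^sub>i\<close> in \<open>V\<close>. Positions are numbered from 0.\<close>

type_synonym tensor = "nat list \<Rightarrow> complex"

definition tensor_scale :: "complex \<Rightarrow> tensor \<Rightarrow> tensor" where
  "tensor_scale c t = (\<lambda>w. c * t w)"

lemma vector_space_tensor_scale: "vector_space tensor_scale"
  by unfold_locales (auto simp: tensor_scale_def fun_eq_iff algebra_simps)

text \<open>The guard is needed because \<open>v $ a\<close> is unspecified for \<open>a\<close> out of range.\<close>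

definition coord :: "complex vec \<Rightarrow> nat \<Rightarrow> complex" where
  "coord v a = (if a < dim_vec v then v $ a else 0)"

definition pure_tensor :: "complex vec list \<Rightarrow> tensor" where
  "pure_tensor vs w =
    (if length w = length vs then \<Prod>i<length vs. coord (vs ! i) (w ! i) else 0)"

definition tensor_power :: "complex vec set \<Rightarrow> nat \<Rightarrow> tensor set" where
  "tensor_power V d =
    module.span tensor_scale {pure_tensor vs | vs. length vs = d \<and> set vs \<subseteq> V}"

text \<open>The right action of permutations, \<open>(v\<^sub>0 \<otimes> \<dots> \<otimes> v\<^sub>d\<^sub>-\<^sub>1) \<sigma> = v\<^sub>\<sigma>\<^sub>(\<^sub>0\<^sub>) \<otimes> \<dots> \<otimes> v\<^sub>\<sigma>\<^sub>(\<^sub>d\<^sub>-\<^sub>1\<^sub>)\<close>;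
  see \<open>tensor_perm_pure\<close> below.\<close>

definition tensor_perm :: "(nat \<Rightarrow> nat) \<Rightarrow> tensor \<Rightarrow> tensor" where
  "tensor_perm \<sigma> t = (\<lambda>w. t (permute_list (inv_into UNIV \<sigma>) w))"

lemma tensor_perm_pure:
  assumes "\<sigma> permutes {..<length vs}"
  shows "tensor_perm \<sigma> (pure_tensor vs) = pure_tensor (permute_list \<sigma> vs)"
proof
  fix w
  have inv: "inv_into UNIV \<sigma> permutes {..<length vs}" using assms by (rule permutes_inv)
  show "tensor_perm \<sigma> (pure_tensor vs) w = pure_tensor (permute_list \<sigma> vs) w"
  proof (cases "length w = length vs")
    case True
    have "(\<Prod>i<length vs. coord (vs ! i) (permute_list (inv_into UNIV \<sigma>) w ! i)) =
        (\<Prod>i<length vs. coord (vs ! i) (w ! inv_into UNIV \<sigma> i))"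
      using inv True by (intro prod.cong) (auto simp: permute_list_nth)
    also have "\<dots> = (\<Prod>i<length vs. coord (vs ! \<sigma> i) (w ! inv_into UNIV \<sigma> (\<sigma> i)))"
      by (subst prod.permute [OF assms]) (simp add: o_def)
    also have "\<dots> = (\<Prod>i<length vs. coord (permute_list \<sigma> vs ! i) (w ! i))"
      using assms by (intro prod.cong) (auto simp: permute_list_nth permutes_inverses)
    finally show ?thesis using True by (simp add: tensor_perm_def pure_tensor_def)
  qed (simp add: tensor_perm_def pure_tensor_def)
qed

definition insert_at :: "nat \<Rightarrow> 'a \<Rightarrow> 'a list \<Rightarrow> 'a list" where
  "insert_at k x xs = take k xs @ x # drop k xs"

lemma length_insert_at: "length (insert_at k x xs) = Suc (length xs)"
  unfolding insert_at_def by (cases "k \<le> length xs") auto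

text \<open>The contraction of positions \<open>p < q\<close> with a bilinear form \<open>\<omega>\<close> on \<open>\<complex>\<^sup>N\<close>. The word on the right
  has the letter \<open>a\<close> at position \<open>p\<close>, the letter \<open>b\<close> at position \<open>q\<close>, and the word \<open>u\<close> elsewhere;
  see \<open>contraction_pure\<close> below.\<close>

definition contraction ::
  "nat \<Rightarrow> (complex vec \<Rightarrow> complex vec \<Rightarrow> complex) \<Rightarrow> nat \<Rightarrow> nat \<Rightarrow> tensor \<Rightarrow> tensor" where
  "contraction N \<omega> p q t = (\<lambda>u. \<Sum>a<N. \<Sum>b<N.
     \<omega> (unit_vec N a) (unit_vec N b) * t (insert_at q b (insert_at p a u)))"

lemma pure_tensor_Cons: "pure_tensor (v # vs) (a # w) = coord v a * pure_tensor vs w"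
  by (simp add: pure_tensor_def prod.lessThan_Suc_shift del: prod.lessThan_Suc)

lemma pure_tensor_append:
  "length xs = length a \<Longrightarrow> pure_tensor (xs @ ys) (a @ b) = pure_tensor xs a * pure_tensor ys b"
proof (induction xs a rule: list_induct2)
  case Nil
  show ?case by (simp add: pure_tensor_def)
next
  case (Cons x xs y ys)
  then show ?case by (simp add: pure_tensor_Cons)
qed

lemma symp_form_expand:
  assumes "u \<in> carrier_vec (2 * n + 2)" "v \<in> carrier_vec (2 * n + 2)"
  shows "symp_form n u v = (\<Sum>a<2*n+2. \<Sum>b<2*n+2.
    symp_form n (unit_vec (2*n+2) a) (unit_vec (2*n+2) b) * (coord u a * coord v b))"
proof -
  let ?N = "2 * n + 2"
  have "(\<Sum>a<?N. \<Sum>b<?N.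
      symp_form n (unit_vec ?N a) (unit_vec ?N b) * (coord u a * coord v b)) =
    (\<Sum>a<?N. \<Sum>b<?N. if b = 2*n+1-a then (if a \<le> n then 1 else -1) * (u $ a * v $ b) else 0)"
    using assms by (intro sum.cong refl) (subst symp_form_unit_vec, auto simp: coord_def)
  also have "\<dots> = (\<Sum>a<?N. (if a \<le> n then 1 else -1) * (u $ a * v $ (2*n+1-a)))"
    by (intro sum.cong refl) (auto simp: sum.delta)
  also have "\<dots> = (\<Sum>a\<in>{..n} \<union> {n<..2*n+1}. (if a \<le> n then 1 else -1) * (u $ a * v $ (2*n+1-a)))"
    by (intro sum.cong) auto
  also have "\<dots> = (\<Sum>a\<le>n. u $ a * v $ (2*n+1-a)) +
      (\<Sum>a\<in>{n<..2*n+1}. - (u $ a * v $ (2*n+1-a)))"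
    by (subst sum.union_disjoint) auto
  also have "(\<Sum>a\<in>{n<..2*n+1}. - (u $ a * v $ (2*n+1-a))) =
      (\<Sum>a\<le>n. - (u $ (2*n+1-a) * v $ a))"
    by (rule sum.reindex_bij_witness [of _ "\<lambda>a. 2*n+1-a" "\<lambda>a. 2*n+1-a"]) auto
  also have "(\<Sum>a\<le>n. u $ a * v $ (2*n+1-a)) + (\<Sum>a\<le>n. - (u $ (2*n+1-a) * v $ a)) =
      symp_form n u v"
    by (simp add: symp_form_def sum_subtractf sum_negf)
  finally show ?thesis by simp
qed

lemma contraction_pure:
  assumes "set vs \<subseteq> carrier_vec (2 * n + 2)" "p < q" "q < length vs"
  shows "contraction (2 * n + 2) (symp_form n) p q (pure_tensor vs) =
    tensor_scale (symp_form n (vs ! p) (vs ! q)) (pure_tensor (nths vs (- {p, q})))"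
proof
  fix u
  define xs where "xs = take p vs"
  define ys where "ys = take (q - p - 1) (drop (Suc p) vs)"
  define zs where "zs = drop (Suc q) vs"
  let ?v = "vs ! p" and ?v' = "vs ! q"
  have vs: "vs = xs @ ?v # ys @ ?v' # zs"
  proof -
    have "drop (q - p - 1) (drop (Suc p) vs) = drop q vs" using assms by simp
    then have "drop (Suc p) vs = ys @ ?v' # zs"
      unfolding ys_def zs_def
      using append_take_drop_id [of "q - p - 1" "drop (Suc p) vs"] assms
      by (metis Cons_nth_drop_Suc)
    then show ?thesis
      unfolding xs_def using id_take_nth_drop [of p vs] assms by simp
  qed
  have len: "length xs = p" "length ys = q - p - 1" "length zs = length vs - Suc q"
    using assms by (auto simp: xs_def ys_def zs_def)
  have *: "nths vs (- {p, q}) = xs @ ys @ zs"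
  proof -
    have "nths xs (- {p, q}) = xs"
      by (rule nths_all) (use len assms in auto)
    moreover have "nths ys {j. j + Suc p \<in> - {p, q}} = ys"
      by (rule nths_all) (use len assms in auto)
    moreover have "nths zs {j. j + (Suc q) \<in> - {p, q}} = zs"
      by (rule nths_all) (use len assms in auto)
    ultimately show ?thesis
      using assms len
      by (subst vs, simp add: nths_append nths_Cons)
  qed
  let ?c = "\<lambda>a b. coord ?v a * coord ?v' b"
  have mem: "?v \<in> carrier_vec (2 * n + 2)" "?v' \<in> carrier_vec (2 * n + 2)"
    using assms by (auto simp: subset_iff)
  have key: "pure_tensor vs (insert_at q b (insert_at p a u)) =
      ?c a b * pure_tensor (xs @ ys @ zs) u" for a b
  proof (cases "length u = length vs - 2")
    case True
    define x where "x = take p u"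
    define y where "y = take (q - p - 1) (drop p u)"
    define z where "z = drop (q - 1) u"
    have lens: "length x = p" "length y = q - p - 1" "length z = length vs - Suc q"
      using True assms by (auto simp: x_def y_def z_def)
    have "y @ z = drop p u"
      unfolding y_def z_def
      using append_take_drop_id [of "q - p - 1" "drop p u"] assms by simp
    then have u: "u = x @ y @ z" by (simp add: x_def)
    have "insert_at q b (insert_at p a u) = x @ a # y @ b # z"
      using lens assms by (simp add: u insert_at_def take_Cons' drop_Cons')
    moreover have "pure_tensor (xs @ ?v # ys @ ?v' # zs) (x @ a # y @ b # z) =
        ?c a b * pure_tensor (xs @ ys @ zs) (x @ y @ z)"
      using lens len by (simp add: pure_tensor_append pure_tensor_Cons)
    ultimately show ?thesis using vs u by metis
  next
    case False
    have "length (insert_at q b (insert_at p a u)) = length u + 2"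
      by (simp add: length_insert_at)
    moreover have "length (xs @ ys @ zs) = length vs - 2" using len assms by simp
    ultimately show ?thesis using False assms by (simp add: pure_tensor_def)
  qed
  show "contraction (2 * n + 2) (symp_form n) p q (pure_tensor vs) u =
      tensor_scale (symp_form n ?v ?v') (pure_tensor (nths vs (- {p, q}))) u"
    unfolding contraction_def key * tensor_scale_def symp_form_expand [OF mem]
    by (simp only: sum_distrib_right mult.assoc)
qed

text \<open>The action of an endomorphism \<open>f\<close> of \<open>E\<close> on the tensor powers of \<open>E\<close> by derivations, written in
  the basis of \<open>E\<close> formed by the \<open>e\<^sub>a\<close> with \<open>a \<noteq> n + 1\<close>; see \<open>tensor_derivation_pure\<close> below.\<close>

definition tensor_derivation :: "nat \<Rightarrow> (complex vec \<Rightarrow> complex vec) \<Rightarrow> tensor \<Rightarrow> tensor" where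
  "tensor_derivation n f t = (\<lambda>w. \<Sum>i<length w. \<Sum>a\<in>{..<2 * n + 2} - {n + 1}.
     coord (f (unit_vec (2 * n + 2) a)) (w ! i) * t (w[i := a]))"

lemma odd_space_iff:
  "v \<in> odd_space n \<longleftrightarrow> v \<in> carrier_vec (2 * n + 2) \<and> v $ (n + 1) = 0"
proof -
  have "symp_form n (unit_vec (2 * n + 2) n) v = v $ (n + 1)"
  proof -
    have "symp_form n (unit_vec (2 * n + 2) n) v = (\<Sum>i\<le>n. if i = n then v $ (n + 1) else 0)"
      unfolding symp_form_def
      by (intro sum.cong) (auto simp: unit_vec_def)
    then show ?thesis by simp
  qed
  then show ?thesis by (simp add: odd_space_def)
qed

lemma linear_endo_coord:
  assumes f: "linear_endo n f" and v: "v \<in> odd_space n"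
  shows "coord (f v) k =
    (\<Sum>a\<in>{..<2 * n + 2} - {n + 1}. coord (f (unit_vec (2 * n + 2) a)) k * coord v a)"
proof -
  let ?N = "2 * n + 2"
  have carr: "f w \<in> carrier_vec ?N \<and> f w \<in> odd_space n" if "w \<in> odd_space n" for w
    using f that by (auto simp: linear_endo_def odd_space_def)
  have unit: "unit_vec ?N a \<in> odd_space n" if "a \<noteq> n + 1" for a
    using that by (auto simp: odd_space_iff unit_vec_def)
  have addf: "f (x + y) = f x + f y" if "x \<in> odd_space n" "y \<in> odd_space n" for x y
    using f that by (auto simp: linear_endo_def)
  have scf: "f (c \<cdot>\<^sub>v x) = c \<cdot>\<^sub>v f x" if "x \<in> odd_space n" for x c
    using f that by (auto simp: linear_endo_def)
  have part: "coord (f (vec ?N (\<lambda>a. if a \<in> A then v $ a else 0))) k =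
      (\<Sum>a\<in>A. coord (f (unit_vec ?N a)) k * v $ a)"
    if "finite A" "A \<subseteq> {..<?N} - {n + 1}" for A
    using that
  proof (induction A rule: finite_induct)
    case empty
    have z: "vec ?N (\<lambda>a. 0) \<in> odd_space n" by (auto simp: odd_space_iff)
    have "vec ?N (\<lambda>a. 0) = 0 \<cdot>\<^sub>v vec ?N (\<lambda>a. 0 :: complex)" by auto
    then have "f (vec ?N (\<lambda>a. 0)) = 0 \<cdot>\<^sub>v f (vec ?N (\<lambda>a. 0))" using scf z by metis
    then have "coord (f (vec ?N (\<lambda>a. 0))) k = 0"
      unfolding coord_def by (metis index_smult_vec(1) mult_zero_left index_smult_vec(2))
    then show ?case by simp
  next
    case (insert b B)
    let ?x = "vec ?N (\<lambda>a. if a \<in> B then v $ a else 0)"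
    have x: "?x \<in> odd_space n" using insert by (auto simp: odd_space_iff)
    have b: "unit_vec ?N b \<in> odd_space n" using insert unit by auto
    have sb: "v $ b \<cdot>\<^sub>v unit_vec ?N b \<in> odd_space n" using b by (auto simp: odd_space_iff)
    have "vec ?N (\<lambda>a. if a \<in> insert b B then v $ a else 0) = v $ b \<cdot>\<^sub>v unit_vec ?N b + ?x"
      using insert by (intro eq_vecI) auto
    then have "f (vec ?N (\<lambda>a. if a \<in> insert b B then v $ a else 0)) =
        v $ b \<cdot>\<^sub>v f (unit_vec ?N b) + f ?x"
      using addf [OF sb x] scf [OF b] by simp
    moreover have "coord (v $ b \<cdot>\<^sub>v f (unit_vec ?N b) + f ?x) k =
        v $ b * coord (f (unit_vec ?N b)) k + coord (f ?x) k"
      using carr [OF b] carr [OF x] by (auto simp: coord_def)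
    ultimately show ?case using insert by simp
  qed
  have "v = vec ?N (\<lambda>a. if a \<in> {..<?N} - {n + 1} then v $ a else 0)"
    using v by (intro eq_vecI) (auto simp: odd_space_iff)
  then have "coord (f v) k = (\<Sum>a\<in>{..<?N} - {n + 1}. coord (f (unit_vec ?N a)) k * v $ a)"
    using part [of "{..<?N} - {n + 1}"] by simp
  also have "\<dots> = (\<Sum>a\<in>{..<?N} - {n + 1}. coord (f (unit_vec ?N a)) k * coord v a)"
    using v by (intro sum.cong) (auto simp: coord_def odd_space_def)
  finally show ?thesis .
qed

lemma pure_tensor_update:
  assumes "length w = length vs" "i < length vs"
  shows "pure_tensor vs (w[i := a]) =
      coord (vs ! i) a * (\<Prod>j\<in>{..<length vs} - {i}. coord (vs ! j) (w ! j))"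
    and "pure_tensor (vs[i := v]) w =
      coord v (w ! i) * (\<Prod>j\<in>{..<length vs} - {i}. coord (vs ! j) (w ! j))"
  using assms by (auto simp: pure_tensor_def prod.remove [of "{..<length vs}" i])

lemma tensor_derivation_pure:
  assumes f: "linear_endo n f" and vs: "set vs \<subseteq> odd_space n"
  shows "tensor_derivation n f (pure_tensor vs) =
    (\<Sum>i<length vs. pure_tensor (vs[i := f (vs ! i)]))"
proof
  fix w
  have sum_app: "(\<Sum>i\<in>A. g i) w = (\<Sum>i\<in>A. g i w)" if "finite A" for A and g :: "nat \<Rightarrow> tensor"
    using that by (induction A rule: finite_induct) auto
  show "tensor_derivation n f (pure_tensor vs) w =
      (\<Sum>i<length vs. pure_tensor (vs[i := f (vs ! i)])) w"
  proof (cases "length w = length vs")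
    case True
    have "(\<Sum>a\<in>{..<2 * n + 2} - {n + 1}.
          coord (f (unit_vec (2 * n + 2) a)) (w ! i) * pure_tensor vs (w[i := a])) =
        pure_tensor (vs[i := f (vs ! i)]) w" if i: "i < length vs" for i
    proof -
      have "vs ! i \<in> odd_space n" using vs i by auto
      then show ?thesis
        unfolding pure_tensor_update [OF True i]
        by (simp only: linear_endo_coord [OF f] sum_distrib_right mult.assoc)
    qed
    then show ?thesis using True by (simp add: tensor_derivation_def sum_app)
  next
    case False
    then show ?thesis by (simp add: tensor_derivation_def sum_app pure_tensor_def)
  qed
qed


section \<open>Schur powers\<close>

text \<open>A partition is a weakly decreasing list. A tableau is a numbering of the boxes of its diagram by
  \<open>0, \<dots>, d - 1\<close>, each number being used once; it need not be standard.\<close>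

definition boxes :: "nat list \<Rightarrow> (nat \<times> nat) set" where
  "boxes lam = {(i, j). i < length lam \<and> j < lam ! i}"

definition tableau :: "nat list \<Rightarrow> (nat \<times> nat \<Rightarrow> nat) \<Rightarrow> bool" where
  "tableau lam T \<longleftrightarrow> bij_betw T (boxes lam) {..<sum_list lam}"

definition row_group :: "nat list \<Rightarrow> (nat \<times> nat \<Rightarrow> nat) \<Rightarrow> (nat \<Rightarrow> nat) set" where
  "row_group lam T = {\<sigma>. \<sigma> permutes {..<sum_list lam} \<and>
    (\<forall>i. \<sigma> ` T ` {b \<in> boxes lam. fst b = i} = T ` {b \<in> boxes lam. fst b = i})}"

definition column_group :: "nat list \<Rightarrow> (nat \<times> nat \<Rightarrow> nat) \<Rightarrow> (nat \<Rightarrow> nat) set" where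
  "column_group lam T = {\<sigma>. \<sigma> permutes {..<sum_list lam} \<and>
    (\<forall>j. \<sigma> ` T ` {b \<in> boxes lam. snd b = j} = T ` {b \<in> boxes lam. snd b = j})}"

text \<open>The right action of \<open>c\<^sub>T = a\<^sub>T b\<^sub>T\<close>, where \<open>a\<^sub>T\<close> is the sum of the row permutations and \<open>b\<^sub>T\<close> the
  signed sum of the column permutations. Since the action is on the right, a tensor is first
  symmetrized along the rows.\<close>

definition young_symmetrizer :: "nat list \<Rightarrow> (nat \<times> nat \<Rightarrow> nat) \<Rightarrow> tensor \<Rightarrow> tensor" where
  "young_symmetrizer lam T t = (\<Sum>p\<in>row_group lam T. \<Sum>q\<in>column_group lam T.
     tensor_scale (of_int (sign q)) (tensor_perm (p \<circ> q) t))"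

definition schur_power ::
  "complex vec set \<Rightarrow> nat list \<Rightarrow> (nat \<times> nat \<Rightarrow> nat) \<Rightarrow> tensor set" where
  "schur_power V lam T = young_symmetrizer lam T ` tensor_power V (sum_list lam)"

definition traceless_schur_power ::
  "nat \<Rightarrow> (complex vec \<Rightarrow> complex vec \<Rightarrow> complex) \<Rightarrow> complex vec set \<Rightarrow>
    nat list \<Rightarrow> (nat \<times> nat \<Rightarrow> nat) \<Rightarrow> tensor set" where
  "traceless_schur_power N \<omega> V lam T = schur_power V lam T \<inter>
    {t. \<forall>p q. p < q \<and> q < sum_list lam \<longrightarrow> contraction N \<omega> p q t = 0}"


section \<open>Highest weight vectors\<close>

text \<open>The weight is \<open>lam ! 0 * \<epsilon>\<^sub>0 + \<dots> + lam ! n * \<epsilon>\<^sub>n\<close>. The strictly upper triangular matrices in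
  \<^term>\<open>sp n\<close> are the sum of the positive root spaces.\<close>

definition highest_weight_vector ::
  "nat \<Rightarrow> (complex \<Rightarrow> 'v::ab_group_add \<Rightarrow> 'v) \<Rightarrow> 'v set \<Rightarrow> (complex mat \<Rightarrow> 'v \<Rightarrow> 'v) \<Rightarrow>
    nat list \<Rightarrow> 'v \<Rightarrow> bool" where
  "highest_weight_vector n scale V act lam v \<longleftrightarrow> v \<in> V \<and> v \<noteq> 0 \<and>
    (\<forall>X\<in>sp n. (\<forall>i<2 * n + 2. \<forall>j\<le>i. X $$ (i, j) = 0) \<longrightarrow> act X v = 0) \<and>
    (\<forall>X\<in>sp n. diagonal_mat X \<longrightarrow>
      act X v = scale (\<Sum>i\<le>n. of_nat (lam ! i) * X $$ (i, i)) v)"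

end

theory Submission
  imports Defs "HOL-Library.Product_Plus"
begin

text \<open>Write \<open>N = 2n + 2\<close>, \<open>d = |\<lambda>|\<close>, let \<open>W\<close> be the traceless Schur power of \<open>E\<close>, and let \<open>L\<close> be the
  Lagrangian subspace spanned by \<open>e\<^sub>0, \<dots>, e\<^sub>n\<close>. Everything takes place in the tensor power of \<open>\<complex>\<^sup>N\<close>, on
  which \<open>sp\<close> acts by derivations; the tensors in \<open>W\<close> only involve letters other than \<open>n + 1\<close>, and the
  action of the stabilizer of the line \<open>\<complex>e\<^sub>n\<close> on \<open>W\<close> is the restriction of the derivation action.

  Let \<open>e\<^sub>T\<close> be the basis tensor with \<open>e\<^sub>i\<close> at all places of row \<open>i\<close> of the tableau. Its image \<open>t\<^sub>0\<close> under the
  Young symmetrizer lies in \<open>W\<close>, because all letters are at most \<open>n\<close>, and it is a highest weight vector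
  of weight \<open>\<lambda>\<close>. The \<open>sp\<close>-module generated by \<open>t\<^sub>0\<close> is isomorphic to the simple module \<open>V\<close>: the
  submodule of the direct sum generated by \<open>(v, t\<^sub>0)\<close> is the graph of an isomorphism
  (\<open>highest_weight_isomorphism\<close>). So the theorem says that \<open>W\<close> is generated by \<open>t\<^sub>0\<close> under the
  intermediate algebra. As \<open>W\<close> is stable, the point is that \<open>t\<^sub>0\<close> generates enough
  (\<open>odd_schur_generated\<close>), and this is done in two steps.

  First, \<open>W\<close> is generated by its intersection with the tensors over \<open>L\<close> under the operators that send
  \<open>e\<^sub>a\<close> to \<open>e\<^bsub>2n+1-b\<^esub>\<close> and \<open>e\<^sub>b\<close> to \<open>e\<^bsub>2n+1-a\<^esub>\<close> for \<open>a, b < n\<close>. Second, the Schur power of \<open>L\<close> is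
  generated by \<open>t\<^sub>0\<close> under the strictly lower triangular matrices of \<open>gl(L)\<close>. All these operators kill \<open>e\<^sub>n\<close>, so
  they belong to the intermediate algebra. In both steps the adjoints, for the standard Hermitian form,
  of these operators are raising operators, and a nonzero tensor that is orthogonal to the generated
  subspace and has the least possible degree is killed by them (\<open>orthogonal_descent\<close>). It remains to see
  that no such tensor exists. In the first step a sum of squares shows that a traceless tensor killed by the
  raising operators is a tensor over \<open>L\<close> (\<open>traceless_siegel_killed\<close>). In the second step it is the
  uniqueness of the highest weight vector in a Schur power, in the form that such a vector is zero if
  it is orthogonal to \<open>t\<^sub>0\<close> (\<open>lagrangian_schur_power_generated\<close>).\<close>

text \<open>Sums over \<open>{..<2*n+2}\<close> are kept whole; these rules would split off their last two terms.\<close>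

declare sum.lessThan_Suc [simp del] add_2_eq_Suc' [simp del] add_2_eq_Suc [simp del]

interpretation tensor: vector_space tensor_scale
  by (rule vector_space_tensor_scale)

section \<open>Tensors with letters in a given set\<close>

definition words :: "nat set \<Rightarrow> nat \<Rightarrow> nat list set" where
  "words A d = {w. set w \<subseteq> A \<and> length w = d}"

definition word_space :: "nat set \<Rightarrow> nat \<Rightarrow> tensor set" where
  "word_space A d = {t. \<forall>w. t w \<noteq> 0 \<longrightarrow> w \<in> words A d}"

lemma finite_words: "finite A \<Longrightarrow> finite (words A d)"
  unfolding words_def by (rule finite_lists_length_eq)

lemma words_update: "w \<in> words A d \<Longrightarrow> a \<in> A \<Longrightarrow> w[i := a] \<in> words A d"
  using set_update_subset_insert[of w i a] by (auto simp: words_def)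

lemma words_nth: "w \<in> words A d \<Longrightarrow> i < d \<Longrightarrow> w ! i \<in> A"
  by (auto simp: words_def)

lemma word_space_zero: "t \<in> word_space A d \<Longrightarrow> w \<notin> words A d \<Longrightarrow> t w = 0"
  by (auto simp: word_space_def)

lemma word_space_mono: "A \<subseteq> B \<Longrightarrow> word_space A d \<subseteq> word_space B d"
  by (fastforce simp: word_space_def words_def)

lemma sum_tensor: "(\<Sum>i\<in>I. f i :: tensor) w = (\<Sum>i\<in>I. f i w)"
  by (induction I rule: infinite_finite_induct) auto

lemma scale_tensor: "tensor_scale c t w = c * t w"
  by (simp add: tensor_scale_def)

lemma subspace_word_space: "tensor.subspace (word_space A d)"
proof (rule tensor.subspaceI)
  show "x + y \<in> word_space A d" if "x \<in> word_space A d" "y \<in> word_space A d" for x y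
    using that unfolding word_space_def mem_Collect_eq plus_fun_apply
    by (metis add.right_neutral)
qed (auto simp: word_space_def scale_tensor)

definition basis_tensor :: "nat list \<Rightarrow> tensor" where
  "basis_tensor w = (\<lambda>u. if u = w then 1 else 0)"

lemma basis_tensor_word_space: "w \<in> words A d \<Longrightarrow> basis_tensor w \<in> word_space A d"
  by (auto simp: basis_tensor_def word_space_def)

lemma word_space_expand:
  assumes "finite A" "t \<in> word_space A d"
  shows "t = (\<Sum>w\<in>words A d. tensor_scale (t w) (basis_tensor w))"
proof
  fix u
  have "(\<Sum>w\<in>words A d. tensor_scale (t w) (basis_tensor w)) u =
      (\<Sum>w\<in>words A d. if w = u then t w else 0)"
    unfolding sum_tensor by (intro sum.cong) (auto simp: basis_tensor_def scale_tensor)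
  also have "\<dots> = t u"
    using assms by (auto simp: finite_words word_space_zero)
  finally show "t u = (\<Sum>w\<in>words A d. tensor_scale (t w) (basis_tensor w)) u" by simp
qed

lemma word_space_eq_span:
  assumes "finite A"
  shows "word_space A d = tensor.span (basis_tensor ` words A d)"
proof
  show "tensor.span (basis_tensor ` words A d) \<subseteq> word_space A d"
    by (rule tensor.span_minimal) (auto simp: subspace_word_space basis_tensor_word_space)
  show "word_space A d \<subseteq> tensor.span (basis_tensor ` words A d)"
  proof
    fix t assume "t \<in> word_space A d"
    then have "t = (\<Sum>w\<in>words A d. tensor_scale (t w) (basis_tensor w))"
      by (rule word_space_expand[OF assms])
    also have "\<dots> \<in> tensor.span (basis_tensor ` words A d)"
      by (intro tensor.span_sum tensor.span_scale tensor.span_base) auto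
    finally show "t \<in> tensor.span (basis_tensor ` words A d)" .
  qed
qed

text \<open>For a subspace spanned by basis vectors, the tensor power is given by a condition on the letters.\<close>

lemma tensor_power_eq_word_space:
  assumes carr: "V \<subseteq> carrier_vec N"
    and supp: "\<And>v a. v \<in> V \<Longrightarrow> a < N \<Longrightarrow> a \<notin> A \<Longrightarrow> v $ a = 0"
    and A: "A \<subseteq> {..<N}" and units: "\<And>a. a \<in> A \<Longrightarrow> unit_vec N a \<in> V"
  shows "tensor_power V d = word_space A d"
proof
  have fin: "finite A" using A finite_subset by blast
  have "pure_tensor vs \<in> word_space A d" if "length vs = d" "set vs \<subseteq> V" for vs
  proof -
    have "w \<in> words A d" if w: "pure_tensor vs w \<noteq> 0" for w
    proof -
      have len: "length w = d"
        using w \<open>length vs = d\<close> by (auto simp: pure_tensor_def split: if_splits)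
      have "w ! i \<in> A" if i: "i < d" for i
      proof -
        have "vs ! i \<in> V" using i \<open>length vs = d\<close> \<open>set vs \<subseteq> V\<close> by auto
        moreover have "coord (vs ! i) (w ! i) \<noteq> 0"
          using w i len \<open>length vs = d\<close> by (auto simp: pure_tensor_def)
        ultimately show ?thesis
          using carr supp by (fastforce simp: coord_def split: if_splits)
      qed
      then show ?thesis using len by (auto simp: words_def in_set_conv_nth)
    qed
    then show ?thesis by (auto simp: word_space_def)
  qed
  then show "tensor_power V d \<subseteq> word_space A d"
    unfolding tensor_power_def
    by (intro tensor.span_minimal) (auto simp: subspace_word_space)
  have "basis_tensor w \<in> tensor_power V d" if w: "w \<in> words A d" for w
  proof -
    have c: "coord (unit_vec N a) b = (if b = a then 1 else 0)" if "a \<in> A" for a b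
      using that A by (auto simp: coord_def unit_vec_def)
    have "pure_tensor (map (unit_vec N) w) = basis_tensor w"
    proof
      fix u
      show "pure_tensor (map (unit_vec N) w) u = basis_tensor w u"
      proof (cases "length u = length w")
        case True
        have "pure_tensor (map (unit_vec N) w) u = (\<Prod>i<length w. if u ! i = w ! i then 1 else 0)"
          unfolding pure_tensor_def using True w
          by (auto intro!: prod.cong simp: c words_def subset_iff)
        also have "\<dots> = basis_tensor w u"
          using True by (auto simp: basis_tensor_def list_eq_iff_nth_eq)
        finally show ?thesis .
      qed (auto simp: pure_tensor_def basis_tensor_def)
    qed
    moreover have "pure_tensor (map (unit_vec N) w) \<in> tensor_power V d"
      unfolding tensor_power_def
      using w units
      by (intro tensor.span_base CollectI exI[of _ "map (unit_vec N) w"]) (auto simp: words_def)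
    ultimately show ?thesis by simp
  qed
  then show "word_space A d \<subseteq> tensor_power V d"
    unfolding word_space_eq_span[OF fin] tensor_power_def
    by (intro tensor.span_minimal) auto
qed

section \<open>The Hermitian form\<close>

definition hermitian :: "nat \<Rightarrow> nat \<Rightarrow> tensor \<Rightarrow> tensor \<Rightarrow> complex" where
  "hermitian N d s t = (\<Sum>w\<in>words {..<N} d. s w * cnj (t w))"

lemma hermitian_add_left: "hermitian N d (s + s') t = hermitian N d s t + hermitian N d s' t"
  by (simp add: hermitian_def algebra_simps sum.distrib)

lemma hermitian_add_right: "hermitian N d t (s + s') = hermitian N d t s + hermitian N d t s'"
  by (simp add: hermitian_def algebra_simps sum.distrib)

lemma hermitian_diff_left: "hermitian N d (s - s') t = hermitian N d s t - hermitian N d s' t"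
  by (simp add: hermitian_def algebra_simps sum_subtractf)

lemma hermitian_scale_left: "hermitian N d (tensor_scale c s) t = c * hermitian N d s t"
  by (simp add: hermitian_def scale_tensor algebra_simps sum_distrib_left)

lemma hermitian_scale_right: "hermitian N d s (tensor_scale c t) = cnj c * hermitian N d s t"
  by (simp add: hermitian_def scale_tensor algebra_simps sum_distrib_left)

lemma hermitian_zero [simp]: "hermitian N d 0 t = 0" "hermitian N d t 0 = 0"
  by (simp_all add: hermitian_def)

lemma hermitian_sum_left: "hermitian N d (\<Sum>i\<in>I. f i) t = (\<Sum>i\<in>I. hermitian N d (f i) t)"
  unfolding hermitian_def sum_tensor sum_distrib_right by (rule sum.swap)

lemma hermitian_sum_right: "hermitian N d t (\<Sum>i\<in>I. f i) = (\<Sum>i\<in>I. hermitian N d t (f i))"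
  unfolding hermitian_def sum_tensor cnj_sum sum_distrib_left by (rule sum.swap)

lemma hermitian_cnj: "cnj (hermitian N d s t) = hermitian N d t s"
  by (simp add: hermitian_def mult.commute)

lemma hermitian_self: "hermitian N d t t = of_real (\<Sum>w\<in>words {..<N} d. (cmod (t w))\<^sup>2)"
  by (simp add: hermitian_def complex_norm_square del: of_real_power)

lemma hermitian_self_eq_0:
  assumes "t \<in> word_space {..<N} d" "hermitian N d t t = 0"
  shows "t = 0"
proof
  fix w
  have "(\<Sum>w\<in>words {..<N} d. (cmod (t w))\<^sup>2) = 0"
    using assms(2) unfolding hermitian_self by (simp only: of_real_eq_0_iff)
  then have "\<forall>w\<in>words {..<N} d. (cmod (t w))\<^sup>2 = 0"
    by (subst (asm) sum_nonneg_eq_0_iff) (auto simp: finite_words)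
  then show "t w = 0 w"
    using assms(1) by (cases "w \<in> words {..<N} d") (auto simp: word_space_zero)
qed

lemma hermitian_basis_tensor:
  "w \<in> words {..<N} d \<Longrightarrow> hermitian N d t (basis_tensor w) = t w"
  by (simp add: hermitian_def basis_tensor_def if_distrib finite_words cong: if_cong)

lemma orthogonal_projection_span:
  assumes "finite B" "B \<subseteq> word_space {..<N} d"
  shows "t \<in> word_space {..<N} d \<Longrightarrow>
    \<exists>z\<in>tensor.span B. \<forall>y\<in>tensor.span B. hermitian N d (t - z) y = 0"
  using assms
proof (induction B arbitrary: t rule: finite_induct)
  case empty
  show ?case unfolding tensor.span_empty by (metis hermitian_zero(2) singletonD singletonI)
next
  case (insert b B)
  have sub: "tensor.span B \<subseteq> word_space {..<N} d"
    using insert.prems by (intro tensor.span_minimal subspace_word_space) auto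
  from insert obtain z where z: "z \<in> tensor.span B"
    and tz: "\<forall>y\<in>tensor.span B. hermitian N d (t - z) y = 0" by blast
  from insert obtain b' where b': "b' \<in> tensor.span B"
    and bb: "\<forall>y\<in>tensor.span B. hermitian N d (b - b') y = 0" by blast
  define e where "e = b - b'"
  have e: "e \<in> word_space {..<N} d"
    unfolding e_def using insert.prems b' sub
    by (intro tensor.subspace_diff subspace_word_space) auto
  define c where "c = hermitian N d (t - z) e / hermitian N d e e"
  let ?z = "z + tensor_scale c e"
  have mono: "tensor.span B \<subseteq> tensor.span (insert b B)"
    by (rule tensor.span_mono) auto
  have espan: "e \<in> tensor.span (insert b B)"
    unfolding e_def using subsetD[OF mono b'] by (intro tensor.span_diff) (auto intro: tensor.span_base)
  have "?z \<in> tensor.span (insert b B)"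
    using z mono espan by (intro tensor.span_add tensor.span_scale) auto
  moreover have "hermitian N d (t - ?z) y = 0" if "y \<in> tensor.span (insert b B)" for y
  proof -
    \<comment> \<open>Gram-Schmidt: \<open>e\<close> is the component of \<open>b\<close> orthogonal to the span of \<open>B\<close>.\<close>
    from that obtain k where k: "y - tensor_scale k b \<in> tensor.span B"
      unfolding tensor.span_insert by blast
    define y' where "y' = y - tensor_scale k b + tensor_scale k b'"
    have y': "y' \<in> tensor.span B"
      unfolding y'_def using k b' by (intro tensor.span_add tensor.span_scale)
    have y: "y = y' + tensor_scale k e"
      by (auto simp: y'_def e_def algebra_simps)
    have 1: "hermitian N d (t - ?z) e = 0"
    proof (cases "e = 0")
      case False
      then have "hermitian N d e e \<noteq> 0" using hermitian_self_eq_0[OF e] by blast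
      then show ?thesis
        by (simp add: hermitian_diff_left hermitian_add_left hermitian_scale_left c_def)
    qed simp
    have 2: "hermitian N d (t - ?z) y' = 0"
      using tz bb y' by (simp add: hermitian_diff_left hermitian_add_left hermitian_scale_left e_def)
    show ?thesis
      by (simp add: y hermitian_add_right hermitian_scale_right 1 2)
  qed
  ultimately show ?case by blast
qed

lemma orthogonal_projection:
  assumes Z: "tensor.subspace Z" "Z \<subseteq> word_space {..<N} d" and t: "t \<in> word_space {..<N} d"
  obtains z where "z \<in> Z" "\<And>y. y \<in> Z \<Longrightarrow> hermitian N d (t - z) y = 0"
proof -
  obtain B where B: "B \<subseteq> Z" "tensor.independent B" "Z \<subseteq> tensor.span B"
    by (rule tensor.maximal_independent_subset)
  then have "B \<subseteq> tensor.span (basis_tensor ` words {..<N} d)"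
    using Z(2) by (simp add: word_space_eq_span)
  then have fin: "finite B"
    using tensor.independent_span_bound[of "basis_tensor ` words {..<N} d" B] B
    by (auto simp: finite_words)
  have "tensor.span B = Z"
    using B Z(1) by (simp add: tensor.span_minimal subset_antisym)
  then show thesis
    using orthogonal_projection_span[OF fin _ t] B Z(2) that by blast
qed

section \<open>Matrices acting by derivations\<close>

text \<open>A word with a letter \<open>\<ge> N\<close> gets the value 0, since the entries of \<open>X\<close> are unspecified out of range.\<close>

definition derivation :: "nat \<Rightarrow> complex mat \<Rightarrow> tensor \<Rightarrow> tensor" where
  "derivation N X t = (\<lambda>w. if set w \<subseteq> {..<N}
     then \<Sum>i<length w. \<Sum>a<N. X $$ (w ! i, a) * t (w[i := a]) else 0)"

lemma derivation_nonzeroE: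
  assumes "derivation N X t w \<noteq> 0"
  obtains i a where "set w \<subseteq> {..<N}" "i < length w" "a < N" "X $$ (w ! i, a) \<noteq> 0" "t (w[i := a]) \<noteq> 0"
proof -
  have w: "set w \<subseteq> {..<N}" and
    "(\<Sum>i<length w. \<Sum>a<N. X $$ (w ! i, a) * t (w[i := a])) \<noteq> 0"
    using assms by (auto simp: derivation_def split: if_splits)
  then obtain i where i: "i < length w" and "(\<Sum>a<N. X $$ (w ! i, a) * t (w[i := a])) \<noteq> 0"
    by (auto elim: sum.not_neutral_contains_not_neutral)
  then obtain a where "a < N" "X $$ (w ! i, a) * t (w[i := a]) \<noteq> 0"
    by (auto elim: sum.not_neutral_contains_not_neutral)
  then show thesis using that w i by auto
qed

lemma derivation_word_space:
  assumes A: "A \<subseteq> {..<N}" and X: "\<And>a b. a \<in> A \<Longrightarrow> b < N \<Longrightarrow> b \<notin> A \<Longrightarrow> X $$ (b, a) = 0"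
    and t: "t \<in> word_space A d"
  shows "derivation N X t \<in> word_space A d"
proof -
  have "w \<in> words A d" if nz: "derivation N X t w \<noteq> 0" for w
  proof -
    from nz obtain i a where *: "set w \<subseteq> {..<N}" "i < length w" "a < N" "X $$ (w ! i, a) \<noteq> 0"
      "t (w[i := a]) \<noteq> 0" by (rule derivation_nonzeroE)
    then have w: "w[i := a] \<in> words A d" using t by (auto simp: word_space_def)
    then have "a \<in> A" using words_nth[OF w, of i] *(2) by (auto simp: words_def)
    have "w ! i < N" using *(1,2) nth_mem by blast
    then have "w ! i \<in> A" using X[OF \<open>a \<in> A\<close>] *(4) by blast
    then have "(w[i := a])[i := w ! i] \<in> words A d" by (rule words_update[OF w])
    then show ?thesis by simp
  qed
  then show ?thesis by (auto simp: word_space_def)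
qed

lemma derivation_word_space_full:
  "t \<in> word_space {..<N} d \<Longrightarrow> derivation N X t \<in> word_space {..<N} d"
  by (rule derivation_word_space) auto

lemma derivation_add: "derivation N X (s + t) = derivation N X s + derivation N X t"
  by (rule ext) (simp add: derivation_def algebra_simps sum.distrib)

lemma derivation_scale: "derivation N X (tensor_scale c t) = tensor_scale c (derivation N X t)"
  by (rule ext) (simp add: derivation_def scale_tensor algebra_simps sum_distrib_left)

lemma derivation_zero [simp]: "derivation N X 0 = 0"
  by (rule ext) (simp add: derivation_def)

lemma derivation_sum: "derivation N X (\<Sum>i\<in>I. f i) = (\<Sum>i\<in>I. derivation N X (f i))"
proof (induction I rule: infinite_finite_induct)
  case (insert x F)
  then show ?case unfolding sum.insert[OF insert.hyps(1,2)] derivation_add by simp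
next
  case (infinite I)
  show ?case unfolding sum.infinite[OF infinite] by (rule derivation_zero)
next
  case empty
  show ?case unfolding sum.empty by (rule derivation_zero)
qed

lemma derivation_mat_add:
  assumes "X \<in> carrier_mat N N" "Y \<in> carrier_mat N N"
  shows "derivation N (X + Y) t = derivation N X t + derivation N Y t"
proof
  fix w
  have "set w \<subseteq> {..<N} \<Longrightarrow> i < length w \<Longrightarrow> w ! i < N" for i using nth_mem by blast
  then show "derivation N (X + Y) t w = (derivation N X t + derivation N Y t) w"
    using assms by (simp add: derivation_def sum.distrib [symmetric] algebra_simps)
qed

lemma derivation_smult:
  assumes "X \<in> carrier_mat N N"
  shows "derivation N (c \<cdot>\<^sub>m X) t = tensor_scale c (derivation N X t)"
proof
  fix w
  have "set w \<subseteq> {..<N} \<Longrightarrow> i < length w \<Longrightarrow> w ! i < N" for i using nth_mem by blast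
  then show "derivation N (c \<cdot>\<^sub>m X) t w = tensor_scale c (derivation N X t) w"
    using assms by (simp add: derivation_def scale_tensor sum_distrib_left algebra_simps)
qed

text \<open>The terms of \<open>X\<close> and \<open>Y\<close> acting at different positions commute, so that only the terms where both act at
  the same position contribute to the commutator.\<close>

lemma derivation_bracket:
  assumes X: "X \<in> carrier_mat N N" and Y: "Y \<in> carrier_mat N N"
  shows "derivation N (X * Y - Y * X) t =
    derivation N X (derivation N Y t) - derivation N Y (derivation N X t)"
proof
  fix w :: "nat list"
  let ?l = "length w"
  show "derivation N (X * Y - Y * X) t w =
    (derivation N X (derivation N Y t) - derivation N Y (derivation N X t)) w"
  proof (cases "set w \<subseteq> {..<N}")
    case True
    have wN: "w ! i < N" if "i < ?l" for i using True that nth_mem by blast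
    \<comment> \<open>The part of the composition where \<open>X\<close> acts at position \<open>i\<close> and \<open>Y\<close> at position \<open>j\<close>.\<close>
    define F where "F X Y i j = (\<Sum>a<N. \<Sum>b<N. X $$ (w ! i, a) *
        (Y $$ (w[i := a] ! j, b) * t (w[i := a, j := b])))" for X Y :: "complex mat" and i j
    have upd: "set (w[i := a]) \<subseteq> {..<N}" if "a < N" for i a
      using True that set_update_subset_insert[of w i a] by auto
    have DD: "derivation N X (derivation N Y t) w = (\<Sum>i<?l. \<Sum>j<?l. F X Y i j)" for X Y
    proof -
      have "derivation N X (derivation N Y t) w = (\<Sum>i<?l. \<Sum>a<N. \<Sum>j<?l. \<Sum>b<N. X $$ (w ! i, a) *
          (Y $$ (w[i := a] ! j, b) * t (w[i := a, j := b])))"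
        using True upd unfolding derivation_def
        by (simp add: sum_distrib_left cong: if_cong)
      also have "\<dots> = (\<Sum>i<?l. \<Sum>j<?l. F X Y i j)"
        unfolding F_def by (intro sum.cong refl sum.swap)
      finally show ?thesis .
    qed
    have off: "F X Y i j = F Y X j i" if "i \<noteq> j" for X Y i j
      unfolding F_def
      by (subst sum.swap) (use that in \<open>simp add: mult.left_commute list_update_swap\<close>)
    have "F X Y i i = (\<Sum>b<N. (X * Y) $$ (w ! i, b) * t (w[i := b]))"
      if "i < ?l" "X \<in> carrier_mat N N" "Y \<in> carrier_mat N N" for X Y i
      unfolding F_def
      by (subst sum.swap) (use that wN[OF that(1)] in \<open>simp add: scalar_prod_def sum_distrib_right
        mult.assoc atLeast0LessThan\<close>)
    then have diag: "F X Y i i - F Y X i i = (\<Sum>b<N. (X * Y - Y * X) $$ (w ! i, b) * t (w[i := b]))"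
      if "i < ?l" for i
      using that X Y wN[OF that] by (simp add: sum_subtractf algebra_simps)
    have "(\<Sum>i<?l. \<Sum>j<?l. F X Y i j) - (\<Sum>i<?l. \<Sum>j<?l. F Y X i j) =
        (\<Sum>i<?l. \<Sum>j<?l. F X Y i j) - (\<Sum>i<?l. \<Sum>j<?l. F Y X j i)"
      by (subst (2) sum.swap) simp
    also have "\<dots> = (\<Sum>i<?l. \<Sum>j<?l. if i = j then F X Y i i - F Y X i i else 0)"
      unfolding sum_subtractf [symmetric]
      by (intro sum.cong refl) (auto dest: off)
    also have "\<dots> = (\<Sum>i<?l. F X Y i i - F Y X i i)"
      by (intro sum.cong) (auto simp: sum.delta)
    also have "\<dots> = derivation N (X * Y - Y * X) t w"
      unfolding derivation_def using True diag by simp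
    finally show ?thesis by (simp add: DD)
  qed (simp add: derivation_def)
qed

definition mat_star :: "nat \<Rightarrow> complex mat \<Rightarrow> complex mat" where
  "mat_star N X = mat N N (\<lambda>(i, j). cnj (X $$ (j, i)))"

lemma mat_star_carrier [simp]: "mat_star N X \<in> carrier_mat N N"
  by (simp add: mat_star_def)

lemma mat_star_index [simp]: "i < N \<Longrightarrow> j < N \<Longrightarrow> mat_star N X $$ (i, j) = cnj (X $$ (j, i))"
  by (simp add: mat_star_def)

lemma hermitian_derivation:
  "hermitian N d (derivation N X s) t = hermitian N d s (derivation N (mat_star N X) t)"
proof -
  let ?W = "words {..<N} d"
  have wN: "w ! i < N" if "w \<in> ?W" "i < d" for w i using words_nth[OF that] by simp
  have L: "hermitian N d (derivation N X s) t =
      (\<Sum>i<d. \<Sum>(w, a)\<in>?W \<times> {..<N}. X $$ (w ! i, a) * s (w[i := a]) * cnj (t w))"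
  proof -
    have "hermitian N d (derivation N X s) t =
        (\<Sum>w\<in>?W. \<Sum>i<d. \<Sum>a<N. X $$ (w ! i, a) * s (w[i := a]) * cnj (t w))"
      unfolding hermitian_def
      by (intro sum.cong refl) (auto simp: derivation_def words_def sum_distrib_right)
    also have "\<dots> = (\<Sum>i<d. \<Sum>w\<in>?W. \<Sum>a<N. X $$ (w ! i, a) * s (w[i := a]) * cnj (t w))"
      by (rule sum.swap)
    finally show ?thesis by (simp add: sum.cartesian_product)
  qed
  have R: "hermitian N d s (derivation N (mat_star N X) t) =
      (\<Sum>i<d. \<Sum>(w, a)\<in>?W \<times> {..<N}. X $$ (a, w ! i) * s w * cnj (t (w[i := a])))"
  proof -
    have "hermitian N d s (derivation N (mat_star N X) t) =
        (\<Sum>w\<in>?W. \<Sum>i<d. \<Sum>a<N. X $$ (a, w ! i) * s w * cnj (t (w[i := a])))"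
      unfolding hermitian_def
    proof (intro sum.cong refl)
      fix w assume w: "w \<in> ?W"
      then have "derivation N (mat_star N X) t w = (\<Sum>i<d. \<Sum>a<N. cnj (X $$ (a, w ! i)) * t (w[i := a]))"
        unfolding derivation_def using wN[OF w] by (auto simp: words_def)
      then show "s w * cnj (derivation N (mat_star N X) t w) =
        (\<Sum>i<d. \<Sum>a<N. X $$ (a, w ! i) * s w * cnj (t (w[i := a])))"
        by (simp add: sum_distrib_left algebra_simps)
    qed
    also have "\<dots> = (\<Sum>i<d. \<Sum>w\<in>?W. \<Sum>a<N. X $$ (a, w ! i) * s w * cnj (t (w[i := a])))"
      by (rule sum.swap)
    finally show ?thesis by (simp add: sum.cartesian_product)
  qed
  show ?thesis unfolding L R
  proof (rule sum.cong[OF refl])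
    fix i assume "i \<in> {..<d}"
    then have i: "i < d" by simp
    \<comment> \<open>Exchanging the letter at position \<open>i\<close> with \<open>a\<close> is an involution on pairs.\<close>
    let ?f = "\<lambda>(w, a). (w[i := a], w ! i)"
    show "(\<Sum>(w, a)\<in>?W \<times> {..<N}. X $$ (w ! i, a) * s (w[i := a]) * cnj (t w)) =
        (\<Sum>(w, a)\<in>?W \<times> {..<N}. X $$ (a, w ! i) * s w * cnj (t (w[i := a])))"
      by (rule sum.reindex_bij_witness[of _ ?f ?f])
        (use i in \<open>auto simp: words_update wN, auto simp: words_def\<close>)
  qed
qed

section \<open>Permuting the factors\<close>

lemma tensor_perm_add: "tensor_perm \<sigma> (s + t) = tensor_perm \<sigma> s + tensor_perm \<sigma> t"
  by (rule ext) (simp add: tensor_perm_def)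

lemma tensor_perm_scale: "tensor_perm \<sigma> (tensor_scale c t) = tensor_scale c (tensor_perm \<sigma> t)"
  by (rule ext) (simp add: tensor_perm_def scale_tensor)

lemma tensor_perm_sum: "tensor_perm \<sigma> (\<Sum>i\<in>I. f i) = (\<Sum>i\<in>I. tensor_perm \<sigma> (f i))"
  by (rule ext) (simp add: tensor_perm_def sum_tensor)

lemma permute_list_inv:
  assumes "\<sigma> permutes {..<length w}"
  shows "permute_list (inv_into UNIV \<sigma>) (permute_list \<sigma> w) = w"
    and "permute_list \<sigma> (permute_list (inv_into UNIV \<sigma>) w) = w"
  using assms permutes_inv[OF assms]
  by (auto simp: permute_list_compose[symmetric] permutes_inv_o)

lemma words_permute_list:
  assumes "\<sigma> permutes {..<d}"
  shows "permute_list \<sigma> w \<in> words A d \<longleftrightarrow> w \<in> words A d"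
  using assms by (auto simp: words_def)

lemma tensor_perm_word_space:
  assumes "\<sigma> permutes {..<d}" "t \<in> word_space A d"
  shows "tensor_perm \<sigma> t \<in> word_space A d"
  using assms words_permute_list[OF permutes_inv[OF assms(1)]]
  by (auto simp: word_space_def tensor_perm_def)

lemma tensor_perm_compose:
  assumes "\<sigma> permutes {..<d}" "\<tau> permutes {..<d}" "t \<in> word_space A d"
  shows "tensor_perm (\<sigma> \<circ> \<tau>) t = tensor_perm \<tau> (tensor_perm \<sigma> t)"
proof
  fix w
  show "tensor_perm (\<sigma> \<circ> \<tau>) t w = tensor_perm \<tau> (tensor_perm \<sigma> t) w"
  proof (cases "length w = d")
    case True
    have "inv_into UNIV (\<sigma> \<circ> \<tau>) = inv_into UNIV \<tau> \<circ> inv_into UNIV \<sigma>"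
      using assms by (simp add: o_inv_distrib permutes_bij)
    then show ?thesis
      using True permutes_inv[OF assms(1)]
      by (simp add: tensor_perm_def permute_list_compose)
  next
    case False
    have "t u = 0" if "length u \<noteq> d" for u
      using assms(3) that by (auto simp: word_space_def words_def)
    then show ?thesis using False by (simp add: tensor_perm_def)
  qed
qed

lemma tensor_perm_derivation:
  assumes "\<sigma> permutes {..<d}" "t \<in> word_space {..<N} d"
  shows "tensor_perm \<sigma> (derivation N X t) = derivation N X (tensor_perm \<sigma> t)"
proof
  fix w
  let ?g = "inv_into UNIV \<sigma>"
  let ?p = "permute_list ?g"
  have inv: "?g permutes {..<d}" using assms(1) by (rule permutes_inv)
  show "tensor_perm \<sigma> (derivation N X t) w = derivation N X (tensor_perm \<sigma> t) w"
  proof (cases "length w = d \<and> set w \<subseteq> {..<N}")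
    case True
    have img: "\<sigma> i < d" "?g i < d" if "i < d" for i
      using permutes_in_image[OF assms(1), of i] permutes_in_image[OF inv, of i] that by auto
    have upd: "?p (w[k := a]) = (?p w)[\<sigma> k := a]" if k: "k < d" for k a
    proof (rule nth_equalityI)
      fix j assume "j < length (?p (w[k := a]))"
      then have j: "j < d" using True by simp
      have "k = ?g j \<longleftrightarrow> \<sigma> k = j" using assms(1) by (metis permutes_inverses)
      then show "?p (w[k := a]) ! j = (?p w)[\<sigma> k := a] ! j"
        using True inv j img by (auto simp: permute_list_nth nth_list_update)
    qed (use True in simp)
    have "tensor_perm \<sigma> (derivation N X t) w =
        (\<Sum>i<d. \<Sum>a<N. X $$ (?p w ! i, a) * t ((?p w)[i := a]))"
      using True inv by (simp add: tensor_perm_def derivation_def)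
    also have "\<dots> = (\<Sum>k<d. \<Sum>a<N. X $$ (?p w ! \<sigma> k, a) * t ((?p w)[\<sigma> k := a]))"
      by (rule sum.reindex_bij_witness[of _ \<sigma> ?g])
        (use img assms(1) in \<open>auto simp: permutes_inverses\<close>)
    also have "\<dots> = (\<Sum>k<d. \<Sum>a<N. X $$ (w ! k, a) * t (?p (w[k := a])))"
      using True inv assms(1) img
      by (intro sum.cong refl) (simp add: upd permute_list_nth permutes_inverses)
    also have "\<dots> = derivation N X (tensor_perm \<sigma> t) w"
      using True by (simp add: tensor_perm_def derivation_def)
    finally show ?thesis .
  next
    case False
    then have "?p w \<notin> words {..<N} d" "w \<notin> words {..<N} d"
      using words_permute_list[OF inv] by (auto simp: words_def)
    then have "derivation N X t (?p w) = 0" "derivation N X (tensor_perm \<sigma> t) w = 0"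
      using word_space_zero[OF derivation_word_space_full[OF assms(2)]]
        word_space_zero[OF derivation_word_space_full[OF tensor_perm_word_space[OF assms]]]
      by blast+
    then show ?thesis by (simp add: tensor_perm_def)
  qed
qed

lemma hermitian_tensor_perm:
  assumes "\<sigma> permutes {..<d}"
  shows "hermitian N d (tensor_perm \<sigma> s) t = hermitian N d s (tensor_perm (inv_into UNIV \<sigma>) t)"
proof -
  have "inv_into UNIV (inv_into UNIV \<sigma>) = \<sigma>" using assms by (simp add: permutes_inv_inv)
  then show ?thesis
    unfolding hermitian_def tensor_perm_def
    by (intro sum.reindex_bij_witness[of _ "permute_list \<sigma>" "permute_list (inv_into UNIV \<sigma>)"])
      (use assms permutes_inv[OF assms] in \<open>auto simp: words_permute_list,
        auto simp: words_def permute_list_inv\<close>)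
qed

section \<open>Descent along strictly triangular matrices\<close>

lemma hermitian_derivation':
  "hermitian N d (derivation N (mat_star N X) s) t = hermitian N d s (derivation N X t)"
  using arg_cong[OF hermitian_derivation[of N d X t s], of cnj] by (simp only: hermitian_cnj)

text \<open>If \<open>A\<close> were larger than \<open>Z\<close>, there would be a nonzero tensor in \<open>A\<close> orthogonal to \<open>Z\<close>. The adjoint of a
  strictly lower triangular matrix replaces letters by smaller ones, and it preserves the orthogonal of
  \<open>Z\<close> in \<open>A\<close>. So a tensor for which the largest sum of letters occurring in it is minimal is killed by
  all adjoints. This replaces complete reducibility and the existence of highest weight vectors.\<close>

lemma orthogonal_descent:
  assumes A: "tensor.subspace A" "A \<subseteq> word_space {..<N} d" and Z: "tensor.subspace Z" "Z \<subseteq> A"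
    and lower: "\<And>X i j. X \<in> G \<Longrightarrow> i < N \<Longrightarrow> j < N \<Longrightarrow> X $$ (i, j) \<noteq> 0 \<Longrightarrow> j < i"
    and Z_stable: "\<And>X z. X \<in> G \<Longrightarrow> z \<in> Z \<Longrightarrow> derivation N X z \<in> Z"
    and A_stable: "\<And>X r. X \<in> G \<Longrightarrow> r \<in> A \<Longrightarrow> derivation N (mat_star N X) r \<in> A"
    and killed: "\<And>r. r \<in> A \<Longrightarrow> \<forall>z\<in>Z. hermitian N d r z = 0 \<Longrightarrow>
      \<forall>X\<in>G. derivation N (mat_star N X) r = 0 \<Longrightarrow> r = 0"
  shows "A \<subseteq> Z"
proof
  fix t assume t: "t \<in> A"
  show "t \<in> Z"
  proof (rule ccontr)
    assume "t \<notin> Z"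
    \<comment> \<open>\<open>m\<close> bounds the sums of letters of the words in the support of \<open>r\<close>.\<close>
    define P where "P m r \<longleftrightarrow> r \<in> A \<and> r \<noteq> 0 \<and> (\<forall>z\<in>Z. hermitian N d r z = 0) \<and>
      (\<forall>w. r w \<noteq> 0 \<longrightarrow> sum_list w \<le> m)" for m and r :: tensor
    obtain z where z: "z \<in> Z" "\<And>y. y \<in> Z \<Longrightarrow> hermitian N d (t - z) y = 0"
      using orthogonal_projection[OF Z(1), of N d t] Z(2) A(2) t by blast
    have "t - z \<in> A" using A(1) Z(2) t z(1) by (blast intro: tensor.subspace_diff)
    moreover have "t - z \<noteq> 0" using z(1) \<open>t \<notin> Z\<close> by auto
    moreover have "sum_list w \<le> sum sum_list (words {..<N} d)" if "(t - z) w \<noteq> 0" for w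
    proof -
      have "w \<in> words {..<N} d" using that \<open>t - z \<in> A\<close> A(2) word_space_zero by blast
      then show ?thesis by (intro member_le_sum) (auto simp: finite_words)
    qed
    ultimately have "\<exists>r. P (sum sum_list (words {..<N} d)) r" using z(2) unfolding P_def by blast
    then have ex: "\<exists>m. \<exists>r. P m r" by blast
    define m where "m = (LEAST m. \<exists>r. P m r)"
    have "\<exists>r. P m r" unfolding m_def by (rule LeastI_ex[OF ex])
    then obtain r where r: "P m r" by blast
    have "derivation N (mat_star N X) r = 0" if X: "X \<in> G" for X
    proof (rule ccontr)
      let ?r = "derivation N (mat_star N X) r"
      assume nz: "?r \<noteq> 0"
      have less: "sum_list w < m" if w: "?r w \<noteq> 0" for w
      proof -
        from w obtain i a where *: "set w \<subseteq> {..<N}" "i < length w" "a < N"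
          "mat_star N X $$ (w ! i, a) \<noteq> 0" "r (w[i := a]) \<noteq> 0" by (rule derivation_nonzeroE)
        have wi: "w ! i < N" using *(1,2) nth_mem by blast
        then have "w ! i < a" using lower[OF X *(3) wi] *(3,4) by simp
        moreover have "sum_list (w[i := a]) \<le> m" using r *(5) unfolding P_def by blast
        moreover have "w ! i \<le> sum_list w" using *(2) by (simp add: member_le_sum_list)
        ultimately show ?thesis using *(2) by (simp add: sum_list_update)
      qed
      have "?r \<in> A" using A_stable[OF X] r unfolding P_def by blast
      moreover have "\<forall>z\<in>Z. hermitian N d ?r z = 0"
        using r Z_stable[OF X] unfolding P_def hermitian_derivation' by blast
      moreover have "\<forall>w. ?r w \<noteq> 0 \<longrightarrow> sum_list w \<le> m - 1" using less by fastforce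
      ultimately have "P (m - 1) ?r" unfolding P_def using nz by blast
      then have "m \<le> m - 1" unfolding m_def by (intro Least_le) blast
      moreover obtain w where "?r w \<noteq> 0" using nz by (metis ext zero_fun_apply)
      ultimately show False using less by fastforce
    qed
    then have "r = 0" using killed r unfolding P_def by blast
    then show False using r unfolding P_def by blast
  qed
qed

section \<open>The symplectic Lie algebra in coordinates\<close>

text \<open>The value of the form on \<open>(e\<^sub>i, e\<^bsub>2n+1-i\<^esub>)\<close>.\<close>

definition symp_sign :: "nat \<Rightarrow> nat \<Rightarrow> complex" where
  "symp_sign n i = (if i \<le> n then 1 else - 1)"

lemma symp_form_alt:
  "symp_form n u v = (\<Sum>a<2*n+2. symp_sign n a * (u $ a * v $ (2*n+1-a)))"
proof -
  have "(\<Sum>a<2*n+2. symp_sign n a * (u $ a * v $ (2*n+1-a))) =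
      (\<Sum>a\<in>{..n} \<union> {n<..2*n+1}. symp_sign n a * (u $ a * v $ (2*n+1-a)))"
    by (intro sum.cong) auto
  also have "\<dots> = (\<Sum>a\<le>n. u $ a * v $ (2*n+1-a)) +
      (\<Sum>a\<in>{n<..2*n+1}. - (u $ a * v $ (2*n+1-a)))"
    by (subst sum.union_disjoint) (auto simp: symp_sign_def)
  also have "(\<Sum>a\<in>{n<..2*n+1}. - (u $ a * v $ (2*n+1-a))) =
      (\<Sum>a\<le>n. - (u $ (2*n+1-a) * v $ a))"
    by (rule sum.reindex_bij_witness [of _ "\<lambda>a. 2*n+1-a" "\<lambda>a. 2*n+1-a"]) auto
  also have "(\<Sum>a\<le>n. u $ a * v $ (2*n+1-a)) + (\<Sum>a\<le>n. - (u $ (2*n+1-a) * v $ a)) =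
      symp_form n u v"
    by (simp add: symp_form_def sum_subtractf sum_negf)
  finally show ?thesis by simp
qed

lemma mem_sp_iff:
  "X \<in> sp n \<longleftrightarrow> X \<in> carrier_mat (2*n+2) (2*n+2) \<and> (\<forall>i<2*n+2. \<forall>j<2*n+2.
     symp_sign n i * X $$ (i, j) + symp_sign n j * X $$ (2*n+1-j, 2*n+1-i) = 0)"
  (is "_ \<longleftrightarrow> _ \<and> ?R")
proof (cases "X \<in> carrier_mat (2*n+2) (2*n+2)")
  case X: True
  let ?N = "2*n+2"
  have expand: "symp_form n (X *\<^sub>v u) v + symp_form n u (X *\<^sub>v v) =
      (\<Sum>i<?N. \<Sum>j<?N. (symp_sign n i * X $$ (i, j) + symp_sign n j * X $$ (2*n+1-j, 2*n+1-i)) *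
        (u $ j * v $ (2*n+1-i)))"
    if u: "u \<in> carrier_vec ?N" and v: "v \<in> carrier_vec ?N" for u v
  proof -
    have mv: "(X *\<^sub>v w) $ i = (\<Sum>j<?N. X $$ (i, j) * w $ j)"
      if "i < ?N" "w \<in> carrier_vec ?N" for i w
      using X that by (simp add: scalar_prod_def atLeast0LessThan)
    have "symp_form n (X *\<^sub>v u) v =
        (\<Sum>i<?N. \<Sum>j<?N. symp_sign n i * X $$ (i, j) * (u $ j * v $ (2*n+1-i)))"
      unfolding symp_form_alt
      by (intro sum.cong refl) (use u in \<open>simp add: mv sum_distrib_left sum_distrib_right mult_ac del: index_mult_mat_vec sum.lessThan_Suc\<close>)
    moreover have "symp_form n u (X *\<^sub>v v) =
        (\<Sum>i<?N. \<Sum>j<?N. symp_sign n j * X $$ (2*n+1-j, 2*n+1-i) * (u $ j * v $ (2*n+1-i)))"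
    proof -
      have "symp_form n u (X *\<^sub>v v) =
          (\<Sum>j<?N. \<Sum>k<?N. symp_sign n j * X $$ (2*n+1-j, k) * (u $ j * v $ k))"
        unfolding symp_form_alt
        by (intro sum.cong refl) (use v in \<open>simp add: mv sum_distrib_left mult_ac del: index_mult_mat_vec sum.lessThan_Suc\<close>)
      also have "\<dots> = (\<Sum>j<?N. \<Sum>i<?N. symp_sign n j * X $$ (2*n+1-j, 2*n+1-i) *
          (u $ j * v $ (2*n+1-i)))"
        by (intro sum.cong refl sum.reindex_bij_witness[of _ "\<lambda>a. 2*n+1-a" "\<lambda>a. 2*n+1-a"]) auto
      finally show ?thesis by (subst sum.swap)
    qed
    ultimately show ?thesis by (simp add: sum.distrib [symmetric] algebra_simps)
  qed
  show ?thesis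
  proof
    assume "X \<in> sp n"
    have "symp_sign n i * X $$ (i, j) + symp_sign n j * X $$ (2*n+1-j, 2*n+1-i) = 0"
      if ij: "i < ?N" "j < ?N" for i j
    proof -
      let ?u = "unit_vec ?N j" and ?v = "unit_vec ?N (2*n+1-i)"
      have "0 = symp_form n (X *\<^sub>v ?u) ?v + symp_form n ?u (X *\<^sub>v ?v)"
        using \<open>X \<in> sp n\<close> by (simp add: sp_def)
      also have "\<dots> = (\<Sum>i'<?N. \<Sum>j'<?N. if j' = j then if i' = i then
          symp_sign n i * X $$ (i, j) + symp_sign n j * X $$ (2*n+1-j, 2*n+1-i) else 0 else 0)"
        by (subst expand, simp, simp, intro sum.cong refl) (use ij in \<open>auto simp: unit_vec_def\<close>)
      finally show ?thesis using ij by (simp add: sum.delta)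
    qed
    then show "X \<in> carrier_mat ?N ?N \<and> ?R" using X by blast
  next
    assume "X \<in> carrier_mat ?N ?N \<and> ?R"
    then show "X \<in> sp n" using X expand by (auto simp: sp_def)
  qed
qed (auto simp: sp_def)

lemma sp_carrier: "X \<in> sp n \<Longrightarrow> X \<in> carrier_mat (2*n+2) (2*n+2)"
  by (simp add: sp_def)

text \<open>The matrix of the form is real and orthogonal, so that the Lie algebra is closed under adjoints.\<close>

lemma mat_star_sp:
  assumes "X \<in> sp n"
  shows "mat_star (2*n+2) X \<in> sp n"
  unfolding mem_sp_iff
proof (intro conjI allI impI)
  fix i j assume ij: "i < 2*n+2" "j < 2*n+2"
  have "symp_sign n j * X $$ (j, i) + symp_sign n i * X $$ (2*n+1-i, 2*n+1-j) = 0"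
    using assms ij unfolding mem_sp_iff by blast
  then have "cnj (symp_sign n j * X $$ (j, i) + symp_sign n i * X $$ (2*n+1-i, 2*n+1-j)) = 0"
    by (simp only: complex_cnj_zero)
  then show "symp_sign n i * mat_star (2*n+2) X $$ (i, j) +
      symp_sign n j * mat_star (2*n+2) X $$ (2*n+1-j, 2*n+1-i) = 0"
    using ij by (auto simp: symp_sign_def split: if_splits)
qed simp

section \<open>Traceless tensors\<close>

definition traceless :: "nat \<Rightarrow> nat \<Rightarrow> tensor \<Rightarrow> bool" where
  "traceless n d t \<longleftrightarrow> (\<forall>p q. \<forall>w\<in>words {..<2*n+2} d. p < q \<longrightarrow> q < d \<longrightarrow>
     (\<Sum>a<2*n+2. symp_sign n a * t (w[p := a, q := 2*n+1-a])) = 0)"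

lemma contraction_alt:
  "contraction (2*n+2) (symp_form n) p q t u =
    (\<Sum>a<2*n+2. symp_sign n a * t (insert_at q (2*n+1-a) (insert_at p a u)))"
proof -
  have "contraction (2*n+2) (symp_form n) p q t u =
      (\<Sum>a<2*n+2. \<Sum>b<2*n+2. if b = 2*n+1-a then
        symp_sign n a * t (insert_at q b (insert_at p a u)) else 0)"
    unfolding contraction_def
    by (intro sum.cong refl) (simp add: symp_form_unit_vec symp_sign_def del: add_2_eq_Suc' sum.lessThan_Suc)
  also have "\<dots> = (\<Sum>a<2*n+2. symp_sign n a * t (insert_at q (2*n+1-a) (insert_at p a u)))"
    by (intro sum.cong refl) (auto simp: sum.delta)
  finally show ?thesis .
qed

lemma insert_at_update:
  assumes "p < q" "length x = p" "length y = q - p - 1"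
  shows "insert_at q b (insert_at p a (x @ y @ z)) = (x @ a' # y @ b' # z)[p := a, q := b]"
proof -
  obtain k where "q = Suc (p + k)" using less_imp_Suc_add[OF assms(1)] by blast
  then show ?thesis using assms by (simp add: insert_at_def list_update_append)
qed

text \<open>Contractions are defined by inserting two letters into a word of length \<open>d - 2\<close>. Replacing two letters of a
  word of length \<open>d\<close> instead makes them easier to combine with derivations.\<close>

lemma traceless_iff_contraction:
  assumes t: "t \<in> word_space {..<2*n+2} d"
  shows "traceless n d t \<longleftrightarrow>
    (\<forall>p q. p < q \<and> q < d \<longrightarrow> contraction (2*n+2) (symp_form n) p q t = 0)"
proof -
  let ?N = "2*n+2"
  have "(\<forall>w\<in>words {..<?N} d. (\<Sum>a<?N. symp_sign n a * t (w[p := a, q := 2*n+1-a])) = 0) \<longleftrightarrow>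
      contraction ?N (symp_form n) p q t = 0" (is "?L \<longleftrightarrow> _") if pq: "p < q" "q < d" for p q
  proof
    assume L: ?L
    show "contraction ?N (symp_form n) p q t = 0"
    proof
      fix u
      show "contraction ?N (symp_form n) p q t u = 0 u"
      proof (cases "length u = d - 2")
        case False
        then have "t (insert_at q b (insert_at p a u)) = 0" for a b
          using pq by (intro word_space_zero[OF t]) (auto simp: words_def length_insert_at)
        then show ?thesis by (simp add: contraction_alt)
      next
        case True
        define x y z where "x = take p u" and "y = take (q - p - 1) (drop p u)" and "z = drop (q - 1) u"
        have len: "length x = p" "length y = q - p - 1"
          using True pq by (auto simp: x_def y_def)
        have "y @ z = drop p u"
          unfolding y_def z_def
          using append_take_drop_id [of "q - p - 1" "drop p u"] pq by simp
        then have u: "u = x @ y @ z" by (simp add: x_def)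
        let ?w = "x @ 0 # y @ 0 # z"
        have ins: "insert_at q b (insert_at p a u) = ?w[p := a, q := b]" for a b
          unfolding u by (rule insert_at_update[OF pq(1) len])
        show ?thesis
        proof (cases "?w \<in> words {..<?N} d")
          case True
          then show ?thesis using L by (simp add: contraction_alt ins)
        next
          case False
          have "t (?w[p := a, q := b]) = 0" for a b
          proof (rule word_space_zero[OF t])
            have "?w[p := a, q := b] = x @ a # y @ b # z"
              using ins[of b a] len pq by (simp add: u insert_at_def take_Cons' drop_Cons')
            then show "?w[p := a, q := b] \<notin> words {..<?N} d"
              using False by (auto simp: words_def)
          qed
          then show ?thesis by (simp add: contraction_alt ins)
        qed
      qed
    qed
  next
    assume R: "contraction ?N (symp_form n) p q t = 0"
    show ?L
    proof
      fix w assume w: "w \<in> words {..<?N} d"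
      define x y z where "x = take p w" and "y = take (q - p - 1) (drop (Suc p) w)" and "z = drop (Suc q) w"
      have len: "length x = p" "length y = q - p - 1"
        using w pq by (auto simp: x_def y_def words_def)
      have "drop (q - p - 1) (drop (Suc p) w) = drop q w" using pq by simp
      then have "drop (Suc p) w = y @ w ! q # z"
        unfolding y_def z_def
        using append_take_drop_id [of "q - p - 1" "drop (Suc p) w"] pq w
        by (auto simp: words_def Cons_nth_drop_Suc)
      then have "w = x @ w ! p # y @ w ! q # z"
        unfolding x_def using id_take_nth_drop [of p w] pq w by (simp add: words_def)
      then have ins: "insert_at q b (insert_at p a (x @ y @ z)) = w[p := a, q := b]" for a b
        using insert_at_update[OF pq(1) len] by metis
      show "(\<Sum>a<?N. symp_sign n a * t (w[p := a, q := 2*n+1-a])) = 0"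
        using fun_cong[OF R, of "x @ y @ z"] by (simp add: contraction_alt ins)
    qed
  qed
  then show ?thesis unfolding traceless_def by blast
qed

text \<open>The form is invariant: the parts of the derivation at the two contracted positions cancel, and the parts
  at the other positions commute with the contraction.\<close>

lemma traceless_derivation:
  assumes X: "X \<in> sp n" and t: "traceless n d t"
  shows "traceless n d (derivation (2*n+2) X t)"
  unfolding traceless_def
proof (intro allI ballI impI)
  let ?N = "2*n+2"
  fix p q w assume w: "w \<in> words {..<?N} d" and pq: "p < q" "q < d"
  let ?v = "\<lambda>a. w[p := a, q := 2*n+1-a]"
  let ?F = "\<lambda>i. \<Sum>a<?N. \<Sum>c<?N. symp_sign n a * X $$ (?v a ! i, c) * t ((?v a)[i := c])"
  have len: "length w = d" using w by (simp add: words_def)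
  have v: "set (?v a) \<subseteq> {..<?N}" if "a < ?N" for a
  proof -
    have "?v a \<in> words {..<?N} d" using that by (intro words_update w) auto
    then show ?thesis by (simp add: words_def)
  qed
  have "(\<Sum>a<?N. symp_sign n a * derivation ?N X t (?v a)) =
      (\<Sum>a<?N. \<Sum>i<d. \<Sum>c<?N. symp_sign n a * X $$ (?v a ! i, c) * t ((?v a)[i := c]))"
  proof (rule sum.cong[OF refl])
    fix a assume "a \<in> {..<?N}"
    then show "symp_sign n a * derivation ?N X t (?v a) =
        (\<Sum>i<d. \<Sum>c<?N. symp_sign n a * X $$ (?v a ! i, c) * t ((?v a)[i := c]))"
      using v[of a] unfolding derivation_def by (simp only: lessThan_iff if_True length_list_update len sum_distrib_left mult.assoc)
  qed
  also have "\<dots> = (\<Sum>i<d. ?F i)" by (rule sum.swap)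
  also have "\<dots> = ?F p + (?F q + (\<Sum>i\<in>{..<d} - {p} - {q}. ?F i))"
    using pq by (simp add: sum.remove[of _ p] sum.remove[of _ q])
  also have "(\<Sum>i\<in>{..<d} - {p} - {q}. ?F i) = 0"
  proof (rule sum.neutral, rule ballI)
    fix i assume i: "i \<in> {..<d} - {p} - {q}"
    have "?F i = (\<Sum>a<?N. \<Sum>c<?N. X $$ (w ! i, c) * (symp_sign n a * t (w[i := c, p := a, q := 2*n+1-a])))"
    proof (intro sum.cong refl)
      fix a c
      have "(?v a)[i := c] = w[i := c, p := a, q := 2*n+1-a]"
        using i by (metis Diff_iff insertI1 list_update_swap)
      then show "symp_sign n a * X $$ (?v a ! i, c) * t ((?v a)[i := c]) =
          X $$ (w ! i, c) * (symp_sign n a * t (w[i := c, p := a, q := 2*n+1-a]))"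
        using i by simp
    qed
    also have "\<dots> = (\<Sum>c<?N. X $$ (w ! i, c) * (\<Sum>a<?N. symp_sign n a * t (w[i := c, p := a, q := 2*n+1-a])))"
      by (subst sum.swap) (simp add: sum_distrib_left)
    also have "\<dots> = 0"
      using t pq words_update[OF w] by (intro sum.neutral) (auto simp: traceless_def)
    finally show "?F i = 0" .
  qed
  also have "?F p = (\<Sum>a<?N. \<Sum>c<?N. symp_sign n a * X $$ (a, c) * t (w[p := c, q := 2*n+1-a]))"
    using pq len by (intro sum.cong refl) (simp add: list_update_swap[of p q])
  also have "?F q = (\<Sum>a<?N. \<Sum>c<?N. symp_sign n a * X $$ (2*n+1-a, c) * t (w[p := a, q := c]))"
    using pq len by (intro sum.cong refl) simp
  also have "\<dots> = (\<Sum>c<?N. \<Sum>a<?N. symp_sign n c * X $$ (2*n+1-c, 2*n+1-a) * t (w[p := c, q := 2*n+1-a]))"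
    by (intro sum.cong refl sum.reindex_bij_witness[of _ "\<lambda>a. 2*n+1-a" "\<lambda>a. 2*n+1-a"]) auto
  also have "\<dots> = (\<Sum>a<?N. \<Sum>c<?N. symp_sign n c * X $$ (2*n+1-c, 2*n+1-a) * t (w[p := c, q := 2*n+1-a]))"
    by (rule sum.swap)
  also have "(\<Sum>a<?N. \<Sum>c<?N. symp_sign n a * X $$ (a, c) * t (w[p := c, q := 2*n+1-a])) + (\<dots> + 0) =
      (\<Sum>a<?N. \<Sum>c<?N. (symp_sign n a * X $$ (a, c) + symp_sign n c * X $$ (2*n+1-c, 2*n+1-a)) *
        t (w[p := c, q := 2*n+1-a]))"
    by (simp add: sum.distrib [symmetric] algebra_simps)
  also have "\<dots> = 0"
    using X unfolding mem_sp_iff by (intro sum.neutral ballI) simp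
  finally show "(\<Sum>a<?N. symp_sign n a * derivation ?N X t (?v a)) = 0" .
qed

lemma traceless_add: "traceless n d s \<Longrightarrow> traceless n d t \<Longrightarrow> traceless n d (s + t)"
  unfolding traceless_def plus_fun_apply distrib_left sum.distrib by simp

lemma traceless_scale: "traceless n d t \<Longrightarrow> traceless n d (tensor_scale c t)"
  unfolding traceless_def scale_tensor mult.left_commute[of _ c] sum_distrib_left[symmetric] by simp

lemma traceless_zero: "traceless n d 0"
  by (simp add: traceless_def)

section \<open>Symmetrization over the permutations preserving a labelling\<close>

text \<open>Row and column groups are both of this form, with the row or the column index as labelling.\<close>

definition fiber_group :: "nat \<Rightarrow> (nat \<Rightarrow> nat) \<Rightarrow> (nat \<Rightarrow> nat) set" where
  "fiber_group d f = {\<sigma>. \<sigma> permutes {..<d} \<and> (\<forall>s<d. f (\<sigma> s) = f s)}"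

lemma fiber_group_permutes: "\<sigma> \<in> fiber_group d f \<Longrightarrow> \<sigma> permutes {..<d}"
  by (simp add: fiber_group_def)

lemma finite_fiber_group [simp]: "finite (fiber_group d f)"
  by (rule finite_subset[OF _ finite_permutations[of "{..<d}"]]) (auto simp: fiber_group_def)

lemma id_fiber_group: "id \<in> fiber_group d f"
  by (simp add: fiber_group_def permutes_id)

lemma fiber_group_nonempty [simp]: "fiber_group d f \<noteq> {}"
  using id_fiber_group by blast

lemma fiber_group_compose:
  "\<sigma> \<in> fiber_group d f \<Longrightarrow> \<tau> \<in> fiber_group d f \<Longrightarrow> \<sigma> \<circ> \<tau> \<in> fiber_group d f"
  using permutes_in_image[of \<tau> "{..<d}"] by (auto simp: fiber_group_def permutes_compose)

lemma fiber_group_inv: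
  assumes "\<sigma> \<in> fiber_group d f"
  shows "inv_into UNIV \<sigma> \<in> fiber_group d f"
proof -
  have \<sigma>: "\<sigma> permutes {..<d}" and f: "\<And>s. s < d \<Longrightarrow> f (\<sigma> s) = f s"
    using assms by (auto simp: fiber_group_def)
  have "f (inv_into UNIV \<sigma> s) = f s" if "s < d" for s
    using f[of "inv_into UNIV \<sigma> s"] permutes_in_image[OF permutes_inv[OF \<sigma>], of s] that
    by (simp add: permutes_inverses[OF \<sigma>])
  then show ?thesis using permutes_inv[OF \<sigma>] by (simp add: fiber_group_def)
qed

text \<open>The trivial character or the sign, in order to treat row symmetrization and column antisymmetrization
  together.\<close>

definition perm_character :: "bool \<Rightarrow> (nat \<Rightarrow> nat) \<Rightarrow> complex" where
  "perm_character e \<sigma> = (if e then of_int (sign \<sigma>) else 1)"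

lemma perm_character_compose:
  "\<sigma> permutes {..<d::nat} \<Longrightarrow> \<tau> permutes {..<d} \<Longrightarrow>
    perm_character e (\<sigma> \<circ> \<tau>) = perm_character e \<sigma> * perm_character e \<tau>"
  using permutes_imp_permutation[of "{..<d}"] by (simp add: perm_character_def sign_compose)

lemma perm_character_inv:
  "\<sigma> permutes {..<d::nat} \<Longrightarrow> perm_character e (inv_into UNIV \<sigma>) = perm_character e \<sigma>"
  using permutes_imp_permutation[of "{..<d}"] by (simp add: perm_character_def sign_inverse)

lemma perm_character_square [simp]: "perm_character e \<sigma> * perm_character e \<sigma> = 1"
  by (simp add: perm_character_def flip: of_int_mult)

lemma perm_character_cnj [simp]: "cnj (perm_character e \<sigma>) = perm_character e \<sigma>"
  by (simp add: perm_character_def)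

definition symmetrize :: "bool \<Rightarrow> nat \<Rightarrow> (nat \<Rightarrow> nat) \<Rightarrow> tensor \<Rightarrow> tensor" where
  "symmetrize e d f t =
    (\<Sum>\<sigma>\<in>fiber_group d f. tensor_scale (perm_character e \<sigma>) (tensor_perm \<sigma> t))"

lemma symmetrize_word_space: "t \<in> word_space A d \<Longrightarrow> symmetrize e d f t \<in> word_space A d"
  unfolding symmetrize_def
  by (intro tensor.subspace_sum tensor.subspace_scale subspace_word_space)
    (auto intro: tensor_perm_word_space fiber_group_permutes)

lemma symmetrize_add: "symmetrize e d f (s + t) = symmetrize e d f s + symmetrize e d f t"
  unfolding symmetrize_def tensor_perm_add tensor.scale_right_distrib sum.distrib by (rule refl)

lemma symmetrize_scale: "symmetrize e d f (tensor_scale c t) = tensor_scale c (symmetrize e d f t)"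
  unfolding symmetrize_def tensor_perm_scale tensor.scale_sum_right
  by (simp add: mult.commute)

lemma symmetrize_derivation:
  assumes "t \<in> word_space {..<N} d"
  shows "symmetrize e d f (derivation N X t) = derivation N X (symmetrize e d f t)"
  unfolding symmetrize_def derivation_sum derivation_scale
  by (intro sum.cong refl) (simp add: tensor_perm_derivation[OF fiber_group_permutes assms])

lemma hermitian_symmetrize:
  "hermitian N d (symmetrize e d f s) t = hermitian N d s (symmetrize e d f t)"
proof -
  have "hermitian N d (symmetrize e d f s) t =
      (\<Sum>\<sigma>\<in>fiber_group d f. perm_character e \<sigma> * hermitian N d s (tensor_perm (inv_into UNIV \<sigma>) t))"
    unfolding symmetrize_def hermitian_sum_left hermitian_scale_left
    by (intro sum.cong refl) (simp add: hermitian_tensor_perm[OF fiber_group_permutes])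
  also have "\<dots> = (\<Sum>\<sigma>\<in>fiber_group d f. perm_character e \<sigma> * hermitian N d s (tensor_perm \<sigma> t))"
    by (rule sum.reindex_bij_witness[of _ "inv_into UNIV" "inv_into UNIV"])
      (auto simp: fiber_group_inv permutes_inv_inv[OF fiber_group_permutes]
        perm_character_inv[OF fiber_group_permutes])
  finally show ?thesis
    unfolding symmetrize_def hermitian_sum_right hermitian_scale_right by simp
qed

lemma tensor_perm_symmetrize:
  assumes t: "t \<in> word_space A d" and \<tau>: "\<tau> \<in> fiber_group d f"
  shows "tensor_perm \<tau> (symmetrize e d f t) = tensor_scale (perm_character e \<tau>) (symmetrize e d f t)"
proof -
  have inv: "inv_into UNIV \<tau> \<in> fiber_group d f" using \<tau> by (rule fiber_group_inv)
  have p: "\<tau> permutes {..<d}" "inv_into UNIV \<tau> permutes {..<d}"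
    using \<tau> inv by (auto dest: fiber_group_permutes)
  have "tensor_perm \<tau> (symmetrize e d f t) =
      (\<Sum>\<sigma>\<in>fiber_group d f. tensor_scale (perm_character e \<sigma>) (tensor_perm (\<sigma> \<circ> \<tau>) t))"
    unfolding symmetrize_def tensor_perm_sum tensor_perm_scale
    by (intro sum.cong refl) (simp add: tensor_perm_compose[OF fiber_group_permutes p(1) t])
  also have "\<dots> = (\<Sum>\<sigma>\<in>fiber_group d f.
      tensor_scale (perm_character e \<tau>) (tensor_scale (perm_character e \<sigma>) (tensor_perm \<sigma> t)))"
  proof (rule sum.reindex_bij_witness[of _ "\<lambda>\<sigma>. \<sigma> \<circ> inv_into UNIV \<tau>" "\<lambda>\<sigma>. \<sigma> \<circ> \<tau>"])
    fix \<sigma> assume \<sigma>: "\<sigma> \<in> fiber_group d f"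
    show "\<sigma> \<circ> \<tau> \<circ> inv_into UNIV \<tau> = \<sigma>" "\<sigma> \<circ> inv_into UNIV \<tau> \<circ> \<tau> = \<sigma>"
      using permutes_inv_o[OF p(1)] by (simp_all add: comp_assoc)
    show "\<sigma> \<circ> \<tau> \<in> fiber_group d f" "\<sigma> \<circ> inv_into UNIV \<tau> \<in> fiber_group d f"
      using \<sigma> \<tau> inv by (simp_all add: fiber_group_compose)
    have "perm_character e \<tau> * perm_character e (\<sigma> \<circ> \<tau>) = perm_character e \<sigma>"
      using perm_character_compose[OF fiber_group_permutes[OF \<sigma>] p(1), of e] by simp
    then show "tensor_scale (perm_character e \<tau>) (tensor_scale (perm_character e (\<sigma> \<circ> \<tau>))
        (tensor_perm (\<sigma> \<circ> \<tau>) t)) = tensor_scale (perm_character e \<sigma>) (tensor_perm (\<sigma> \<circ> \<tau>) t)"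
      by simp
  qed
  finally show ?thesis by (simp add: symmetrize_def tensor.scale_sum_right)
qed

lemma symmetrize_symmetrize:
  assumes t: "t \<in> word_space A d"
  shows "symmetrize e d f (symmetrize e d f t) =
    tensor_scale (of_nat (card (fiber_group d f))) (symmetrize e d f t)"
proof -
  have "symmetrize e d f (symmetrize e d f t) = (\<Sum>\<sigma>\<in>fiber_group d f. symmetrize e d f t)"
    by (subst symmetrize_def, intro sum.cong refl) (simp add: tensor_perm_symmetrize[OF t])
  also have "\<dots> = tensor_scale (of_nat (card (fiber_group d f))) (symmetrize e d f t)"
    by (rule ext) (simp add: sum_tensor scale_tensor)
  finally show ?thesis .
qed

text \<open>The transposition of the two positions fixes the word and has sign \<open>-1\<close>.\<close>

lemma antisymmetrize_repeated:
  assumes t: "t \<in> word_space A d" and s: "s < d" "s' < d" "s \<noteq> s'" "f s = f s'" "w ! s = w ! s'"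
  shows "symmetrize True d f t w = 0"
proof (cases "length w = d")
  case True
  let ?\<tau> = "Transposition.transpose s s'"
  have \<tau>: "?\<tau> permutes {..<d}" using s by (simp add: permutes_swap_id)
  then have "?\<tau> \<in> fiber_group d f" using s by (auto simp: fiber_group_def transpose_def)
  then have "tensor_perm ?\<tau> (symmetrize True d f t) w =
      tensor_scale (perm_character True ?\<tau>) (symmetrize True d f t) w"
    using tensor_perm_symmetrize[OF t] by simp
  moreover have "permute_list (inv_into UNIV ?\<tau>) w = w"
    using True \<tau> s by (intro nth_equalityI) (auto simp: permute_list_nth transpose_def)
  ultimately have "symmetrize True d f t w = - symmetrize True d f t w"
    using s by (simp add: tensor_perm_def scale_tensor perm_character_def sign_swap_id)
  then show ?thesis by simp
next
  case False
  then show ?thesis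
    using word_space_zero[OF symmetrize_word_space[OF t]] by (auto simp: words_def)
qed

lemma tensor_perm_basis_tensor:
  assumes "\<sigma> permutes {..<length w}"
  shows "tensor_perm \<sigma> (basis_tensor w) = basis_tensor (permute_list \<sigma> w)"
proof
  fix u
  show "tensor_perm \<sigma> (basis_tensor w) u = basis_tensor (permute_list \<sigma> w) u"
  proof (cases "length u = length w")
    case True
    then have "permute_list (inv_into UNIV \<sigma>) u = w \<longleftrightarrow> u = permute_list \<sigma> w"
      using permute_list_inv[of \<sigma> u] permute_list_inv[of \<sigma> w] assms by auto
    then show ?thesis by (simp add: tensor_perm_def basis_tensor_def)
  next
    case False
    then show ?thesis by (auto simp: tensor_perm_def basis_tensor_def)
  qed
qed

section \<open>Young symmetrizers\<close>

locale numbered_diagram =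
  fixes lam :: "nat list" and T :: "nat \<times> nat \<Rightarrow> nat"
  assumes tab: "tableau lam T" and decreasing: "sorted_wrt (\<ge>) lam"
begin

definition row_of :: "nat \<Rightarrow> nat" where "row_of s = fst (inv_into (boxes lam) T s)"

definition col_of :: "nat \<Rightarrow> nat" where "col_of s = snd (inv_into (boxes lam) T s)"

abbreviation "deg \<equiv> sum_list lam"

abbreviation "young \<equiv> young_symmetrizer lam T"

abbreviation "row_sym \<equiv> symmetrize False deg row_of"

abbreviation "col_antisym \<equiv> symmetrize True deg col_of"

lemma bij: "bij_betw T (boxes lam) {..<deg}"
  using tab by (simp add: tableau_def)

lemma box_of: "s < deg \<Longrightarrow> (row_of s, col_of s) \<in> boxes lam \<and> T (row_of s, col_of s) = s"
  using bij_betw_inv_into_right[OF bij, of s] bij_betw_apply[OF bij_betw_inv_into[OF bij], of s]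
  by (simp add: row_of_def col_of_def)

lemma row_col_T: "(i, j) \<in> boxes lam \<Longrightarrow> row_of (T (i, j)) = i \<and> col_of (T (i, j)) = j"
  by (simp add: row_of_def col_of_def bij_betw_inv_into_left[OF bij])

lemma T_less: "b \<in> boxes lam \<Longrightarrow> T b < deg"
  using bij_betw_apply[OF bij] by blast

lemma row_of_less: "s < deg \<Longrightarrow> row_of s < length lam"
  using box_of by (auto simp: boxes_def)

lemma box_eqI: "s < deg \<Longrightarrow> s' < deg \<Longrightarrow> row_of s = row_of s' \<Longrightarrow> col_of s = col_of s' \<Longrightarrow> s = s'"
  using box_of by metis

text \<open>A permutation that maps each fiber into itself maps it onto itself, since the fibers are finite.\<close>

lemma fiber_stabilizer:
  assumes "\<And>b. b \<in> boxes lam \<Longrightarrow> f (T b) = g b"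
  shows "{\<sigma>. \<sigma> permutes {..<deg} \<and>
      (\<forall>i. \<sigma> ` T ` {b \<in> boxes lam. g b = i} = T ` {b \<in> boxes lam. g b = i})} =
    fiber_group deg f"
proof -
  have img: "T ` {b \<in> boxes lam. g b = i} = {s. s < deg \<and> f s = i}" for i
    using box_of T_less assms by (auto simp: image_iff) metis+
  have "(\<forall>i. \<sigma> ` {s. s < deg \<and> f s = i} = {s. s < deg \<and> f s = i}) \<longleftrightarrow>
      (\<forall>s<deg. f (\<sigma> s) = f s)" if \<sigma>: "\<sigma> permutes {..<deg}" for \<sigma>
  proof
    assume "\<forall>i. \<sigma> ` {s. s < deg \<and> f s = i} = {s. s < deg \<and> f s = i}"
    then show "\<forall>s<deg. f (\<sigma> s) = f s" by blast
  next
    assume *: "\<forall>s<deg. f (\<sigma> s) = f s"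
    have "\<sigma> ` {s. s < deg \<and> f s = i} \<subseteq> {s. s < deg \<and> f s = i}" for i
      using * permutes_in_image[OF \<sigma>] by auto
    moreover have "inj_on \<sigma> A" for A using permutes_inj_on[OF \<sigma>] .
    ultimately show "\<forall>i. \<sigma> ` {s. s < deg \<and> f s = i} = {s. s < deg \<and> f s = i}"
      by (intro allI endo_inj_surj) auto
  qed
  then show ?thesis unfolding img fiber_group_def by blast
qed

lemma row_group_eq: "row_group lam T = fiber_group deg row_of"
  unfolding row_group_def by (rule fiber_stabilizer) (auto simp: row_col_T)

lemma column_group_eq: "column_group lam T = fiber_group deg col_of"
  unfolding column_group_def by (rule fiber_stabilizer) (auto simp: row_col_T)

lemma young_symmetrizer_eq:
  assumes "t \<in> word_space A deg"
  shows "young t = col_antisym (row_sym t)"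
proof -
  have "young t = (\<Sum>p\<in>fiber_group deg row_of. \<Sum>q\<in>fiber_group deg col_of.
      tensor_scale (perm_character True q) (tensor_perm q (tensor_perm p t)))"
    unfolding young_symmetrizer_def row_group_eq column_group_eq
    by (intro sum.cong refl)
      (simp add: perm_character_def tensor_perm_compose[OF fiber_group_permutes fiber_group_permutes assms])
  also have "\<dots> = col_antisym (row_sym t)"
    unfolding symmetrize_def tensor_perm_sum tensor.scale_sum_right
    by (subst sum.swap) (simp add: perm_character_def)
  finally show ?thesis .
qed

lemma young_symmetrizer_word_space:
  "t \<in> word_space A deg \<Longrightarrow> young t \<in> word_space A deg"
  by (simp add: young_symmetrizer_eq symmetrize_word_space)

lemma young_symmetrizer_derivation:
  assumes "t \<in> word_space {..<N} deg"
  shows "derivation N X (young t) = young (derivation N X t)"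
  using assms derivation_word_space_full[OF assms, of X]
  by (simp add: young_symmetrizer_eq symmetrize_derivation symmetrize_word_space)

lemma subspace_young_image: "tensor.subspace (young ` word_space A deg)"
proof (rule tensor.subspaceI)
  have z: "0 \<in> word_space A deg" by (rule tensor.subspace_0[OF subspace_word_space])
  have "young 0 = tensor_scale 0 (young 0)"
    using symmetrize_scale[of False deg row_of 0 0] symmetrize_scale[of True deg col_of 0 "row_sym 0"]
    unfolding young_symmetrizer_eq[OF z] tensor.scale_zero_left tensor.scale_zero_right by simp
  then show "0 \<in> young ` word_space A deg"
    unfolding tensor.scale_zero_left using z by (metis imageI)
next
  fix x y assume "x \<in> young ` word_space A deg"
    "y \<in> young ` word_space A deg"
  then obtain s t where st: "s \<in> word_space A deg" "t \<in> word_space A deg"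
    "x = young s" "y = young t" by blast
  have sum: "s + t \<in> word_space A deg" using st by (intro tensor.subspace_add subspace_word_space)
  have "x + y = young (s + t)"
    unfolding st(3,4) young_symmetrizer_eq[OF st(1)] young_symmetrizer_eq[OF st(2)]
      young_symmetrizer_eq[OF sum] symmetrize_add by (rule refl)
  then show "x + y \<in> young ` word_space A deg" using sum by blast
next
  fix c x assume "x \<in> young ` word_space A deg"
  then obtain s where s: "s \<in> word_space A deg" "x = young s" by blast
  have cs: "tensor_scale c s \<in> word_space A deg"
    using s by (intro tensor.subspace_scale subspace_word_space)
  have "tensor_scale c x = young (tensor_scale c s)"
    unfolding s(2) young_symmetrizer_eq[OF s(1)] young_symmetrizer_eq[OF cs] symmetrize_scale by (rule refl)
  then show "tensor_scale c x \<in> young ` word_space A deg" using cs by blast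
qed

definition row_word :: "nat list" where "row_word = map row_of [0..<deg]"

lemma row_word_nth [simp]: "s < deg \<Longrightarrow> row_word ! s = row_of s"
  by (simp add: row_word_def)

lemma length_row_word [simp]: "length row_word = deg"
  by (simp add: row_word_def)

lemma row_word_words: "row_word \<in> words {..<length lam} deg"
  using row_of_less by (auto simp: words_def row_word_def)

lemma row_word_fixed: "\<sigma> \<in> fiber_group deg row_of \<Longrightarrow> permute_list \<sigma> row_word = row_word"
  using permutes_in_image[of \<sigma> "{..<deg}"]
  by (intro nth_equalityI) (auto simp: permute_list_nth fiber_group_def)

lemma row_sym_row_word:
  "row_sym (basis_tensor row_word) = tensor_scale (of_nat (card (fiber_group deg row_of))) (basis_tensor row_word)"
proof -
  have "row_sym (basis_tensor row_word) = (\<Sum>\<sigma>\<in>fiber_group deg row_of. basis_tensor row_word)"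
    unfolding symmetrize_def
    by (intro sum.cong refl)
      (simp add: perm_character_def tensor_perm_basis_tensor fiber_group_permutes row_word_fixed)
  then show ?thesis by (intro ext) (simp add: sum_tensor scale_tensor)
qed

text \<open>The tensor \<open>t\<^sub>0\<close>.\<close>

definition hw_tensor :: tensor where
  "hw_tensor = young (basis_tensor row_word)"

lemma hw_tensor_eq:
  "hw_tensor = tensor_scale (of_nat (card (fiber_group deg row_of))) (col_antisym (basis_tensor row_word))"
  unfolding hw_tensor_def
  by (simp add: young_symmetrizer_eq[OF basis_tensor_word_space[OF row_word_words]]
      row_sym_row_word symmetrize_scale)

text \<open>A column permutation fixing \<open>row_word\<close> preserves rows and columns and is the identity. So the coefficient
  of \<open>e\<^sub>T\<close> in its column antisymmetrization is 1.\<close>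

lemma hw_tensor_nz: "hw_tensor \<noteq> 0"
proof -
  have only_id: "\<sigma> = id" if \<sigma>: "\<sigma> \<in> fiber_group deg col_of" "permute_list \<sigma> row_word = row_word" for \<sigma>
  proof
    fix s
    have p: "\<sigma> permutes {..<deg}" using \<sigma> by (simp add: fiber_group_permutes)
    show "\<sigma> s = id s"
    proof (cases "s < deg")
      case True
      then have less: "\<sigma> s < deg" using permutes_in_image[OF p] by simp
      have "row_of (\<sigma> s) = row_of s"
        using arg_cong[OF \<sigma>(2), of "\<lambda>w. w ! s"] True p less by (simp add: permute_list_nth)
      moreover have "col_of (\<sigma> s) = col_of s" using \<sigma>(1) True by (simp add: fiber_group_def)
      ultimately show ?thesis using box_eqI less True by simp
    qed (use p in \<open>simp add: permutes_not_in\<close>)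
  qed
  have "col_antisym (basis_tensor row_word) row_word =
      (\<Sum>\<sigma>\<in>fiber_group deg col_of. if \<sigma> = id then 1 else 0)"
    unfolding symmetrize_def sum_tensor scale_tensor
  proof (intro sum.cong refl)
    fix \<sigma> assume \<sigma>: "\<sigma> \<in> fiber_group deg col_of"
    show "perm_character True \<sigma> * tensor_perm \<sigma> (basis_tensor row_word) row_word =
        (if \<sigma> = id then 1 else 0)"
    proof -
      have "tensor_perm \<sigma> (basis_tensor row_word) = basis_tensor (permute_list \<sigma> row_word)"
        using fiber_group_permutes[OF \<sigma>] by (intro tensor_perm_basis_tensor) simp
      then show ?thesis
        using only_id[OF \<sigma>] by (auto simp: basis_tensor_def perm_character_def)
    qed
  qed
  also have "\<dots> = 1" using id_fiber_group by simp
  finally have "hw_tensor row_word \<noteq> 0" by (simp add: hw_tensor_eq scale_tensor)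
  then show ?thesis by auto
qed

text \<open>On the image of the Young symmetrizer, the Hermitian product with \<open>t\<^sub>0\<close> is a nonzero multiple of the
  coefficient of \<open>e\<^sub>T\<close>: the column antisymmetrizer is self-adjoint and acts on this image by a scalar.\<close>

lemma hermitian_hw_tensor:
  assumes r: "r = young t" "t \<in> word_space {..<N} deg" and N: "length lam \<le> N"
    and orth: "hermitian N deg r hw_tensor = 0"
  shows "r row_word = 0"
proof -
  have w: "row_word \<in> words {..<N} deg" using row_word_words N by (auto simp: words_def)
  have "hermitian N deg r hw_tensor =
      of_nat (card (fiber_group deg row_of)) * hermitian N deg (col_antisym r) (basis_tensor row_word)"
    by (simp add: hw_tensor_eq hermitian_scale_right hermitian_symmetrize)
  also have "col_antisym r = tensor_scale (of_nat (card (fiber_group deg col_of))) r"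
    unfolding r(1) young_symmetrizer_eq[OF r(2)]
    by (rule symmetrize_symmetrize[OF symmetrize_word_space[OF r(2)]])
  finally show ?thesis using orth by (simp add: hermitian_scale_left hermitian_basis_tensor[OF w])
qed

text \<open>If \<open>r = b a t\<close> with row symmetrizer \<open>a\<close> and column antisymmetrizer \<open>b\<close>, then
  \<open>\<langle>r, r\<rangle> = \<langle>a t, b r\<rangle> = |C| \<langle>a t, r\<rangle> = |C| \<langle>t, a r\<rangle>\<close>, where \<open>C\<close> is the column group.\<close>

lemma young_image_row_sym_inj:
  assumes r: "r = young t" "t \<in> word_space {..<N} deg" and z: "row_sym r = 0"
  shows "r = 0"
proof (rule hermitian_self_eq_0)
  show rw: "r \<in> word_space {..<N} deg" using r by (simp add: young_symmetrizer_word_space)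
  have "hermitian N deg r r = hermitian N deg (row_sym t) (col_antisym r)"
    using r(1) by (metis young_symmetrizer_eq[OF r(2)] hermitian_symmetrize)
  also have "col_antisym r = tensor_scale (of_nat (card (fiber_group deg col_of))) r"
    unfolding r(1) young_symmetrizer_eq[OF r(2)]
    by (rule symmetrize_symmetrize[OF symmetrize_word_space[OF r(2)]])
  also have "hermitian N deg (row_sym t) \<dots> = 0"
    unfolding hermitian_scale_right hermitian_symmetrize z by simp
  finally show "hermitian N deg r r = 0" .
qed

text \<open>In each column, distinct letters with the letter in row \<open>i\<close> at most \<open>i\<close> must be \<open>0, 1, 2, \<dots>\<close> from the top.\<close>

lemma bounded_word_eq_row_word:
  assumes w: "length w = deg" "\<And>s. s < deg \<Longrightarrow> w ! s \<le> row_of s"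
    and distinct: "\<And>s s'. s < deg \<Longrightarrow> s' < deg \<Longrightarrow> s \<noteq> s' \<Longrightarrow> col_of s = col_of s' \<Longrightarrow> w ! s \<noteq> w ! s'"
  shows "w = row_word"
proof -
  have "w ! s = row_of s" if "s < deg" for s
    using that
  proof (induction "row_of s" arbitrary: s rule: less_induct)
    case less
    show ?case
    proof (rule ccontr)
      assume "w ! s \<noteq> row_of s"
      with w(2)[OF less.prems] have lt: "w ! s < row_of s" by simp
      have "(row_of s, col_of s) \<in> boxes lam" using box_of[OF less.prems] by simp
      then have b: "(w ! s, col_of s) \<in> boxes lam"
        using lt sorted_wrt_nth_less[OF decreasing lt] by (auto simp: boxes_def)
      define s' where "s' = T (w ! s, col_of s)"
      have s': "s' < deg" "row_of s' = w ! s" "col_of s' = col_of s"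
        using T_less[OF b] row_col_T[OF b] by (simp_all add: s'_def)
      then have "w ! s' = w ! s" using less.hyps[of s'] lt by simp
      moreover have "s' \<noteq> s" using s' lt by auto
      ultimately show False using distinct[of s' s] s' less.prems by simp
    qed
  qed
  then show ?thesis using w(1) by (intro nth_equalityI) simp_all
qed

end

section \<open>The Schur power of the Lagrangian subspace\<close>

text \<open>The operator \<open>e\<^sub>i \<mapsto> e\<^sub>j\<close> of \<open>gl(L)\<close>, extended to an element of \<open>sp\<close>.\<close>

definition gl_lowering :: "nat \<Rightarrow> nat \<Rightarrow> nat \<Rightarrow> complex mat" where
  "gl_lowering n i j = mat (2*n+2) (2*n+2) (\<lambda>(r, c).
     if r = j \<and> c = i then 1 else if r = 2*n+1-i \<and> c = 2*n+1-j then - 1 else 0)"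

text \<open>The operator \<open>e\<^sub>b \<mapsto> e\<^bsub>2n+1-a\<^esub>\<close>, \<open>e\<^sub>a \<mapsto> e\<^bsub>2n+1-b\<^esub>\<close>. It is a sum so that it has
  the factor 2 for \<open>a = b\<close>, which makes its adjoint the symmetrization of \<open>e\<^bsub>2n+1-a\<^esub> \<mapsto> e\<^sub>b\<close> in all cases.\<close>

definition siegel_lowering :: "nat \<Rightarrow> nat \<Rightarrow> nat \<Rightarrow> complex mat" where
  "siegel_lowering n a b = mat (2*n+2) (2*n+2) (\<lambda>(r, c).
     (if r = 2*n+1-a \<and> c = b then 1 else 0) + (if r = 2*n+1-b \<and> c = a then 1 else 0))"

lemma mem_intermediate_spI:
  assumes "X \<in> sp n" "\<And>i. i < 2*n+2 \<Longrightarrow> X $$ (i, n) = 0"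
  shows "X \<in> intermediate_sp n"
proof -
  have "X *\<^sub>v unit_vec (2*n+2) n = 0\<^sub>v (2*n+2)"
    using sp_carrier[OF assms(1)] assms(2) by (intro eq_vecI) (auto simp: scalar_prod_right_unit)
  then show ?thesis using assms(1) by (simp add: intermediate_sp_def)
qed

lemma gl_lowering_intermediate:
  assumes "i < j" "j \<le> n"
  shows "gl_lowering n i j \<in> intermediate_sp n"
proof (rule mem_intermediate_spI)
  show "gl_lowering n i j \<in> sp n"
    unfolding mem_sp_iff
  proof (intro conjI allI impI)
    fix r c assume rc: "r < 2*n+2" "c < 2*n+2"
    have "2*n+1-c = j \<and> 2*n+1-r = i \<longleftrightarrow> r = 2*n+1-i \<and> c = 2*n+1-j"
      "2*n+1-c = 2*n+1-i \<and> 2*n+1-r = 2*n+1-j \<longleftrightarrow> r = j \<and> c = i"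
      "\<not> (r = j \<and> c = i \<and> r = 2*n+1-i \<and> c = 2*n+1-j)"
      using rc assms by linarith+
    moreover have "symp_sign n i = 1" "symp_sign n j = 1"
      "symp_sign n (2*n+1-i) = - 1" "symp_sign n (2*n+1-j) = - 1"
      using assms by (auto simp: symp_sign_def)
    ultimately show "symp_sign n r * gl_lowering n i j $$ (r, c) +
        symp_sign n c * gl_lowering n i j $$ (2*n+1-c, 2*n+1-r) = 0"
      using rc by (simp add: gl_lowering_def) metis
  qed (simp add: gl_lowering_def)
qed (use assms in \<open>auto simp: gl_lowering_def\<close>)

lemma gl_lowering_nonzeroD:
  assumes "gl_lowering n i j $$ (r, c) \<noteq> 0" "r < 2*n+2" "c < 2*n+2"
  shows "r = j \<and> c = i \<or> r = 2*n+1-i \<and> c = 2*n+1-j"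
  using assms unfolding gl_lowering_def by (simp split: if_splits)

lemma siegel_lowering_nonzeroD:
  assumes "siegel_lowering n a b $$ (r, c) \<noteq> 0" "r < 2*n+2" "c < 2*n+2"
  shows "r = 2*n+1-a \<and> c = b \<or> r = 2*n+1-b \<and> c = a"
  using assms unfolding siegel_lowering_def by (simp split: if_splits)

lemma gl_lowering_block:
  assumes "i < j" "j \<le> n" "a \<le> n" "n < b" "b < 2*n+2"
  shows "gl_lowering n i j $$ (a, b) = 0" "gl_lowering n i j $$ (b, a) = 0"
proof -
  have "\<not> (a = j \<and> b = i \<or> a = 2*n+1-i \<and> b = 2*n+1-j)"
    "\<not> (b = j \<and> a = i \<or> b = 2*n+1-i \<and> a = 2*n+1-j)"
    using assms by linarith+
  then show "gl_lowering n i j $$ (a, b) = 0" "gl_lowering n i j $$ (b, a) = 0"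
    using gl_lowering_nonzeroD[of n i j a b] gl_lowering_nonzeroD[of n i j b a] assms by fastforce+
qed

lemma siegel_lowering_intermediate:
  assumes "a < n" "b < n"
  shows "siegel_lowering n a b \<in> intermediate_sp n"
proof (rule mem_intermediate_spI)
  show "siegel_lowering n a b \<in> sp n"
    unfolding mem_sp_iff
  proof (intro conjI allI impI)
    fix r c assume rc: "r < 2*n+2" "c < 2*n+2"
    have "2*n+1-c = 2*n+1-a \<and> 2*n+1-r = b \<longleftrightarrow> r = 2*n+1-b \<and> c = a"
      "2*n+1-c = 2*n+1-b \<and> 2*n+1-r = a \<longleftrightarrow> r = 2*n+1-a \<and> c = b"
      using rc assms by linarith+
    moreover have "symp_sign n a = 1" "symp_sign n b = 1"
      "symp_sign n (2*n+1-a) = - 1" "symp_sign n (2*n+1-b) = - 1"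
      using assms by (auto simp: symp_sign_def)
    ultimately show "symp_sign n r * siegel_lowering n a b $$ (r, c) +
        symp_sign n c * siegel_lowering n a b $$ (2*n+1-c, 2*n+1-r) = 0"
      using rc by (simp add: siegel_lowering_def)
  qed (simp add: siegel_lowering_def)
qed (use assms in \<open>auto simp: siegel_lowering_def\<close>)

context numbered_diagram
begin

text \<open>Row invariant tensors form a product of symmetric powers. Of all words in the support take one with the
  row sums of its letters as small as possible, upper rows counting more, and let \<open>i\<close> be the first row with
  a letter \<open>j > i\<close>. Replace this letter by \<open>i\<close> and evaluate there the equation for the raising
  operator \<open>e\<^sub>j \<mapsto> e\<^sub>i\<close>: a term that puts \<open>j\<close> back into row \<open>i\<close> gives the coefficient of the chosen word, rows
  above \<open>i\<close> do not contain \<open>i\<close>, and rows below \<open>i\<close> give smaller words. So a multiple of the coefficient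
  vanishes, unless each row \<open>i\<close> only has letters at most \<open>i\<close>.\<close>

lemma row_invariant_highest_eq_0:
  assumes len: "length lam = n + 1" and y: "y \<in> word_space {..n} deg"
    and inv: "\<And>\<sigma>. \<sigma> \<in> fiber_group deg row_of \<Longrightarrow> tensor_perm \<sigma> y = y"
    and raise: "\<And>i j w. i < j \<Longrightarrow> j \<le> n \<Longrightarrow> w \<in> words {..n} deg \<Longrightarrow>
      (\<Sum>s | s < deg \<and> w ! s = i. y (w[s := j])) = 0"
    and bounded: "\<And>w. length w = deg \<Longrightarrow> (\<forall>s<deg. w ! s \<le> row_of s) \<Longrightarrow> y w = 0"
  shows "y = 0"
proof (rule ccontr)
  assume "y \<noteq> 0"
  then obtain w0 where w0: "y w0 \<noteq> 0" by (metis ext zero_fun_apply)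
  \<comment> \<open>The last index of a row is \<open>n\<close>; the weights decrease by 1 from row to row.\<close>
  define f where "f u = (\<Sum>s<deg. (n - row_of s) * u ! s)" for u :: "nat list"
  have f_upd: "f (u[s := a]) + (n - row_of s) * u ! s = f u + (n - row_of s) * a"
    if "s < deg" "length u = deg" for u s a
  proof -
    have "(\<Sum>s'\<in>{..<deg} - {s}. (n - row_of s') * u[s := a] ! s') =
        (\<Sum>s'\<in>{..<deg} - {s}. (n - row_of s') * u ! s')"
      by (intro sum.cong) auto
    then show ?thesis
      using that unfolding f_def by (simp add: sum.remove[of "{..<deg}" s])
  qed
  obtain w where w: "y w \<noteq> 0" and least: "\<And>u. y u \<noteq> 0 \<Longrightarrow> f w \<le> f u"
    using ex_has_least_nat[of "\<lambda>u. y u \<noteq> 0" w0 f] w0 by blast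
  have wW: "w \<in> words {..n} deg" using w word_space_zero[OF y] by blast
  then have wl: "length w = deg" by (simp add: words_def)
  obtain s1 where "s1 < deg \<and> row_of s1 < w ! s1" using bounded[OF wl] w not_le by blast
  then obtain s0 where s0: "s0 < deg" "row_of s0 < w ! s0"
    and first: "\<And>s. s < deg \<Longrightarrow> row_of s < w ! s \<Longrightarrow> row_of s0 \<le> row_of s"
    using ex_has_least_nat[of "\<lambda>s. s < deg \<and> row_of s < w ! s" s1 row_of] by blast
  define i j where "i = row_of s0" and "j = w ! s0"
  have ij: "i < j" "j \<le> n" using s0 words_nth[OF wW s0(1)] by (auto simp: i_def j_def)
  define w' where "w' = w[s0 := i]"
  have w': "w' \<in> words {..n} deg" unfolding w'_def using wW ij by (intro words_update) auto
  let ?S = "{s. s < deg \<and> w' ! s = i}"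
  have val: "y (w'[s := j]) = (if row_of s = i then y w else 0)" if s: "s \<in> ?S" for s
  proof (cases "s = s0")
    case True
    then show ?thesis by (simp add: w'_def i_def j_def)
  next
    case False
    then have ws: "s < deg" "w ! s = i" using s by (auto simp: w'_def)
    consider "row_of s = i" | "row_of s < i" | "i < row_of s" by linarith
    then show ?thesis
    proof cases
      case 1
      let ?\<tau> = "Transposition.transpose s0 s"
      have \<tau>: "?\<tau> permutes {..<deg}" using s0 ws by (simp add: permutes_swap_id)
      have "?\<tau> \<in> fiber_group deg row_of"
        using \<tau> 1 by (auto simp: fiber_group_def transpose_def i_def)
      then have "y w = y (permute_list ?\<tau> w)"
        using fun_cong[OF inv, of ?\<tau> w] by (simp add: tensor_perm_def)
      also have "permute_list ?\<tau> w = w'[s := j]"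
        using \<tau> wl ws s0 False
        by (intro nth_equalityI)
          (auto simp: permute_list_nth transpose_def w'_def nth_list_update j_def)
      finally show ?thesis using 1 by simp
    next
      case 2
      then show ?thesis using first[of s] ws by (simp add: i_def)
    next
      case 3
      have rn: "row_of s \<le> n" using row_of_less[OF ws(1)] len by simp
      obtain e where e: "j = i + e" "e > 0" using ij(1) less_imp_add_positive by blast
      obtain c where c: "n - i = (n - row_of s) + c" "c > 0"
        using 3 rn by (intro that[of "row_of s - i"]) auto
      have "f w' + (n - i) * j = f w + (n - i) * i"
        using f_upd[OF s0(1) wl, of i] by (simp add: w'_def i_def j_def)
      moreover have "f (w'[s := j]) + (n - row_of s) * i = f w' + (n - row_of s) * j"
        using f_upd[of s w' j] s w' by (simp add: words_def)
      ultimately have "f w = f (w'[s := j]) + c * e"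
        unfolding c(1) e(1) by (simp add: algebra_simps)
      moreover have "c * e > 0" using c e by simp
      ultimately have "f (w'[s := j]) < f w" by linarith
      then have "y (w'[s := j]) = 0" using least not_le by blast
      then show ?thesis using 3 by simp
    qed
  qed
  have "0 = (\<Sum>s\<in>?S. y (w'[s := j]))" using raise[OF ij w'] by simp
  also have "\<dots> = (\<Sum>s\<in>?S. if row_of s = i then y w else 0)"
    by (rule sum.cong[OF refl val])
  also have "\<dots> = of_nat (card {s \<in> ?S. row_of s = i}) * y w"
    by (subst sum.inter_filter[symmetric]) simp_all
  finally have "card {s \<in> ?S. row_of s = i} = 0" using w by simp
  moreover have "s0 \<in> {s \<in> ?S. row_of s = i}" using s0 wl by (simp add: w'_def i_def)
  moreover have "finite {s \<in> ?S. row_of s = i}" by simp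
  ultimately show False unfolding card_eq_0_iff by blast
qed

lemma derivation_star_gl_lowering:
  assumes ij: "i < j" "j \<le> n" and y: "y \<in> word_space {..n} d" and w: "w \<in> words {..n} d"
  shows "derivation (2*n+2) (mat_star (2*n+2) (gl_lowering n i j)) y w =
    (\<Sum>s | s < d \<and> w ! s = i. y (w[s := j]))"
proof -
  let ?N = "2*n+2"
  have "derivation ?N (mat_star ?N (gl_lowering n i j)) y w =
      (\<Sum>s<d. \<Sum>a<?N. if a = j then if w ! s = i then y (w[s := j]) else 0 else 0)"
  proof -
    have "set w \<subseteq> {..<?N}" "length w = d" using w by (auto simp: words_def)
    moreover have "mat_star ?N (gl_lowering n i j) $$ (w ! s, a) =
        (if a = j \<and> w ! s = i then 1 else 0)" if "s < d" "a < ?N" for s a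
      using words_nth[OF w that(1)] that ij by (auto simp: gl_lowering_def)
    ultimately show ?thesis
      unfolding derivation_def
      by (simp only: if_True) (intro sum.cong refl, auto)
  qed
  also have "\<dots> = (\<Sum>s<d. if w ! s = i then y (w[s := j]) else 0)"
    using ij by (simp add: sum.delta)
  also have "\<dots> = (\<Sum>s \<in> {s \<in> {..<d}. w ! s = i}. y (w[s := j]))"
    by (rule sum.inter_filter[symmetric]) simp
  finally show ?thesis by (simp add: lessThan_def)
qed

text \<open>Let \<open>r\<close> be a tensor in the Schur power of \<open>L\<close> that is killed by the raising operators of \<open>gl(L)\<close> and
  orthogonal to \<open>t\<^sub>0\<close>, hence without \<open>e\<^sub>T\<close> term. Its row symmetrization satisfies the same
  equations. As \<open>r\<close> is antisymmetric along columns, the only words with letters at most \<open>i\<close> in row \<open>i\<close>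
  that could contribute are row permutations of the word of \<open>e\<^sub>T\<close>. So the row symmetrization is 0, and
  then \<open>r = 0\<close>.\<close>

lemma lagrangian_schur_power_generated:
  assumes len: "length lam = n + 1"
    and Z: "tensor.subspace Z" "Z \<subseteq> word_space {..<2*n+2} deg"
    and stable: "\<And>X z. X \<in> intermediate_sp n \<Longrightarrow> z \<in> Z \<Longrightarrow> derivation (2*n+2) X z \<in> Z"
    and hw: "hw_tensor \<in> Z"
  shows "young ` word_space {..n} deg \<subseteq> Z"
proof -
  let ?N = "2*n+2" and ?A = "young ` word_space {..n} deg"
  define G where "G = {gl_lowering n i j | i j. i < j \<and> j \<le> n}"
  have full: "word_space {..n} deg \<subseteq> word_space {..<?N} deg"
    by (rule word_space_mono) auto
  have A: "tensor.subspace ?A" "?A \<subseteq> word_space {..<?N} deg"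
    using subspace_young_image young_symmetrizer_word_space full by blast+
  have lag: "derivation ?N X x \<in> ?A"
    if x: "x \<in> ?A" and X: "\<And>a b. a \<le> n \<Longrightarrow> b < ?N \<Longrightarrow> n < b \<Longrightarrow> X $$ (b, a) = 0" for X x
  proof -
    obtain t where t: "t \<in> word_space {..n} deg" "x = young t"
      using x by blast
    have "derivation ?N X t \<in> word_space {..n} deg"
      by (rule derivation_word_space[OF _ _ t(1)]) (use X in auto)
    then show ?thesis
      using young_symmetrizer_derivation[of t ?N X] t full by blast
  qed
  have "?A \<subseteq> Z \<inter> ?A"
  proof (rule orthogonal_descent[OF A, of _ G])
    show "tensor.subspace (Z \<inter> ?A)" using Z(1) A(1) by (rule tensor.subspace_inter)
    show "Z \<inter> ?A \<subseteq> ?A" by blast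
    show "j < i" if X: "X \<in> G" and ij: "i < ?N" "j < ?N" "X $$ (i, j) \<noteq> 0" for X i j
    proof -
      obtain i' j' where X': "X = gl_lowering n i' j'" "i' < j'" "j' \<le> n"
        using X unfolding G_def by blast
      show ?thesis
        using gl_lowering_nonzeroD[OF ij(3)[unfolded X'(1)] ij(1,2)] X'(2,3) by linarith
    qed
    show "derivation ?N X z \<in> Z \<inter> ?A" if X: "X \<in> G" and z: "z \<in> Z \<inter> ?A" for X z
    proof -
      obtain i j where ij: "X = gl_lowering n i j" "i < j" "j \<le> n"
        using X unfolding G_def by blast
      have "derivation ?N X z \<in> ?A"
        using z gl_lowering_block(2)[OF ij(2,3)] unfolding ij(1) by (intro lag) simp_all
      moreover have "derivation ?N X z \<in> Z"
        using z unfolding ij(1) by (intro stable gl_lowering_intermediate[OF ij(2,3)]) simp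
      ultimately show ?thesis by blast
    qed
    show "derivation ?N (mat_star ?N X) r \<in> ?A" if X: "X \<in> G" and r: "r \<in> ?A" for X r
    proof (rule lag[OF r])
      fix a b assume ab: "a \<le> n" "b < ?N" "n < b"
      obtain i j where ij: "X = gl_lowering n i j" "i < j" "j \<le> n"
        using X unfolding G_def by blast
      have "X $$ (a, b) = 0" unfolding ij(1) by (rule gl_lowering_block(1)[OF ij(2,3) ab(1,3,2)])
      then show "mat_star ?N X $$ (b, a) = 0" using ab by simp
    qed
  next
    fix r assume r: "r \<in> ?A" and orth: "\<forall>z\<in>Z \<inter> ?A. hermitian ?N deg r z = 0"
      and killed: "\<forall>X\<in>G. derivation ?N (mat_star ?N X) r = 0"
    obtain t where t: "t \<in> word_space {..n} deg" "r = young t"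
      using r by blast
    have tN: "t \<in> word_space {..<?N} deg" using t full by blast
    have rn: "r \<in> word_space {..n} deg" using t young_symmetrizer_word_space by blast
    have rN: "r \<in> word_space {..<?N} deg" using rn full by blast
    have "basis_tensor row_word \<in> word_space {..n} deg"
      using row_word_words len by (intro basis_tensor_word_space) (auto simp: words_def)
    then have "hw_tensor \<in> Z \<inter> ?A" using hw by (auto simp: hw_tensor_def)
    then have rw: "r row_word = 0"
      using orth len by (intro hermitian_hw_tensor[OF t(2) tN]) auto
    have "row_sym r = 0"
    proof (rule row_invariant_highest_eq_0[OF len])
      show y: "row_sym r \<in> word_space {..n} deg" by (rule symmetrize_word_space[OF rn])
      show "tensor_perm \<sigma> (row_sym r) = row_sym r" if "\<sigma> \<in> fiber_group deg row_of" for \<sigma>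
        using tensor_perm_symmetrize[OF rn that, of False] by (simp add: perm_character_def)
      show "(\<Sum>s | s < deg \<and> w ! s = i. row_sym r (w[s := j])) = 0"
        if ij: "i < j" "j \<le> n" and w: "w \<in> words {..n} deg" for i j w
      proof -
        have "gl_lowering n i j \<in> G" using ij by (auto simp: G_def)
        then have "derivation ?N (mat_star ?N (gl_lowering n i j)) (row_sym r) = row_sym 0"
          using killed symmetrize_derivation[OF rN] by metis
        also have "row_sym 0 = 0"
          using symmetrize_scale[of False deg row_of 0 0] by (metis tensor.scale_zero_left)
        finally show ?thesis using derivation_star_gl_lowering[OF ij y w] by simp
      qed
      show "row_sym r w = 0"
        if w: "length w = deg" "\<forall>s<deg. w ! s \<le> row_of s" for w
      proof -
        have "tensor_perm \<sigma> r w = 0" if \<sigma>: "\<sigma> \<in> fiber_group deg row_of" for \<sigma>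
        proof (rule ccontr)
          let ?g = "inv_into UNIV \<sigma>"
          let ?w = "permute_list ?g w"
          have g: "?g \<in> fiber_group deg row_of" using \<sigma> by (rule fiber_group_inv)
          then have gp: "?g permutes {..<deg}" by (rule fiber_group_permutes)
          assume "tensor_perm \<sigma> r w \<noteq> 0"
          then have nz: "r ?w \<noteq> 0" by (simp add: tensor_perm_def)
          have "?w = row_word"
          proof (rule bounded_word_eq_row_word)
            show "?w ! s \<le> row_of s" if "s < deg" for s
              using w that g gp permutes_in_image[OF gp, of s]
              by (auto simp: permute_list_nth fiber_group_def)
            show "?w ! s \<noteq> ?w ! s'"
              if s: "s < deg" "s' < deg" "s \<noteq> s'" "col_of s = col_of s'" for s s'
              using antisymmetrize_repeated[OF symmetrize_word_space[OF t(1)] s] nz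
              by (auto simp: t(2) young_symmetrizer_eq[OF t(1)])
          qed (use w in simp)
          then show False using nz rw by simp
        qed
        then show ?thesis by (simp add: symmetrize_def sum_tensor scale_tensor)
      qed
    qed
    then show "r = 0" by (rule young_image_row_sym_inj[OF t(2) tN])
  qed
  then show ?thesis by blast
qed

end

section \<open>Traceless tensors on the odd symplectic space\<close>

abbreviation odd_letters :: "nat \<Rightarrow> nat set" where
  "odd_letters n \<equiv> {..<2*n+2} - {n+1}"

text \<open>The two halves of the trace cancel; the letters \<open>n\<close> and \<open>n + 1\<close> do not contribute, as \<open>n + 1\<close> does not
  occur in \<open>u\<close>.\<close>

lemma traceless_swap:
  assumes u: "u \<in> word_space (odd_letters n) d" and tr: "traceless n d u"
    and x: "x \<in> words {..<2*n+2} d" and pq: "p < d" "q < d" "p \<noteq> q"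
  shows "(\<Sum>a<n. u (x[p := 2*n+1-a, q := a])) = (\<Sum>a<n. u (x[p := a, q := 2*n+1-a]))"
proof -
  have main: "(\<Sum>a<n. u (x[p := 2*n+1-a, q := a])) = (\<Sum>a<n. u (x[p := a, q := 2*n+1-a]))"
    if "p < q" "q < d" for p q
  proof -
    let ?g = "\<lambda>c. symp_sign n c * u (x[p := c, q := 2*n+1-c])"
    have len: "length x = d" using x by (simp add: words_def)
    have bad: "u y = 0" if "s < d" "length y = d" "y ! s = n+1" for y s
      using words_nth[of y "odd_letters n" d s] word_space_zero[OF u, of y] that by auto
    have "{..<2*n+2} = ({..<n} \<union> {n, n+1}) \<union> {n+2..2*n+1}" by auto
    moreover have "sum ?g (({..<n} \<union> {n, n+1}) \<union> {n+2..2*n+1}) =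
        sum ?g ({..<n} \<union> {n, n+1}) + sum ?g {n+2..2*n+1}"
      by (rule sum.union_disjoint) auto
    moreover have "sum ?g ({..<n} \<union> {n, n+1}) = sum ?g {..<n} + sum ?g {n, n+1}"
      by (rule sum.union_disjoint) auto
    ultimately have "(\<Sum>c<2*n+2. ?g c) =
        (\<Sum>c<n. ?g c) + (\<Sum>c\<in>{n, n+1}. ?g c) + (\<Sum>c\<in>{n+2..2*n+1}. ?g c)" by simp
    moreover have "(\<Sum>c\<in>{n, n+1}. ?g c) = 0"
      using bad[of q "x[p := n, q := 2*n+1-n]"] bad[of p "x[p := n+1, q := 2*n+1-(n+1)]"] that len
      by simp
    moreover have "(\<Sum>c<n. ?g c) = (\<Sum>a<n. u (x[p := a, q := 2*n+1-a]))"
      by (intro sum.cong) (auto simp: symp_sign_def)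
    moreover have "(\<Sum>c\<in>{n+2..2*n+1}. ?g c) = (\<Sum>a<n. - u (x[p := 2*n+1-a, q := a]))"
      by (rule sum.reindex_bij_witness[of _ "\<lambda>a. 2*n+1-a" "\<lambda>a. 2*n+1-a"])
        (auto simp: symp_sign_def)
    moreover have "(\<Sum>c<2*n+2. ?g c) = 0" using tr x that by (simp add: traceless_def)
    ultimately show ?thesis by (simp add: sum_negf)
  qed
  show ?thesis
  proof (cases "p < q")
    case True
    then show ?thesis using main pq by blast
  next
    case False
    then show ?thesis
      using main[of q p] pq by (simp add: list_update_swap[of p q])
  qed
qed

lemma derivation_star_siegel_lowering:
  assumes ab: "a < n" "b < n" and w: "w \<in> words {..<2*n+2} d"
  shows "derivation (2*n+2) (mat_star (2*n+2) (siegel_lowering n a b)) u w =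
    (\<Sum>s<d. if w ! s = b then u (w[s := 2*n+1-a]) else 0) +
    (\<Sum>s<d. if w ! s = a then u (w[s := 2*n+1-b]) else 0)"
proof -
  let ?N = "2*n+2"
  have "mat_star ?N (siegel_lowering n a b) $$ (w ! s, c) * u (w[s := c]) =
      (if c = 2*n+1-a then if w ! s = b then u (w[s := 2*n+1-a]) else 0 else 0) +
      (if c = 2*n+1-b then if w ! s = a then u (w[s := 2*n+1-b]) else 0 else 0)"
    if "s < d" "c < ?N" for s c
    using words_nth[OF w that(1)] that by (simp add: siegel_lowering_def)
  then have "derivation ?N (mat_star ?N (siegel_lowering n a b)) u w =
      (\<Sum>s<d. \<Sum>c<?N. (if c = 2*n+1-a then if w ! s = b then u (w[s := 2*n+1-a]) else 0 else 0) +
      (if c = 2*n+1-b then if w ! s = a then u (w[s := 2*n+1-b]) else 0 else 0))"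
    using w unfolding derivation_def words_def by simp
  also have "\<dots> = (\<Sum>s<d. (if w ! s = b then u (w[s := 2*n+1-a]) else 0) +
      (if w ! s = a then u (w[s := 2*n+1-b]) else 0))"
  proof -
    have "2*n+1-a < 2*n+2" "2*n+1-b < 2*n+2" by linarith+
    then show ?thesis by (simp only: sum.distrib sum.delta finite_lessThan lessThan_iff if_True)
  qed
  finally show ?thesis by (simp add: sum.distrib)
qed

text \<open>Let \<open>T\<^bsub>ab\<^esub>\<close> be the derivation by \<open>e\<^bsub>2n+1-a\<^esub> \<mapsto> e\<^sub>b\<close>. The raising operators are the sums
  \<open>T\<^bsub>ab\<^esub> + T\<^bsub>ba\<^esub>\<close>, so that \<open>\<Sum> \<langle>T\<^bsub>ab\<^esub> u, T\<^bsub>ba\<^esub> u\<rangle> = - \<Sum> \<parallel>T\<^bsub>ab\<^esub> u\<parallel>\<^sup>2 \<le> 0\<close>. On the other hand, expand the left side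
  over the positions \<open>s\<close> and \<open>s'\<close> where the two operators act. For \<open>s \<noteq> s'\<close> the terms add up to the
  product of a partial trace of \<open>u\<close> with the conjugate of the opposite partial trace, and the two are equal
  since \<open>u\<close> is traceless. For \<open>s = s'\<close> they add up to the squares of the coefficients of \<open>u\<close> at the
  words with a letter greater than \<open>n + 1\<close> at position \<open>s\<close>. So everything is nonnegative, and these coefficients
  vanish.\<close>

lemma traceless_siegel_killed:
  assumes u: "u \<in> word_space (odd_letters n) d" and tr: "traceless n d u"
    and killed: "\<And>a b. a < n \<Longrightarrow> b < n \<Longrightarrow>
      derivation (2*n+2) (mat_star (2*n+2) (siegel_lowering n a b)) u = 0"
  shows "u \<in> word_space {..n} d"
proof -
  let ?W = "words {..<2*n+2} d"
  define h where "h a b w s = (if w ! s = b then u (w[s := 2*n+1-a]) else 0)"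
    for a b :: nat and w :: "nat list" and s :: nat
  define T where "T a b w = (\<Sum>s<d. h a b w s)" for a b w
  have T: "T b a w = - T a b w" if "a < n" "b < n" "w \<in> ?W" for a b w
    using derivation_star_siegel_lowering[OF that, of u] killed[OF that(1,2)]
    by (simp add: T_def h_def add_eq_0_iff2)
  have finW: "finite ?W" by (simp add: finite_words)
  define Q where "Q s s' = (\<Sum>w\<in>?W. \<Sum>a<n. \<Sum>b<n. h a b w s * cnj (h b a w s'))" for s s'
  have expand: "(\<Sum>w\<in>?W. \<Sum>a<n. \<Sum>b<n. T a b w * cnj (T b a w)) = (\<Sum>s<d. \<Sum>s'<d. Q s s')"
  proof -
    have "(\<Sum>w\<in>?W. \<Sum>a<n. \<Sum>b<n. T a b w * cnj (T b a w)) =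
        (\<Sum>w\<in>?W. \<Sum>a<n. \<Sum>b<n. \<Sum>s<d. \<Sum>s'<d. h a b w s * cnj (h b a w s'))"
      unfolding T_def cnj_sum sum_product by (rule refl)
    also have "\<dots> = (\<Sum>w\<in>?W. \<Sum>a<n. \<Sum>s<d. \<Sum>s'<d. \<Sum>b<n. h a b w s * cnj (h b a w s'))"
      by (subst (4) sum.swap, subst (3) sum.swap) (rule refl)
    also have "\<dots> = (\<Sum>w\<in>?W. \<Sum>s<d. \<Sum>s'<d. \<Sum>a<n. \<Sum>b<n. h a b w s * cnj (h b a w s'))"
      by (subst (3) sum.swap, subst (2) sum.swap) (rule refl)
    also have "\<dots> = (\<Sum>s<d. \<Sum>s'<d. Q s s')"
      unfolding Q_def by (subst (2) sum.swap, subst sum.swap) (rule refl)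
    finally show ?thesis .
  qed
  have Q_off: "0 \<le> Re (Q s s')" if s: "s < d" "s' < d" "s \<noteq> s'" for s s'
  proof -
    \<comment> \<open>The words with the letters at positions \<open>s\<close> and \<open>s'\<close> left open; 0 is a placeholder.\<close>
    define X where "X = {x \<in> ?W. x ! s = 0 \<and> x ! s' = 0}"
    let ?F = "\<lambda>a x. u (x[s := 2*n+1-a, s' := a])" and ?G = "\<lambda>b x. u (x[s := b, s' := 2*n+1-b])"
    have one: "(\<Sum>w\<in>?W. h a b w s * cnj (h b a w s')) = (\<Sum>x\<in>X. ?F a x * cnj (?G b x))"
      if ab: "a < n" "b < n" for a b
    proof -
      have "(\<Sum>w\<in>?W. h a b w s * cnj (h b a w s')) =
          (\<Sum>w\<in>?W. if w ! s = b \<and> w ! s' = a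
            then u (w[s := 2*n+1-a]) * cnj (u (w[s' := 2*n+1-b])) else 0)"
        by (intro sum.cong) (auto simp: h_def)
      also have "\<dots> = (\<Sum>w\<in>{w \<in> ?W. w ! s = b \<and> w ! s' = a}.
            u (w[s := 2*n+1-a]) * cnj (u (w[s' := 2*n+1-b])))"
        by (rule sum.inter_filter[symmetric, OF finW])
      also have "\<dots> = (\<Sum>x\<in>X. ?F a x * cnj (?G b x))"
      proof (rule sum.reindex_bij_witness[of _ "\<lambda>x. x[s := b, s' := a]" "\<lambda>w. w[s := 0, s' := 0]"])
        fix w assume w: "w \<in> {w \<in> ?W. w ! s = b \<and> w ! s' = a}"
        then have len: "length w = d" by (simp add: words_def)
        show "w[s := 0, s' := 0, s := b, s' := a] = w"
          using w s len by (intro nth_equalityI) (auto simp: nth_list_update)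
        show "w[s := 0, s' := 0] \<in> X"
          unfolding X_def using w s len by (auto intro!: words_update)
        have "w[s := 0, s' := 0, s := 2*n+1-a, s' := a] = w[s := 2*n+1-a]"
          "w[s := 0, s' := 0, s := b, s' := 2*n+1-b] = w[s' := 2*n+1-b]"
          using w s len by (auto intro!: nth_equalityI simp: nth_list_update)
        then show "?F a (w[s := 0, s' := 0]) * cnj (?G b (w[s := 0, s' := 0])) =
            u (w[s := 2*n+1-a]) * cnj (u (w[s' := 2*n+1-b]))" by (simp only:)
      next
        fix x assume x: "x \<in> X"
        then have len: "length x = d" by (simp add: X_def words_def)
        show "x[s := b, s' := a, s := 0, s' := 0] = x"
          using x s len by (intro nth_equalityI) (auto simp: nth_list_update X_def)
        show "x[s := b, s' := a] \<in> {w \<in> ?W. w ! s = b \<and> w ! s' = a}"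
          using x s ab len unfolding X_def by (auto intro!: words_update)
      qed
      finally show ?thesis .
    qed
    have "Q s s' = (\<Sum>a<n. \<Sum>b<n. \<Sum>w\<in>?W. h a b w s * cnj (h b a w s'))"
      unfolding Q_def by (subst sum.swap, subst (2) sum.swap) (rule refl)
    also have "\<dots> = (\<Sum>a<n. \<Sum>b<n. \<Sum>x\<in>X. ?F a x * cnj (?G b x))"
      by (intro sum.cong refl one) auto
    also have "\<dots> = (\<Sum>x\<in>X. \<Sum>a<n. \<Sum>b<n. ?F a x * cnj (?G b x))"
      by (subst (2) sum.swap, subst sum.swap) (rule refl)
    also have "\<dots> = (\<Sum>x\<in>X. (\<Sum>a<n. ?F a x) * cnj (\<Sum>b<n. ?G b x))"
      by (simp add: sum_product cnj_sum)
    also have "\<dots> = (\<Sum>x\<in>X. (\<Sum>a<n. ?F a x) * cnj (\<Sum>a<n. ?F a x))"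
    proof (rule sum.cong[OF refl])
      fix x assume "x \<in> X"
      then have "(\<Sum>a<n. ?F a x) = (\<Sum>b<n. ?G b x)"
        by (intro traceless_swap[OF u tr _ s]) (simp add: X_def)
      then show "(\<Sum>a<n. ?F a x) * cnj (\<Sum>b<n. ?G b x) = (\<Sum>a<n. ?F a x) * cnj (\<Sum>a<n. ?F a x)"
        by simp
    qed
    finally have Q_eq: "Q s s' = (\<Sum>x\<in>X. (\<Sum>a<n. ?F a x) * cnj (\<Sum>a<n. ?F a x))" .
    have "0 \<le> Re (z * cnj z)" for z by simp
    then show ?thesis unfolding Q_eq Re_sum by (intro sum_nonneg)
  qed
  have Q_diag: "Re (Q s s) = (\<Sum>w\<in>?W. \<Sum>a<n. (cmod (h a a w s))\<^sup>2)" for s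
  proof -
    have "(\<Sum>a<n. \<Sum>b<n. h a b w s * cnj (h b a w s)) = (\<Sum>a<n. h a a w s * cnj (h a a w s))" for w
    proof (rule sum.cong[OF refl])
      fix a assume a: "a \<in> {..<n}"
      have "(\<Sum>b<n. h a b w s * cnj (h b a w s)) =
          (\<Sum>b<n. if b = a then h a a w s * cnj (h a a w s) else 0)"
        by (intro sum.cong) (auto simp: h_def)
      then show "(\<Sum>b<n. h a b w s * cnj (h b a w s)) = h a a w s * cnj (h a a w s)"
        using a by (simp add: sum.delta)
    qed
    then show ?thesis
      unfolding Q_def by (simp add: complex_norm_square[symmetric] del: of_real_power)
  qed
  have "Re (\<Sum>w\<in>?W. \<Sum>a<n. \<Sum>b<n. T a b w * cnj (T b a w)) \<le> 0"
  proof -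
    have "Re (T a b w * cnj (T b a w)) \<le> 0" if "w \<in> ?W" "a < n" "b < n" for w a b
      unfolding T[OF that(2,3,1)] by simp
    then show ?thesis by (simp only: Re_sum) (intro sum_nonpos, simp)
  qed
  then have le: "(\<Sum>s<d. \<Sum>s'<d. Re (Q s s')) \<le> 0" unfolding expand by simp
  have nonneg: "0 \<le> Re (Q s s')" if "s < d" "s' < d" for s s'
  proof (cases "s = s'")
    case True
    then show ?thesis unfolding True Q_diag by (intro sum_nonneg zero_le_power2)
  qed (use Q_off that in blast)
  have Q0: "Re (Q s s) = 0" if s: "s < d" for s
  proof -
    have "Re (Q s s) \<le> (\<Sum>s'<d. Re (Q s s'))"
      using s nonneg by (intro member_le_sum) auto
    also have "\<dots> \<le> (\<Sum>s<d. \<Sum>s'<d. Re (Q s s'))"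
      using s nonneg by (intro member_le_sum[of s "{..<d}" "\<lambda>s. \<Sum>s'<d. Re (Q s s')"]) (auto intro: sum_nonneg)
    finally show ?thesis using le nonneg[OF s s] by linarith
  qed
  have h0: "h a a w s = 0" if "s < d" "a < n" "w \<in> ?W" for s a w
  proof -
    have "(\<Sum>a<n. (cmod (h a a w s))\<^sup>2) = 0"
      using Q0[OF that(1)] that(3) unfolding Q_diag
      by (subst (asm) sum_nonneg_eq_0_iff[OF finW]) (auto intro: sum_nonneg)
    then show ?thesis
      using that(2) by (subst (asm) sum_nonneg_eq_0_iff) auto
  qed
  have "w \<in> words {..n} d" if nz: "u w \<noteq> 0" for w
  proof -
    have w: "w \<in> words (odd_letters n) d" using nz word_space_zero[OF u] by blast
    then have wW: "w \<in> ?W" by (auto simp: words_def)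
    have "w ! s \<le> n" if s: "s < d" for s
    proof (rule ccontr)
      assume "\<not> w ! s \<le> n"
      then have r: "n + 2 \<le> w ! s" "w ! s < 2*n+2" using words_nth[OF w s] by auto
      define a where "a = 2*n+1 - w ! s"
      have a: "a < n" "2*n+1-a = w ! s" using r by (auto simp: a_def)
      have "w[s := a] \<in> ?W" using wW a by (intro words_update) auto
      then have "h a a (w[s := a]) s = 0" using h0 s a by blast
      then show False using nz a s w by (simp add: h_def words_def)
    qed
    then show ?thesis using w by (auto simp: words_def in_set_conv_nth)
  qed
  then show ?thesis by (auto simp: word_space_def)
qed

context numbered_diagram
begin

text \<open>Permuting the factors does not change the set of letters, so that \<open>t\<close> can be replaced by its part with
  letters in \<open>B\<close>.\<close>

lemma young_symmetrizer_restrict: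
  assumes r: "r = young t" "t \<in> word_space A deg"
    and rB: "r \<in> word_space B deg"
  shows "r \<in> young ` word_space B deg"
proof -
  define cut where "cut x = (\<lambda>w. if w \<in> words B deg then x w else 0)" for x :: tensor
  have cut_sym: "symmetrize e deg f (cut x) = cut (symmetrize e deg f x)" for e f x
  proof
    fix w
    show "symmetrize e deg f (cut x) w = cut (symmetrize e deg f x) w"
      unfolding symmetrize_def cut_def sum_tensor scale_tensor tensor_perm_def
      by (auto intro!: sum.neutral
          simp: words_permute_list[OF permutes_inv[OF fiber_group_permutes]])
  qed
  have cB: "cut t \<in> word_space B deg" by (simp add: cut_def word_space_def)
  have "cut r = r" by (rule ext) (simp add: cut_def word_space_zero[OF rB])
  then have "r = young (cut t)"
    unfolding young_symmetrizer_eq[OF cB] cut_sym r(1) young_symmetrizer_eq[OF r(2)] by simp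
  then show ?thesis using cB by blast
qed

text \<open>The module \<open>W\<close>.\<close>

definition odd_schur :: "nat \<Rightarrow> tensor set" where
  "odd_schur n = {t \<in> young ` word_space (odd_letters n) deg.
     traceless n deg t}"

lemma odd_letters_full: "word_space (odd_letters n) d \<subseteq> word_space {..<2*n+2} d"
  by (rule word_space_mono) auto

lemma odd_schur_word_space: "odd_schur n \<subseteq> word_space (odd_letters n) deg"
  using young_symmetrizer_word_space by (auto simp: odd_schur_def)

lemma subspace_odd_schur: "tensor.subspace (odd_schur n)"
proof (rule tensor.subspaceI)
  show "0 \<in> odd_schur n"
    using tensor.subspace_0[OF subspace_young_image] traceless_zero by (simp add: odd_schur_def)
  show "x + y \<in> odd_schur n" if "x \<in> odd_schur n" "y \<in> odd_schur n" for x y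
    using that tensor.subspace_add[OF subspace_young_image] traceless_add
    unfolding odd_schur_def mem_Collect_eq by blast
  show "tensor_scale c x \<in> odd_schur n" if "x \<in> odd_schur n" for c x
    using that tensor.subspace_scale[OF subspace_young_image] traceless_scale
    unfolding odd_schur_def mem_Collect_eq by blast
qed

lemma derivation_odd_schur:
  assumes X: "X \<in> sp n" "\<And>a. a < 2*n+2 \<Longrightarrow> a \<noteq> n+1 \<Longrightarrow> X $$ (n+1, a) = 0"
    and x: "x \<in> odd_schur n"
  shows "derivation (2*n+2) X x \<in> odd_schur n"
proof -
  obtain t where t: "t \<in> word_space (odd_letters n) deg" "x = young t"
    using x by (auto simp: odd_schur_def)
  have "derivation (2*n+2) X t \<in> word_space (odd_letters n) deg"
    by (rule derivation_word_space[OF _ _ t(1)]) (use X in auto)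
  moreover have "derivation (2*n+2) X x = young (derivation (2*n+2) X t)"
    unfolding t(2) by (rule young_symmetrizer_derivation) (use t(1) odd_letters_full in blast)
  moreover have "traceless n deg (derivation (2*n+2) X x)"
    using x by (intro traceless_derivation[OF X(1)]) (simp add: odd_schur_def)
  ultimately show ?thesis by (simp add: odd_schur_def)
qed

text \<open>A tensor of \<open>W\<close> killed by the Siegel raising operators is a tensor over \<open>L\<close>, hence in the Schur power of \<open>L\<close>,
  which is contained in \<open>Z\<close>. If it is also orthogonal to \<open>Z\<close>, it is 0.\<close>

lemma odd_schur_generated:
  assumes len: "length lam = n + 1"
    and Z: "tensor.subspace Z" "Z \<subseteq> word_space {..<2*n+2} deg"
    and stable: "\<And>X z. X \<in> intermediate_sp n \<Longrightarrow> z \<in> Z \<Longrightarrow> derivation (2*n+2) X z \<in> Z"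
    and hw: "hw_tensor \<in> Z"
  shows "odd_schur n \<subseteq> Z"
proof -
  let ?N = "2*n+2"
  define G where "G = {siegel_lowering n a b | a b. a < n \<and> b < n}"
  have full: "odd_schur n \<subseteq> word_space {..<?N} deg"
    using odd_schur_word_space odd_letters_full by blast
  have zero: "siegel_lowering n a b $$ (n+1, c) = 0" "siegel_lowering n a b $$ (c, n+1) = 0"
    if "a < n" "b < n" "c < ?N" for a b c
    using that siegel_lowering_nonzeroD[of n a b "n+1" c] siegel_lowering_nonzeroD[of n a b c "n+1"]
    by fastforce+
  have sp: "siegel_lowering n a b \<in> sp n" if "a < n" "b < n" for a b
    using siegel_lowering_intermediate[OF that] by (simp add: intermediate_sp_def)
  have "odd_schur n \<subseteq> Z \<inter> odd_schur n"
  proof (rule orthogonal_descent[OF subspace_odd_schur full, of _ G])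
    show "tensor.subspace (Z \<inter> odd_schur n)"
      using Z(1) subspace_odd_schur by (rule tensor.subspace_inter)
    show "Z \<inter> odd_schur n \<subseteq> odd_schur n" by blast
    show "j < i" if X: "X \<in> G" and ij: "i < ?N" "j < ?N" "X $$ (i, j) \<noteq> 0" for X i j
    proof -
      obtain a b where ab: "X = siegel_lowering n a b" "a < n" "b < n" using X unfolding G_def by blast
      show ?thesis
        using siegel_lowering_nonzeroD[OF ij(3)[unfolded ab(1)] ij(1,2)] ab(2,3) by linarith
    qed
    show "derivation ?N X z \<in> Z \<inter> odd_schur n" if X: "X \<in> G" and z: "z \<in> Z \<inter> odd_schur n" for X z
    proof -
      obtain a b where ab: "X = siegel_lowering n a b" "a < n" "b < n" using X unfolding G_def by blast
      have "derivation ?N X z \<in> odd_schur n"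
        using z zero(1)[OF ab(2,3)] unfolding ab(1) by (intro derivation_odd_schur sp[OF ab(2,3)]) auto
      then show ?thesis
        using z stable[OF siegel_lowering_intermediate[OF ab(2,3)]] ab(1) by blast
    qed
    show "derivation ?N (mat_star ?N X) r \<in> odd_schur n" if X: "X \<in> G" and r: "r \<in> odd_schur n" for X r
    proof -
      obtain a b where ab: "X = siegel_lowering n a b" "a < n" "b < n" using X unfolding G_def by blast
      show ?thesis
        unfolding ab(1) using zero(2)[OF ab(2,3)]
        by (intro derivation_odd_schur mat_star_sp sp[OF ab(2,3)] r) simp
    qed
  next
    fix r assume r: "r \<in> odd_schur n"
      and orth: "\<forall>z\<in>Z \<inter> odd_schur n. hermitian ?N deg r z = 0"
      and killed: "\<forall>X\<in>G. derivation ?N (mat_star ?N X) r = 0"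
    obtain t where t: "t \<in> word_space (odd_letters n) deg" "r = young t"
      using r by (auto simp: odd_schur_def)
    have "r \<in> word_space {..n} deg"
    proof (rule traceless_siegel_killed)
      show "r \<in> word_space (odd_letters n) deg" using r odd_schur_word_space by blast
      show "traceless n deg r" using r by (simp add: odd_schur_def)
      show "derivation ?N (mat_star ?N (siegel_lowering n a b)) r = 0" if "a < n" "b < n" for a b
        using killed that unfolding G_def by blast
    qed
    then have "r \<in> young ` word_space {..n} deg"
      by (rule young_symmetrizer_restrict[OF t(2,1)])
    then have "r \<in> Z" using lagrangian_schur_power_generated[OF len Z stable hw] by blast
    then have "hermitian ?N deg r r = 0" using orth r by blast
    then show "r = 0" using r full by (intro hermitian_self_eq_0) auto
  qed
  then show ?thesis by blast
qed

end

section \<open>The highest weight vector of the Schur power\<close>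

lemma derivation_basis_tensor:
  assumes u: "u \<in> words {..<N} d"
  shows "derivation N X (basis_tensor u) =
    (\<Sum>s<d. \<Sum>c<N. tensor_scale (X $$ (c, u ! s)) (basis_tensor (u[s := c])))"
proof
  fix w
  have len: "length u = d" using u by (simp add: words_def)
  show "derivation N X (basis_tensor u) w =
      (\<Sum>s<d. \<Sum>c<N. tensor_scale (X $$ (c, u ! s)) (basis_tensor (u[s := c]))) w"
  proof (cases "w \<in> words {..<N} d")
    case True
    then have lw: "length w = d" "set w \<subseteq> {..<N}" by (simp_all add: words_def)
    have "(\<Sum>a<N. X $$ (w ! s, a) * basis_tensor u (w[s := a])) =
        (\<Sum>c<N. X $$ (c, u ! s) * basis_tensor (u[s := c]) w)" if s: "s < d" for s
    proof -
      have us: "u ! s < N" and ws: "w ! s < N" using words_nth[OF u s] words_nth[OF True s] by auto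
      \<comment> \<open>Both sums have at most one nonzero term, and they have one exactly if \<open>P\<close> holds.\<close>
      define P where "P \<longleftrightarrow> (\<forall>i<d. i \<noteq> s \<longrightarrow> w ! i = u ! i)"
      have 1: "w[s := a] = u \<longleftrightarrow> a = u ! s \<and> P" for a
        using s lw len by (auto simp: P_def list_eq_iff_nth_eq nth_list_update)
      have 2: "w = u[s := c] \<longleftrightarrow> c = w ! s \<and> P" for c
        using s lw len by (auto simp: P_def list_eq_iff_nth_eq nth_list_update)
      have "(\<Sum>a<N. X $$ (w ! s, a) * basis_tensor u (w[s := a])) =
          (\<Sum>a<N. if a = u ! s then if P then X $$ (w ! s, u ! s) else 0 else 0)"
        by (intro sum.cong refl) (auto simp: basis_tensor_def 1)
      also have "\<dots> = (if P then X $$ (w ! s, u ! s) else 0)"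
        using us by (simp add: sum.delta)
      also have "\<dots> = (\<Sum>c<N. if c = w ! s then if P then X $$ (w ! s, u ! s) else 0 else 0)"
        using ws by (simp add: sum.delta)
      also have "\<dots> = (\<Sum>c<N. X $$ (c, u ! s) * basis_tensor (u[s := c]) w)"
        by (intro sum.cong refl) (auto simp: basis_tensor_def 2)
      finally show ?thesis .
    qed
    then show ?thesis
      using lw by (simp add: derivation_def sum_tensor scale_tensor)
  next
    case False
    have "derivation N X (basis_tensor u) \<in> word_space {..<N} d"
      by (rule derivation_word_space_full[OF basis_tensor_word_space[OF u]])
    then have "derivation N X (basis_tensor u) w = 0" using False by (rule word_space_zero)
    moreover have "basis_tensor (u[s := c]) w = 0" if "c < N" for s c
      using words_update[OF u, of c s] that False by (auto simp: basis_tensor_def)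
    ultimately show ?thesis by (simp add: sum_tensor scale_tensor)
  qed
qed

lemma symmetrize_sum: "symmetrize e d f (\<Sum>i\<in>I. g i) = (\<Sum>i\<in>I. symmetrize e d f (g i))"
  unfolding symmetrize_def tensor_perm_sum tensor.scale_sum_right by (rule sum.swap)

text \<open>The square norm of the antisymmetrization is a multiple of its coefficient at the word \<open>u\<close>, which vanishes.\<close>

lemma antisymmetrize_basis_tensor_repeated:
  assumes u: "u \<in> words {..<N} d"
    and s: "s < d" "s' < d" "s \<noteq> s'" "f s = f s'" "u ! s = u ! s'"
  shows "symmetrize True d f (basis_tensor u) = 0"
proof (rule hermitian_self_eq_0)
  let ?b = "symmetrize True d f"
  have e: "basis_tensor u \<in> word_space {..<N} d" by (rule basis_tensor_word_space[OF u])
  then show "?b (basis_tensor u) \<in> word_space {..<N} d" by (rule symmetrize_word_space)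
  have "hermitian N d (?b (basis_tensor u)) (?b (basis_tensor u)) =
      hermitian N d (?b (?b (basis_tensor u))) (basis_tensor u)"
    by (rule hermitian_symmetrize[symmetric])
  also have "\<dots> = 0"
    unfolding symmetrize_symmetrize[OF e] hermitian_scale_left hermitian_basis_tensor[OF u]
      antisymmetrize_repeated[where f = f, OF e s] by simp
  finally show "hermitian N d (?b (basis_tensor u)) (?b (basis_tensor u)) = 0" .
qed

context numbered_diagram
begin

lemma hw_tensor_letters: "length lam = n + 1 \<Longrightarrow> hw_tensor \<in> word_space {..n} deg"
  unfolding hw_tensor_def using row_word_words
  by (intro young_symmetrizer_word_space basis_tensor_word_space) (auto simp: words_def)

lemma hw_tensor_odd_schur:
  assumes len: "length lam = n + 1"
  shows "hw_tensor \<in> odd_schur n"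
proof -
  have "basis_tensor row_word \<in> word_space (odd_letters n) deg"
    using row_word_words len by (intro basis_tensor_word_space) (auto simp: words_def)
  moreover have "traceless n deg hw_tensor"
    unfolding traceless_def
  proof (intro allI ballI impI sum.neutral)
    fix p q w a assume w: "w \<in> words {..<2*n+2} deg" and pq: "p < q" "q < deg"
      and a: "a \<in> {..<2*n+2}"
    let ?w = "w[p := a, q := 2*n+1-a]"
    have "?w \<notin> words {..n} deg"
    proof
      assume *: "?w \<in> words {..n} deg"
      show False
        using words_nth[OF *, of p] words_nth[OF *, of q] pq w by (simp add: words_def)
    qed
    then show "symp_sign n a * hw_tensor ?w = 0"
      using word_space_zero[OF hw_tensor_letters[OF len]] by simp
  qed
  ultimately show ?thesis by (auto simp: odd_schur_def hw_tensor_def)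
qed

lemma derivation_hw_tensor:
  assumes len: "length lam = n + 1"
  shows "derivation (2*n+2) X hw_tensor = young
    (\<Sum>s<deg. \<Sum>c<2*n+2. tensor_scale (X $$ (c, row_of s)) (basis_tensor (row_word[s := c])))"
proof -
  have u: "row_word \<in> words {..<2*n+2} deg" using row_word_words len by (auto simp: words_def)
  have "derivation (2*n+2) X (basis_tensor row_word) =
      (\<Sum>s<deg. \<Sum>c<2*n+2. tensor_scale (X $$ (c, row_of s)) (basis_tensor (row_word[s := c])))"
    unfolding derivation_basis_tensor[OF u] by (rule sum.cong[OF refl]) simp
  then show ?thesis
    unfolding hw_tensor_def young_symmetrizer_derivation[OF basis_tensor_word_space[OF u]]
    by (rule arg_cong[where f = "young"])
qed

lemma sum_row_of:
  fixes g :: "nat \<Rightarrow> complex"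
  assumes len: "length lam = n + 1"
  shows "(\<Sum>s<deg. g (row_of s)) = (\<Sum>i\<le>n. of_nat (lam ! i) * g i)"
proof -
  have "(\<Sum>s<deg. g (row_of s)) = (\<Sum>b\<in>boxes lam. g (row_of (T b)))"
    by (rule sum.reindex_bij_betw[OF bij, symmetric])
  also have "\<dots> = (\<Sum>b\<in>Sigma {..n} (\<lambda>i. {..<lam ! i}). g (fst b))"
    using len by (intro sum.cong) (auto simp: boxes_def row_col_T)
  also have "\<dots> = (\<Sum>i\<le>n. \<Sum>j<lam ! i. g i)"
    by (subst sum.Sigma) (auto simp: case_prod_beta)
  finally show ?thesis by simp
qed

lemma hw_tensor_weight:
  assumes len: "length lam = n + 1" and X: "X \<in> carrier_mat (2*n+2) (2*n+2)" "diagonal_mat X"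
  shows "derivation (2*n+2) X hw_tensor =
    tensor_scale (\<Sum>i\<le>n. of_nat (lam ! i) * X $$ (i, i)) hw_tensor"
proof -
  have "(\<Sum>c<2*n+2. tensor_scale (X $$ (c, row_of s)) (basis_tensor (row_word[s := c]))) =
      tensor_scale (X $$ (row_of s, row_of s)) (basis_tensor row_word)" if s: "s < deg" for s
  proof -
    have r: "row_of s < 2*n+2" using row_of_less[OF s] len by simp
    have "row_word[s := row_of s] = row_word" using s by (metis list_update_id row_word_nth)
    moreover have "X $$ (c, row_of s) = 0" if "c < 2*n+2" "c \<noteq> row_of s" for c
      using X that r by (auto simp: diagonal_mat_def)
    ultimately have "(\<Sum>c<2*n+2. tensor_scale (X $$ (c, row_of s)) (basis_tensor (row_word[s := c]))) =
        (\<Sum>c<2*n+2. if c = row_of s then tensor_scale (X $$ (row_of s, row_of s)) (basis_tensor row_word) else 0)"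
      by (intro sum.cong refl) (auto simp: tensor.scale_zero_left)
    also have "\<dots> = tensor_scale (X $$ (row_of s, row_of s)) (basis_tensor row_word)"
      using r by (simp add: sum.delta)
    finally show ?thesis .
  qed
  then have "(\<Sum>s<deg. \<Sum>c<2*n+2. tensor_scale (X $$ (c, row_of s)) (basis_tensor (row_word[s := c]))) =
      (\<Sum>s<deg. tensor_scale (X $$ (row_of s, row_of s)) (basis_tensor row_word))"
    by (intro sum.cong[OF refl]) simp
  then have "derivation (2*n+2) X hw_tensor =
      young (\<Sum>s<deg. tensor_scale (X $$ (row_of s, row_of s)) (basis_tensor row_word))"
    unfolding derivation_hw_tensor[OF len] by (rule arg_cong[where f = "young"])
  also have "(\<Sum>s<deg. tensor_scale (X $$ (row_of s, row_of s)) (basis_tensor row_word)) =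
      tensor_scale (\<Sum>i\<le>n. of_nat (lam ! i) * X $$ (i, i)) (basis_tensor row_word)"
    unfolding tensor.scale_sum_left[symmetric] sum_row_of[OF len, of "\<lambda>i. X $$ (i, i)"] by (rule refl)
  also have "young \<dots> = tensor_scale (\<Sum>i\<le>n. of_nat (lam ! i) * X $$ (i, i)) hw_tensor"
  proof -
    have e: "basis_tensor row_word \<in> word_space {..<length lam} deg"
      by (rule basis_tensor_word_space[OF row_word_words])
    show ?thesis
      unfolding hw_tensor_def young_symmetrizer_eq[OF e]
        young_symmetrizer_eq[OF tensor.subspace_scale[OF subspace_word_space e]]
        symmetrize_scale by (rule refl)
  qed
  finally show ?thesis .
qed

text \<open>After any row permutation, the letter \<open>c\<close> that was moved to row \<open>row_of s\<close> has another letter \<open>c\<close> in the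
  same column: the one in row \<open>c\<close>, which is at least as long as the row of \<open>s\<close>. So each term of the row
  symmetrization is killed by the column antisymmetrizer.\<close>

lemma young_symmetrizer_lowered_row:
  assumes s: "s < deg" and c: "c < row_of s"
  shows "young (basis_tensor (row_word[s := c])) = 0"
proof -
  let ?u = "row_word[s := c]"
  let ?N = "length lam"
  have u: "?u \<in> words {..<?N} deg"
    using c row_of_less[OF s] by (intro words_update row_word_words) simp
  have "col_antisym (tensor_perm p (basis_tensor ?u)) = 0" if p: "p \<in> fiber_group deg row_of" for p
  proof -
    have pp: "p permutes {..<deg}" using p by (rule fiber_group_permutes)
    let ?v = "permute_list p ?u"
    have v: "?v \<in> words {..<?N} deg" using u words_permute_list[OF pp] by blast
    have vn: "?v ! x = ?u ! p x" if "x < deg" for x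
      using pp that by (simp add: permute_list_nth)
    have px: "p x < deg" if "x < deg" for x
      using permutes_in_image[OF pp, of x] that by simp
    have rowp: "row_of (p x) = row_of x" if "x < deg" for x
      using p that by (simp add: fiber_group_def)
    \<comment> \<open>\<open>x\<close> is the place of the moved letter, and \<open>y\<close> is the box of row \<open>c\<close> in its column.\<close>
    define x where "x = inv_into UNIV p s"
    have x: "x < deg" "p x = s"
      using permutes_in_image[OF permutes_inv[OF pp], of s] s permutes_inverses[OF pp]
      by (simp_all add: x_def)
    have rx: "row_of x = row_of s" using rowp[OF x(1)] x(2) by simp
    have "(row_of x, col_of x) \<in> boxes lam" using box_of[OF x(1)] by simp
    then have b: "(c, col_of x) \<in> boxes lam"
      using c rx sorted_wrt_nth_less[OF decreasing c] by (auto simp: boxes_def)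
    define y where "y = T (c, col_of x)"
    have y: "y < deg" "row_of y = c" "col_of y = col_of x"
      using T_less[OF b] row_col_T[OF b] by (simp_all add: y_def)
    have "p y \<noteq> s" using rowp[OF y(1)] y c by auto
    then have "?v ! y = c" using vn[OF y(1)] px[OF y(1)] rowp[OF y(1)] y(2) by simp
    moreover have "?v ! x = c" using vn[OF x(1)] x s by simp
    moreover have "x \<noteq> y" using rx y c by auto
    moreover have "tensor_perm p (basis_tensor ?u) = basis_tensor ?v"
      using pp by (intro tensor_perm_basis_tensor) simp
    ultimately show ?thesis
      using antisymmetrize_basis_tensor_repeated[OF v x(1) y(1), of col_of] y by simp
  qed
  then show ?thesis
    unfolding young_symmetrizer_eq[OF basis_tensor_word_space[OF u]]
    by (subst (2) symmetrize_def) (simp add: symmetrize_sum symmetrize_scale)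
qed

lemma hw_tensor_highest:
  assumes len: "length lam = n + 1"
    and X: "\<And>i j. i < 2*n+2 \<Longrightarrow> j \<le> i \<Longrightarrow> X $$ (i, j) = 0"
  shows "derivation (2*n+2) X hw_tensor = 0"
proof -
  let ?e = "\<lambda>s c. basis_tensor (row_word[s := c])"
  have u: "row_word \<in> words {..<2*n+2} deg" using row_word_words len by (auto simp: words_def)
  have e: "?e s c \<in> word_space {..<2*n+2} deg" if "c < 2*n+2" for s c
    using that by (intro basis_tensor_word_space words_update u) simp
  have mem: "(\<Sum>s<deg. \<Sum>c<2*n+2. tensor_scale (X $$ (c, row_of s)) (?e s c))
      \<in> word_space {..<2*n+2} deg"
    by (intro tensor.subspace_sum tensor.subspace_scale subspace_word_space e) simp
  have zero: "tensor_scale (X $$ (c, row_of s)) (col_antisym (row_sym (?e s c))) = 0"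
    if "s \<in> {..<deg}" "c \<in> {..<2*n+2}" for s c
  proof -
    have s: "s < deg" and c: "c < 2*n+2" using that by simp_all
    show ?thesis
    proof (cases "c < row_of s")
      case True
      show ?thesis
        using young_symmetrizer_lowered_row[OF s True]
        unfolding young_symmetrizer_eq[OF e[OF c]] by (simp only: tensor.scale_zero_right)
    next
      case False
      then have "X $$ (c, row_of s) = 0" using X[OF c, of "row_of s"] by simp
      then show ?thesis by (simp only: tensor.scale_zero_left)
    qed
  qed
  show ?thesis
    unfolding derivation_hw_tensor[OF len] young_symmetrizer_eq[OF mem] symmetrize_sum symmetrize_scale
    by (rule sum.neutral, rule ballI, rule sum.neutral, rule ballI, rule zero)
qed

lemma hw_tensor_highest_weight_vector:
  assumes len: "length lam = n + 1"
  shows "highest_weight_vector n tensor_scale (word_space {..<2*n+2} deg)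
    (derivation (2*n+2)) lam hw_tensor"
  unfolding highest_weight_vector_def
proof (intro conjI ballI impI)
  have "word_space {..n} deg \<subseteq> word_space {..<2*n+2} deg"
    by (rule word_space_mono) auto
  then show "hw_tensor \<in> word_space {..<2*n+2} deg" using hw_tensor_letters[OF len] by blast
  show "hw_tensor \<noteq> 0" by (rule hw_tensor_nz)
  show "derivation (2*n+2) X hw_tensor = 0"
    if "\<forall>i<2*n+2. \<forall>j\<le>i. X $$ (i, j) = 0" for X
    using that by (intro hw_tensor_highest[OF len]) blast
  show "derivation (2*n+2) X hw_tensor = tensor_scale (\<Sum>i\<le>n. of_nat (lam ! i) * X $$ (i, i)) hw_tensor"
    if "X \<in> sp n" "diagonal_mat X" for X
    using that by (intro hw_tensor_weight[OF len] sp_carrier)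
qed

section \<open>The traceless Schur power as a module\<close>

lemma traceless_schur_power_eq:
  "traceless_schur_power (2*n+2) (symp_form n) (odd_space n) lam T = odd_schur n"
proof -
  have "tensor_power (odd_space n) d = word_space (odd_letters n) d" for d
  proof (rule tensor_power_eq_word_space[of _ "2*n+2"])
    show "unit_vec (2*n+2) a \<in> odd_space n" if "a \<in> odd_letters n" for a
      using that unfolding odd_space_iff by simp
    show "v $ a = 0" if "v \<in> odd_space n" "a < 2*n+2" "a \<notin> odd_letters n" for v a
      using that unfolding odd_space_iff by simp
  qed (auto simp: odd_space_def)
  then have "traceless_schur_power (2*n+2) (symp_form n) (odd_space n) lam T =
      {t \<in> young ` word_space (odd_letters n) deg.
        \<forall>p q. p < q \<and> q < deg \<longrightarrow> contraction (2*n+2) (symp_form n) p q t = 0}"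
    unfolding traceless_schur_power_def schur_power_def by (simp only: Int_def mem_Collect_eq)
  also have "\<dots> = odd_schur n"
    unfolding odd_schur_def
  proof (rule Collect_cong, rule conj_cong[OF refl])
    fix t assume "t \<in> young ` word_space (odd_letters n) deg"
    then have "t \<in> word_space {..<2*n+2} deg"
      using young_symmetrizer_word_space odd_letters_full by blast
    then show "(\<forall>p q. p < q \<and> q < deg \<longrightarrow> contraction (2*n+2) (symp_form n) p q t = 0) =
        traceless n deg t" by (rule traceless_iff_contraction[symmetric])
  qed
  finally show ?thesis .
qed

end

text \<open>The restricted action omits the summand with the letter \<open>n + 1\<close>, which does not occur in \<open>t\<close>.\<close>

lemma tensor_derivation_restriction:
  assumes X: "X \<in> carrier_mat (2*n+2) (2*n+2)" and t: "t \<in> word_space (odd_letters n) d"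
  shows "tensor_derivation n (restriction n X) t = derivation (2*n+2) X t"
proof
  fix w
  let ?N = "2*n+2"
  show "tensor_derivation n (restriction n X) t w = derivation ?N X t w"
  proof (cases "w \<in> words {..<?N} d")
    case True
    have "(\<Sum>a\<in>odd_letters n. coord (restriction n X (unit_vec ?N a)) (w ! i) * t (w[i := a])) =
        (\<Sum>a<?N. X $$ (w ! i, a) * t (w[i := a]))" if i: "i < d" for i
    proof -
      have wi: "w ! i < ?N" using words_nth[OF True i] by simp
      have "t (w[i := n+1]) = 0"
      proof (rule word_space_zero[OF t])
        show "w[i := n+1] \<notin> words (odd_letters n) d"
          using words_nth[of "w[i := n+1]" "odd_letters n" d i] i True by (auto simp: words_def)
      qed
      then have "(\<Sum>a<?N. X $$ (w ! i, a) * t (w[i := a])) =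
          (\<Sum>a\<in>odd_letters n. X $$ (w ! i, a) * t (w[i := a]))"
        by (subst sum.remove[of _ "n+1"]) simp_all
      also have "\<dots> = (\<Sum>a\<in>odd_letters n. coord (restriction n X (unit_vec ?N a)) (w ! i) * t (w[i := a]))"
      proof (rule sum.cong[OF refl])
        fix a assume a: "a \<in> odd_letters n"
        then have "unit_vec ?N a \<in> odd_space n" by (auto simp: odd_space_iff unit_vec_def)
        then have "coord (restriction n X (unit_vec ?N a)) (w ! i) = X $$ (w ! i, a)"
          using X wi a by (simp add: restriction_def coord_def scalar_prod_right_unit)
        then show "X $$ (w ! i, a) * t (w[i := a]) =
            coord (restriction n X (unit_vec ?N a)) (w ! i) * t (w[i := a])" by simp
      qed
      finally show ?thesis by simp
    qed
    moreover have "length w = d" "set w \<subseteq> {..<?N}" using True by (auto simp: words_def)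
    ultimately show ?thesis by (simp add: tensor_derivation_def derivation_def)
  next
    case False
    have "t \<in> word_space {..<?N} d" using t word_space_mono[of "odd_letters n" "{..<?N}" d] by blast
    then have "derivation ?N X t w = 0"
      using word_space_zero[OF derivation_word_space_full False] by blast
    moreover have "coord (restriction n X (unit_vec ?N a)) (w ! i) * t (w[i := a]) = 0"
      if i: "i \<in> {..<length w}" and a: "a \<in> odd_letters n" for i a
    proof (rule ccontr)
      assume nz: "coord (restriction n X (unit_vec ?N a)) (w ! i) * t (w[i := a]) \<noteq> 0"
      have "unit_vec ?N a \<in> odd_space n" using a by (auto simp: odd_space_iff unit_vec_def)
      then have "w ! i < ?N"
        using nz X by (auto simp: restriction_def coord_def split: if_splits)
      moreover have "w[i := a] \<in> words {..<?N} d"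
        using nz t by (auto simp: word_space_def words_def)
      ultimately have "w[i := a, i := w ! i] \<in> words {..<?N} d"
        using words_update[of "w[i := a]" "{..<?N}" d "w ! i" i] by simp
      then show False using False by simp
    qed
    then have "tensor_derivation n (restriction n X) t w = 0"
      unfolding tensor_derivation_def by (intro sum.neutral ballI) blast
    ultimately show ?thesis by simp
  qed
qed

lemma line_stabilizer_sp: "X \<in> line_stabilizer n \<Longrightarrow> X \<in> sp n"
  by (simp add: line_stabilizer_def)

text \<open>The condition on column \<open>n\<close> of a matrix in the stabilizer is transported to row \<open>n + 1\<close> by the symmetry
  of the symplectic matrices.\<close>

lemma line_stabilizer_row:
  assumes X: "X \<in> line_stabilizer n" and a: "a < 2*n+2" "a \<noteq> n+1"
  shows "X $$ (n+1, a) = 0"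
proof -
  let ?e = "unit_vec (2*n+2) n :: complex vec"
  have "X *\<^sub>v (1 \<cdot>\<^sub>v ?e) \<in> {c \<cdot>\<^sub>v ?e | c. True}"
    using X unfolding line_stabilizer_def Let_def by blast
  then obtain c where c: "X *\<^sub>v ?e = c \<cdot>\<^sub>v ?e" by auto
  have carr: "X \<in> carrier_mat (2*n+2) (2*n+2)" using sp_carrier[OF line_stabilizer_sp[OF X]] .
  have i: "2*n+1-a < 2*n+2" "2*n+1-a \<noteq> n" using a by linarith+
  have "X $$ (2*n+1-a, n) = (X *\<^sub>v ?e) $ (2*n+1-a)"
    using carr i by (simp add: scalar_prod_right_unit)
  also have "\<dots> = 0" unfolding c using i by (simp add: unit_vec_def)
  finally have "X $$ (2*n+1-a, n) = 0" .
  moreover have "symp_sign n i * X $$ (i, j) + symp_sign n j * X $$ (2*n+1-j, 2*n+1-i) = 0"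
    if "i < 2*n+2" "j < 2*n+2" for i j
    using line_stabilizer_sp[OF X] that unfolding mem_sp_iff by blast
  from this[of "n+1" a] have "symp_sign n (n+1) * X $$ (n+1, a) + symp_sign n a * X $$ (2*n+1-a, n) = 0"
    using a by simp
  ultimately show ?thesis by (simp add: symp_sign_def)
qed

lemma intermediate_line_stabilizer: "intermediate_sp n \<subseteq> line_stabilizer n"
proof
  fix X assume X: "X \<in> intermediate_sp n"
  let ?e = "unit_vec (2*n+2) n :: complex vec"
  have carr: "X \<in> carrier_mat (2*n+2) (2*n+2)" and sp: "X \<in> sp n" and e: "X *\<^sub>v ?e = 0\<^sub>v (2*n+2)"
    using X sp_carrier by (auto simp: intermediate_sp_def)
  have "X *\<^sub>v (c \<cdot>\<^sub>v ?e) = 0 \<cdot>\<^sub>v ?e" for c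
    using carr e by (auto simp: mult_mat_vec)
  then show "X \<in> line_stabilizer n"
    using sp unfolding line_stabilizer_def Let_def by blast
qed

section \<open>The principal grading of the symplectic Lie algebra\<close>

text \<open>\<open>X\<close> has degree \<open>k\<close> if its nonzero entries are on the \<open>k\<close>-th diagonal above the main one: simple roots have
  degree 1, and the entry of \<open>e\<^sub>i\<close> in \<open>grading_mat\<close> drops by 2 from each letter to the next.\<close>

definition homogeneous :: "nat \<Rightarrow> int \<Rightarrow> complex mat \<Rightarrow> bool" where
  "homogeneous n k X \<longleftrightarrow>
    (\<forall>i<2*n+2. \<forall>j<2*n+2. X $$ (i, j) \<noteq> 0 \<longrightarrow> int j - int i = k)"

definition grading_mat :: "nat \<Rightarrow> complex mat" where
  "grading_mat n = mat (2*n+2) (2*n+2) (\<lambda>(i, j). if i = j then of_int (2 * int n + 1 - 2 * int i) else 0)"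

text \<open>The part of \<open>X\<close> on selected diagonals, which are numbered by natural numbers from below, the main one having
  number \<open>2n + 2\<close>.\<close>

definition diagonals :: "nat \<Rightarrow> (nat \<Rightarrow> bool) \<Rightarrow> complex mat \<Rightarrow> complex mat" where
  "diagonals n P X = mat (2*n+2) (2*n+2) (\<lambda>(i, j). if P (j + (2*n+2) - i) then X $$ (i, j) else 0)"

lemma sp_bracket:
  assumes X: "X \<in> sp n" and Y: "Y \<in> sp n"
  shows "X * Y - Y * X \<in> sp n"
proof -
  let ?N = "2*n+2"
  have c: "X \<in> carrier_mat ?N ?N" "Y \<in> carrier_mat ?N ?N" using X Y by (auto intro: sp_carrier)
  have rel: "X $$ (2*n+1-j, 2*n+1-i) = - (symp_sign n i * symp_sign n j) * X $$ (i, j)"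
    if "X \<in> sp n" "i < ?N" "j < ?N" for X i j
  proof -
    have "symp_sign n i * X $$ (i, j) + symp_sign n j * X $$ (2*n+1-j, 2*n+1-i) = 0"
      using that unfolding mem_sp_iff by blast
    then show ?thesis by (auto simp: symp_sign_def add_eq_0_iff split: if_splits)
  qed
  have sq: "symp_sign n k * symp_sign n k = 1" for k by (simp add: symp_sign_def)
  have prod: "(X * Y) $$ (2*n+1-j, 2*n+1-i) = symp_sign n i * symp_sign n j * (Y * X) $$ (i, j)"
    if X: "X \<in> sp n" and Y: "Y \<in> sp n" and ij: "i < ?N" "j < ?N" for X Y i j
  proof -
    have c: "X \<in> carrier_mat ?N ?N" "Y \<in> carrier_mat ?N ?N" using X Y by (auto intro: sp_carrier)
    have "(X * Y) $$ (2*n+1-j, 2*n+1-i) = (\<Sum>k<?N. X $$ (2*n+1-j, k) * Y $$ (k, 2*n+1-i))"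
      using c ij by (simp add: scalar_prod_def atLeast0LessThan)
    also have "\<dots> = (\<Sum>k<?N. X $$ (2*n+1-j, 2*n+1-k) * Y $$ (2*n+1-k, 2*n+1-i))"
      by (rule sum.reindex_bij_witness[of _ "\<lambda>a. 2*n+1-a" "\<lambda>a. 2*n+1-a"]) auto
    also have "\<dots> = (\<Sum>k<?N. symp_sign n i * symp_sign n j * (Y $$ (i, k) * X $$ (k, j)))"
    proof (rule sum.cong[OF refl])
      fix k assume "k \<in> {..<?N}"
      then show "X $$ (2*n+1-j, 2*n+1-k) * Y $$ (2*n+1-k, 2*n+1-i) =
          symp_sign n i * symp_sign n j * (Y $$ (i, k) * X $$ (k, j))"
        using rel[OF X, of k j] rel[OF Y, of i k] ij by (simp add: symp_sign_def)
    qed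
    also have "\<dots> = symp_sign n i * symp_sign n j * (Y * X) $$ (i, j)"
      using c ij by (simp add: scalar_prod_def atLeast0LessThan sum_distrib_left)
    finally show ?thesis .
  qed
  show ?thesis
    unfolding mem_sp_iff
  proof (intro conjI allI impI)
    show "X * Y - Y * X \<in> carrier_mat ?N ?N"
      using c by (intro minus_carrier_mat mult_carrier_mat)
    fix i j assume ij: "i < ?N" "j < ?N"
    let ?B = "(X * Y) $$ (i, j) - (Y * X) $$ (i, j)"
    have "(X * Y - Y * X) $$ (i, j) = ?B" using c ij by simp
    moreover have "(X * Y - Y * X) $$ (2*n+1-j, 2*n+1-i) = - (symp_sign n i * symp_sign n j) * ?B"
    proof -
      have "2*n+1-j < ?N" "2*n+1-i < ?N" by linarith+
      then have "(X * Y - Y * X) $$ (2*n+1-j, 2*n+1-i) =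
          (X * Y) $$ (2*n+1-j, 2*n+1-i) - (Y * X) $$ (2*n+1-j, 2*n+1-i)"
        using c by (intro index_minus_mat(1)) auto
      then show ?thesis
        unfolding prod[OF X Y ij] prod[OF Y X ij] by (simp add: algebra_simps)
    qed
    ultimately show "symp_sign n i * (X * Y - Y * X) $$ (i, j) +
        symp_sign n j * (X * Y - Y * X) $$ (2*n+1-j, 2*n+1-i) = 0"
      by (simp only:) (simp add: symp_sign_def)
  qed
qed

lemma grading_mat_sp: "grading_mat n \<in> sp n"
  unfolding mem_sp_iff
proof (intro conjI allI impI)
  fix i j assume ij: "i < 2*n+2" "j < 2*n+2"
  have "2*n+1-j = 2*n+1-i \<longleftrightarrow> i = j" using ij by linarith
  moreover have "int (2*n+1-i) = 2 * int n + 1 - int i" using ij by linarith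
  ultimately show "symp_sign n i * grading_mat n $$ (i, j) +
      symp_sign n j * grading_mat n $$ (2*n+1-j, 2*n+1-i) = 0"
    using ij by (auto simp: grading_mat_def symp_sign_def algebra_simps)
qed (simp add: grading_mat_def)

lemma grading_mat_diagonal: "diagonal_mat (grading_mat n)"
  by (simp add: grading_mat_def diagonal_mat_def)

lemma mat_star_grading_mat: "mat_star (2*n+2) (grading_mat n) = grading_mat n"
  by (rule eq_matI) (auto simp: grading_mat_def mat_star_def)

lemma diagonals_sp:
  assumes "X \<in> sp n"
  shows "diagonals n P X \<in> sp n"
  unfolding mem_sp_iff
proof (intro conjI allI impI)
  fix i j assume ij: "i < 2*n+2" "j < 2*n+2"
  have "(2*n+1-i) + (2*n+2) - (2*n+1-j) = j + (2*n+2) - i" using ij by linarith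
  moreover have "symp_sign n i * X $$ (i, j) + symp_sign n j * X $$ (2*n+1-j, 2*n+1-i) = 0"
    using assms ij unfolding mem_sp_iff by blast
  moreover have "diagonals n P X $$ (a, b) = (if P (b + (2*n+2) - a) then X $$ (a, b) else 0)"
    if "a < 2*n+2" "b < 2*n+2" for a b
    using that by (simp add: diagonals_def)
  moreover have "2*n+1-i < 2*n+2" "2*n+1-j < 2*n+2" by linarith+
  ultimately show "symp_sign n i * diagonals n P X $$ (i, j) +
      symp_sign n j * diagonals n P X $$ (2*n+1-j, 2*n+1-i) = 0"
    using ij by (cases "P (j + (2*n+2) - i)") (simp_all only: if_True if_False mult_zero_right add_0)
qed (simp add: diagonals_def)

lemma diagonals_homogeneous:
  "homogeneous n (int m - (2 * int n + 2)) (diagonals n (\<lambda>l. l = m) X)"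
  by (auto simp: homogeneous_def diagonals_def)

lemma homogeneous_bracket:
  assumes X: "X \<in> carrier_mat (2*n+2) (2*n+2)" "homogeneous n k X"
    and Y: "Y \<in> carrier_mat (2*n+2) (2*n+2)" "homogeneous n l Y"
  shows "homogeneous n (k + l) (X * Y - Y * X)"
proof -
  have prod: "int j - int i = k + l"
    if c: "X \<in> carrier_mat (2*n+2) (2*n+2)" "homogeneous n k X"
      "Y \<in> carrier_mat (2*n+2) (2*n+2)" "homogeneous n l Y"
      and ij: "i < 2*n+2" "j < 2*n+2" "(X * Y) $$ (i, j) \<noteq> 0" for X Y k l i j
  proof -
    have "(X * Y) $$ (i, j) = (\<Sum>m<2*n+2. X $$ (i, m) * Y $$ (m, j))"
      using c ij by (simp add: scalar_prod_def atLeast0LessThan)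
    then obtain m where "m < 2*n+2" "X $$ (i, m) * Y $$ (m, j) \<noteq> 0"
      using ij(3) by (auto elim: sum.not_neutral_contains_not_neutral)
    then have "int m - int i = k" "int j - int m = l"
      using c ij unfolding homogeneous_def by auto
    then show ?thesis by simp
  qed
  show ?thesis
    unfolding homogeneous_def
  proof (intro allI impI)
    fix i j assume ij: "i < 2*n+2" "j < 2*n+2" and nz: "(X * Y - Y * X) $$ (i, j) \<noteq> 0"
    then have "(X * Y) $$ (i, j) \<noteq> 0 \<or> (Y * X) $$ (i, j) \<noteq> 0" using X(1) Y(1) by auto
    then show "int j - int i = k + l"
      using prod[OF X Y ij] prod[OF Y X ij] by linarith
  qed
qed

lemma bracket_grading_mat:
  assumes X: "X \<in> carrier_mat (2*n+2) (2*n+2)" "homogeneous n k X"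
  shows "grading_mat n * X - X * grading_mat n = of_int (2 * k) \<cdot>\<^sub>m X"
proof (rule eq_matI)
  let ?N = "2*n+2"
  have g: "grading_mat n \<in> carrier_mat ?N ?N" by (simp add: grading_mat_def)
  fix i j assume "i < dim_row (of_int (2 * k) \<cdot>\<^sub>m X)" "j < dim_col (of_int (2 * k) \<cdot>\<^sub>m X)"
  then have ij: "i < ?N" "j < ?N" using X by auto
  let ?h = "\<lambda>i. of_int (2 * int n + 1 - 2 * int i) :: complex"
  have gi: "grading_mat n $$ (a, b) = (if a = b then ?h a else 0)" if "a < ?N" "b < ?N" for a b
    using that by (simp add: grading_mat_def)
  have "(grading_mat n * X) $$ (i, j) = (\<Sum>m<?N. grading_mat n $$ (i, m) * X $$ (m, j))"
    using g X ij by (simp add: scalar_prod_def atLeast0LessThan)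
  also have "\<dots> = (\<Sum>m<?N. if m = i then ?h i * X $$ (i, j) else 0)"
    using gi[OF ij(1)] by (intro sum.cong refl) auto
  finally have 1: "(grading_mat n * X) $$ (i, j) = (\<Sum>m<?N. if m = i then ?h i * X $$ (i, j) else 0)" .
  have "(X * grading_mat n) $$ (i, j) = (\<Sum>m<?N. X $$ (i, m) * grading_mat n $$ (m, j))"
    using g X ij by (simp add: scalar_prod_def atLeast0LessThan)
  also have "\<dots> = (\<Sum>m<?N. if m = j then ?h j * X $$ (i, j) else 0)"
    using gi[OF _ ij(2)] by (intro sum.cong refl) auto
  finally have 2: "(X * grading_mat n) $$ (i, j) = (\<Sum>m<?N. if m = j then ?h j * X $$ (i, j) else 0)" .
  from 1 2 have "(grading_mat n * X - X * grading_mat n) $$ (i, j) = (?h i - ?h j) * X $$ (i, j)"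
    using g X ij by (simp add: sum.delta algebra_simps del: index_mult_mat(1))
  also have "\<dots> = of_int (2 * k) * X $$ (i, j)"
  proof (cases "X $$ (i, j) = 0")
    case False
    then have "k = int j - int i" using X(2) ij by (simp add: homogeneous_def)
    then show ?thesis by simp
  qed simp
  finally show "(grading_mat n * X - X * grading_mat n) $$ (i, j) = (of_int (2 * k) \<cdot>\<^sub>m X) $$ (i, j)"
    using X ij by simp
qed (use X in \<open>simp_all add: grading_mat_def\<close>)

section \<open>Modules generated by a highest weight vector\<close>

text \<open>Sums of eigenvectors of \<open>h\<close> with eigenvalues \<open>c - 2, c - 4, \<dots>\<close>.\<close>

definition lower_eigenvectors ::
  "(complex \<Rightarrow> 'v::ab_group_add \<Rightarrow> 'v) \<Rightarrow> 'v set \<Rightarrow> ('v \<Rightarrow> 'v) \<Rightarrow> complex \<Rightarrow> 'v set" where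
  "lower_eigenvectors scale V h c =
    {\<Sum>m=1..r. zs m | r zs. \<forall>m::nat. zs m \<in> V \<and> h (zs m) = scale (c - 2 * of_nat m) (zs m)}"

lemma lower_eigenvectorsI:
  "\<forall>m::nat. zs m \<in> V \<and> h (zs m) = scale (c - 2 * of_nat m) (zs m) \<Longrightarrow>
    (\<Sum>m=1..r. zs m) \<in> lower_eigenvectors scale V h c"
  unfolding lower_eigenvectors_def by blast

lemma lower_eigenvectorsE:
  assumes "y \<in> lower_eigenvectors scale V h c"
  obtains r zs where "y = (\<Sum>m=1..r. zs m)"
    "\<And>m::nat. zs m \<in> V" "\<And>m. h (zs m) = scale (c - 2 * of_nat m) (zs m)"
  using assms unfolding lower_eigenvectors_def by blast

context lie_module
begin

lemmas V_zero = subspace_0[OF carrier_subspace]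
  and V_add = subspace_add[OF carrier_subspace]
  and V_scale = subspace_scale[OF carrier_subspace]

lemma act_zero: "X \<in> g \<Longrightarrow> act X 0 = 0"
  using act_scale[of X 0 0] V_zero by simp

lemma act_sum:
  assumes X: "X \<in> g" and f: "\<And>i. i \<in> I \<Longrightarrow> f i \<in> V"
  shows "act X (\<Sum>i\<in>I. f i) = (\<Sum>i\<in>I. act X (f i))"
  using f
proof (induction I rule: infinite_finite_induct)
  case (insert i I)
  then show ?case using X by (simp add: act_add subspace_sum[OF carrier_subspace])
qed (use act_zero[OF X] in auto)

lemma lower_eigenvectors_subspace:
  assumes X: "X \<in> g"
  shows "subspace (lower_eigenvectors scale V (act X) c)"
proof (rule subspaceI)
  have "(\<Sum>m=1..0::nat. 0) \<in> lower_eigenvectors scale V (act X) c"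
    by (rule lower_eigenvectorsI) (use X V_zero in \<open>simp add: act_zero\<close>)
  then show "0 \<in> lower_eigenvectors scale V (act X) c" by simp
next
  fix x y assume x: "x \<in> lower_eigenvectors scale V (act X) c" and y: "y \<in> lower_eigenvectors scale V (act X) c"
  obtain r f where f: "x = (\<Sum>m=1..r. f m)" "\<And>m::nat. f m \<in> V"
    "\<And>m. act X (f m) = scale (c - 2 * of_nat m) (f m)"
    using x by (rule lower_eigenvectorsE) blast
  obtain s g' where g': "y = (\<Sum>m=1..s. g' m)" "\<And>m::nat. g' m \<in> V"
    "\<And>m. act X (g' m) = scale (c - 2 * of_nat m) (g' m)"
    using y by (rule lower_eigenvectorsE) blast
  define h where "h m = (if m \<le> r then f m else 0) + (if m \<le> s then g' m else 0)" for m
  have "(\<Sum>m=1..max r s. h m) =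
      (\<Sum>m=1..max r s. if m \<le> r then f m else 0) + (\<Sum>m=1..max r s. if m \<le> s then g' m else 0)"
    by (simp add: h_def sum.distrib)
  also have "(\<Sum>m=1..max r s. if m \<le> r then f m else 0) = x"
    unfolding f(1) by (rule sum.mono_neutral_cong_right) auto
  also have "(\<Sum>m=1..max r s. if m \<le> s then g' m else 0) = y"
    unfolding g'(1) by (rule sum.mono_neutral_cong_right) auto
  finally have eq: "x + y = (\<Sum>m=1..max r s. h m)" by simp
  show "x + y \<in> lower_eigenvectors scale V (act X) c"
    unfolding eq
  proof (rule lower_eigenvectorsI, intro allI conjI)
    fix m
    have 0: "0 \<in> V" by (rule V_zero)
    show "h m \<in> V" unfolding h_def using f g' 0 by (auto intro: V_add)
    show "act X (h m) = scale (c - 2 * of_nat m) (h m)"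
      unfolding h_def using X f g' 0 by (simp add: act_add act_zero scale_right_distrib)
  qed
next
  fix a x assume "x \<in> lower_eigenvectors scale V (act X) c"
  then obtain r f where f: "x = (\<Sum>m=1..r. f m)" "\<And>m::nat. f m \<in> V"
    "\<And>m. act X (f m) = scale (c - 2 * of_nat m) (f m)"
    by (rule lower_eigenvectorsE) blast
  have eq: "scale a x = (\<Sum>m=1..r. scale a (f m))" unfolding f(1) by (rule scale_sum_right)
  show "scale a x \<in> lower_eigenvectors scale V (act X) c"
    unfolding eq
  proof (rule lower_eigenvectorsI, intro allI conjI)
    fix m
    show "scale a (f m) \<in> V" using f by (intro V_scale)
    show "act X (scale a (f m)) = scale (c - 2 * of_nat m) (scale a (f m))"
      using X f by (simp add: act_scale scale_left_commute)
  qed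
qed

text \<open>Subtracting \<open>c - 2r\<close> from \<open>h\<close> kills the last of \<open>r\<close> summands, rescales the others, and multiplies \<open>y\<close>
  by \<open>2r\<close>.\<close>

lemma lower_eigenvectors_top:
  assumes X: "X \<in> g" and y: "y \<in> lower_eigenvectors scale V (act X) c" "act X y = scale c y"
  shows "y = 0"
proof -
  have "y = 0" if "y = (\<Sum>m=1..r. f m)" "\<And>m::nat. f m \<in> V"
    "\<And>m. act X (f m) = scale (c - 2 * of_nat m) (f m)" "act X y = scale c y" for r f y
    using that
  proof (induction r arbitrary: y f)
    case (Suc r)
    let ?k = "c - 2 * of_nat (Suc r)"
    let ?y = "scale (2 * of_nat (Suc r)) y"
    define f' where "f' m = scale (2 * of_nat (Suc r) - 2 * of_nat m) (f m)" for m
    have yV: "y \<in> V" unfolding Suc.prems(1) by (intro subspace_sum[OF carrier_subspace] Suc.prems)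
    have "act X y = (\<Sum>m=1..Suc r. scale (c - 2 * of_nat m) (f m))"
      using act_sum[OF X, of "{1..Suc r}" f] Suc.prems(2) unfolding Suc.prems(1) Suc.prems(3) by simp
    then have "act X y - scale ?k y = (\<Sum>m=1..Suc r. f' m)"
      unfolding Suc.prems(1) scale_sum_right f'_def
      by (simp add: sum_subtractf[symmetric] scale_left_diff_distrib[symmetric] del: sum.cl_ivl_Suc of_nat_Suc)
    also have "\<dots> = (\<Sum>m=1..r. f' m)" by (simp add: f'_def)
    also have "act X y - scale ?k y = ?y"
      unfolding Suc.prems(4) scale_left_diff_distrib[symmetric] by simp
    finally have "?y = (\<Sum>m=1..r. f' m)" .
    moreover have "f' m \<in> V" "act X (f' m) = scale (c - 2 * of_nat m) (f' m)" for m
      unfolding f'_def using X Suc.prems(2,3)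
      by (simp_all add: V_scale act_scale scale_left_commute)
    moreover have "act X ?y = scale c ?y"
      using X yV Suc.prems(4) by (simp add: act_scale scale_left_commute del: of_nat_Suc)
    ultimately have "?y = 0" by (rule Suc.IH)
    moreover have "2 * of_nat (Suc r) \<noteq> (0 :: complex)" by (simp del: of_nat_Suc)
    ultimately show ?case by simp
  qed simp
  then show ?thesis using y by (elim lower_eigenvectorsE) blast
qed

end

text \<open>The vectors obtained from \<open>p\<close> by lowering operators of total degree \<open>m\<close>. The degree is an integer, and zero
  is allowed in all degrees, so that the operators of positive degree can be treated uniformly.\<close>

inductive lowered :: "(complex \<Rightarrow> 'v::ab_group_add \<Rightarrow> 'v) \<Rightarrow> (complex mat \<Rightarrow> 'v \<Rightarrow> 'v) \<Rightarrow> nat \<Rightarrow> 'v \<Rightarrow>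
    int \<Rightarrow> 'v \<Rightarrow> bool" for scale act n p where
  base: "lowered scale act n p 0 p"
| zero: "lowered scale act n p m 0"
| add: "lowered scale act n p m x \<Longrightarrow> lowered scale act n p m y \<Longrightarrow> lowered scale act n p m (x + y)"
| scale: "lowered scale act n p m x \<Longrightarrow> lowered scale act n p m (scale c x)"
| lower: "lowered scale act n p m x \<Longrightarrow> X \<in> sp n \<Longrightarrow> homogeneous n (- k) X \<Longrightarrow> 1 \<le> k \<Longrightarrow>
    lowered scale act n p (m + k) (act X x)"

locale highest_weight_module = lie_module scale "sp n" V act
  for scale :: "complex \<Rightarrow> 'v::ab_group_add \<Rightarrow> 'v" and n :: nat and V :: "'v set"
    and act :: "complex mat \<Rightarrow> 'v \<Rightarrow> 'v" +
  fixes lam :: "nat list" and p :: 'v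
  assumes hw: "highest_weight_vector n scale V act lam p"
begin

abbreviation "low \<equiv> lowered scale act n p"

definition top_eigenvalue :: complex where
  "top_eigenvalue = (\<Sum>i\<le>n. of_nat (lam ! i) * grading_mat n $$ (i, i))"

lemma p_mem: "p \<in> V"
  using hw by (simp add: highest_weight_vector_def)

lemma act_grading_p: "act (grading_mat n) p = scale top_eigenvalue p"
  using hw grading_mat_sp grading_mat_diagonal
  by (simp add: highest_weight_vector_def top_eigenvalue_def)

lemma low_mem: "low m x \<Longrightarrow> x \<in> V"
proof (induction rule: lowered.induct)
  case (lower m x X k)
  then show ?case by (simp add: act_closed)
qed (auto simp: p_mem V_zero
    intro: V_add V_scale)

lemma low_top: "low m x \<Longrightarrow> (m < 0 \<longrightarrow> x = 0) \<and> (m = 0 \<longrightarrow> (\<exists>c. x = scale c p))"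
proof (induction rule: lowered.induct)
  case base
  show ?case by (intro conjI impI exI[of _ 1]) simp_all
next
  case (zero m)
  show ?case by (intro conjI impI exI[of _ 0]) simp_all
next
  case (add m x y)
  then show ?case by (auto simp: scale_left_distrib[symmetric])
next
  case (scale m x c)
  then show ?case by auto
next
  case (lower m x X k)
  then have "m < 0" if "m + k \<le> 0" using that by simp
  then show ?case using lower act_zero[of X] by (auto intro: exI[of _ 0])
qed

text \<open>The usual argument that a highest weight vector generates its module under lowering operators: commute an
  operator past the lowering operators, until it reaches the highest weight vector.\<close>

lemma low_act:
  assumes "low m x" "Z \<in> sp n" "homogeneous n j Z"
  shows "low (m - j) (act Z x)"
  using assms
proof (induction arbitrary: Z j rule: lowered.induct)
  case base
  consider "j < 0" | "j = 0" | "j > 0" by linarith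
  then show ?case
  proof cases
    case 1
    then show ?thesis using lowered.lower[OF lowered.base base(1), where k = "- j"] base(2) by simp
  next
    case 2
    have "diagonal_mat Z"
      using base sp_carrier[OF base(1)] 2 by (auto simp: diagonal_mat_def homogeneous_def)
    then have "act Z p = scale (\<Sum>i\<le>n. of_nat (lam ! i) * Z $$ (i, i)) p"
      using hw base(1) by (simp add: highest_weight_vector_def)
    then show ?thesis using 2 by (simp add: lowered.scale lowered.base)
  next
    case 3
    have "Z $$ (i, l) = 0" if "i < 2*n+2" "l \<le> i" for i l
    proof (rule ccontr)
      assume "Z $$ (i, l) \<noteq> 0"
      then have "int l - int i = j" using base(2) that by (simp add: homogeneous_def)
      then show False using 3 that by simp
    qed
    then have "act Z p = 0" using hw base(1) by (simp add: highest_weight_vector_def)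
    then show ?thesis by (simp add: lowered.zero)
  qed
next
  case (zero m)
  then show ?case by (simp add: act_zero lowered.zero)
next
  case (add m x y)
  then show ?case by (simp add: act_add low_mem lowered.add)
next
  case (scale m x c)
  then show ?case by (simp add: act_scale low_mem lowered.scale)
next
  case (lower m x X k)
  have xV: "x \<in> V" using lower.hyps(1) by (rule low_mem)
  let ?B = "Z * X - X * Z"
  have "homogeneous n (j + - k) ?B"
    using lower.prems lower.hyps by (intro homogeneous_bracket sp_carrier)
  then have "low (m - (j + - k)) (act ?B x)"
    using lower.prems lower.hyps by (intro lower.IH sp_bracket)
  moreover have "low (m - j + k) (act X (act Z x))"
    using lower.prems lower.hyps by (intro lowered.lower[where k = k] lower.IH)
  moreover have "act Z (act X x) = act ?B x + act X (act Z x)"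
    using bracket_act[OF lower.prems(1) lower.hyps(2) xV] by simp
  ultimately show ?case by (simp add: algebra_simps lowered.add)
qed

lemma low_eigenvalue:
  "low m x \<Longrightarrow> act (grading_mat n) x = scale (top_eigenvalue - 2 * of_int m) x"
proof (induction rule: lowered.induct)
  case base
  show ?case by (simp add: act_grading_p)
next
  case (zero m)
  show ?case by (simp add: act_zero grading_mat_sp)
next
  case (add m x y)
  then show ?case by (simp add: act_add grading_mat_sp low_mem scale_right_distrib)
next
  case (scale m x c)
  then show ?case by (simp add: act_scale grading_mat_sp low_mem scale_left_commute)
next
  case (lower m x X k)
  have xV: "x \<in> V" using lower.hyps(1) by (rule low_mem)
  have "act (grading_mat n) (act X x) =
      act (grading_mat n * X - X * grading_mat n) x + act X (act (grading_mat n) x)"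
    using bracket_act[OF grading_mat_sp lower.hyps(2) xV] by simp
  also have "\<dots> = scale (of_int (2 * - k)) (act X x) + scale (top_eigenvalue - 2 * of_int m) (act X x)"
    unfolding bracket_grading_mat[OF sp_carrier[OF lower.hyps(2)] lower.hyps(3)] lower.IH
    using lower.hyps(2) xV by (simp only: smult_act act_scale)
  also have "\<dots> = scale (top_eigenvalue - 2 * of_int (m + k)) (act X x)"
    unfolding scale_left_distrib[symmetric] by (simp add: algebra_simps)
  finally show ?case .
qed

text \<open>An arbitrary matrix of \<open>sp\<close> is the sum of its diagonals, added one at a time.\<close>

lemma subspace_span_low_stable:
  assumes X: "X \<in> sp n" and z: "z \<in> span {x. \<exists>m. low m x}"
  shows "act X z \<in> span {x. \<exists>m. low m x}"
proof -
  let ?N = "2*n+2" and ?L = "span {x. \<exists>m. low m x}"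
  have LV: "?L \<subseteq> V" by (rule span_minimal[OF _ carrier_subspace]) (auto intro: low_mem)
  have Xc: "X \<in> carrier_mat ?N ?N" using X by (rule sp_carrier)
  have hom: "act Y z \<in> ?L" if Y: "Y \<in> sp n" "homogeneous n k Y" for Y k
  proof -
    have "?L \<subseteq> {z \<in> V. act Y z \<in> ?L}"
    proof (rule span_minimal)
      show "{x. \<exists>m. low m x} \<subseteq> {z \<in> V. act Y z \<in> ?L}"
        using low_act[OF _ Y] low_mem by (blast intro: span_base)
      show "subspace {z \<in> V. act Y z \<in> ?L}"
        by (rule subspaceI)
          (auto simp: act_zero[OF Y(1)] act_add[OF Y(1)] act_scale[OF Y(1)] span_zero span_add span_scale
            V_zero V_add V_scale)
    qed
    then show ?thesis using z by blast
  qed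
  have "act (diagonals n (\<lambda>l. l < m) X) z \<in> ?L" for m
  proof (induction m)
    case 0
    have "diagonals n (\<lambda>l. l < 0) X = 0 \<cdot>\<^sub>m X"
      using Xc by (intro eq_matI) (auto simp: diagonals_def)
    then have "act (diagonals n (\<lambda>l. l < 0) X) z = scale 0 (act X z)"
      using smult_act[OF X, of z 0] LV z by auto
    then show ?case using span_zero by simp
  next
    case (Suc m)
    have "diagonals n (\<lambda>l. l < Suc m) X = diagonals n (\<lambda>l. l < m) X + diagonals n (\<lambda>l. l = m) X"
      by (rule eq_matI) (auto simp: diagonals_def)
    then have "act (diagonals n (\<lambda>l. l < Suc m) X) z =
        act (diagonals n (\<lambda>l. l < m) X) z + act (diagonals n (\<lambda>l. l = m) X) z"
      using add_act[OF diagonals_sp[OF X] diagonals_sp[OF X]] LV z by auto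
    then show ?case
      using Suc hom[OF diagonals_sp[OF X] diagonals_homogeneous] by (simp add: span_add)
  qed
  moreover have "diagonals n (\<lambda>l. l < 2 * ?N) X = X"
    using Xc by (intro eq_matI) (auto simp: diagonals_def)
  ultimately show ?thesis by metis
qed

lemma generated_decomposition:
  assumes "z \<in> generated_submodule scale (sp n) V act p"
  obtains c y where "z = scale c p + y"
    "y \<in> lower_eigenvectors scale V (act (grading_mat n)) top_eigenvalue"
proof -
  let ?L = "span {x. \<exists>m. low m x}" and ?E = "lower_eigenvectors scale V (act (grading_mat n)) top_eigenvalue"
  have "?L \<subseteq> V" by (rule span_minimal[OF _ carrier_subspace]) (auto intro: low_mem)
  then have "lie_submodule scale (sp n) V act ?L"
    unfolding lie_submodule_def using subspace_span_low_stable subspace_span by blast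
  moreover have "p \<in> ?L" using lowered.base by (intro span_base) blast
  ultimately have "z \<in> ?L" using assms unfolding generated_submodule_def by blast
  moreover have "?L \<subseteq> {z. \<exists>c y. z = scale c p + y \<and> y \<in> ?E}"
  proof (rule span_minimal)
    have E: "subspace ?E" by (rule lower_eigenvectors_subspace[OF grading_mat_sp])
    show "{x. \<exists>m. low m x} \<subseteq> {z. \<exists>c y. z = scale c p + y \<and> y \<in> ?E}"
    proof clarify
      fix m x assume x: "low m x"
      show "\<exists>c y. x = scale c p + y \<and> y \<in> ?E"
      proof (cases "m \<le> 0")
        case True
        then obtain c where "x = scale c p"
          using low_top[OF x] scale_zero_left by (metis order_le_less)
        then show ?thesis using subspace_0[OF E] by (intro exI[of _ c] exI[of _ 0]) simp
      next
        case False
        define f where "f k = (if k = nat m then x else 0)" for k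
        have "(\<Sum>k=1..nat m. f k) \<in> ?E"
        proof (rule lower_eigenvectorsI, intro allI conjI)
          fix k
          show "f k \<in> V" using low_mem[OF x] V_zero by (simp add: f_def)
          show "act (grading_mat n) (f k) = scale (top_eigenvalue - 2 * of_nat k) (f k)"
            using low_eigenvalue[OF x] False by (simp add: f_def act_zero[OF grading_mat_sp])
        qed
        moreover have "(\<Sum>k=1..nat m. f k) = x"
        proof -
          have "1 \<le> nat m" using False by linarith
          then show ?thesis by (simp add: f_def)
        qed
        ultimately show ?thesis by (intro exI[of _ 0] exI[of _ x]) simp
      qed
    qed
    show "subspace {z. \<exists>c y. z = scale c p + y \<and> y \<in> ?E}"
    proof (rule subspaceI)
      show "0 \<in> {z. \<exists>c y. z = scale c p + y \<and> y \<in> ?E}"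
        using subspace_0[OF E] by (auto intro!: exI[of _ 0])
    next
      fix x y assume "x \<in> {z. \<exists>c y. z = scale c p + y \<and> y \<in> ?E}" "y \<in> {z. \<exists>c y. z = scale c p + y \<and> y \<in> ?E}"
      then obtain a b u v where *: "x = scale a p + u" "y = scale b p + v" "u \<in> ?E" "v \<in> ?E" by blast
      then have "x + y = scale (a + b) p + (u + v)" by (simp add: scale_left_distrib algebra_simps)
      then show "x + y \<in> {z. \<exists>c y. z = scale c p + y \<and> y \<in> ?E}"
        using subspace_add[OF E *(3,4)] by blast
    next
      fix c x assume "x \<in> {z. \<exists>c y. z = scale c p + y \<and> y \<in> ?E}"
      then obtain a u where *: "x = scale a p + u" "u \<in> ?E" by blast
      then have "scale c x = scale (c * a) p + scale c u" by (simp add: scale_right_distrib)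
      then show "scale c x \<in> {z. \<exists>c y. z = scale c p + y \<and> y \<in> ?E}"
        using subspace_scale[OF E *(2)] by blast
    qed
  qed
  ultimately show thesis using that by blast
qed

end

section \<open>The isomorphism with the simple module\<close>

lemma (in lie_module) restrict_lie_algebra:
  assumes "g' \<subseteq> g"
  shows "lie_module scale g' V act"
  using assms by unfold_locales
    (auto simp: carrier_subspace act_closed act_add act_scale add_act smult_act bracket_act subset_iff)

lemma (in lie_module) generated_submodule:
  assumes "v \<in> V"
  shows "lie_submodule scale g V act (generated_submodule scale g V act v)"
    and "v \<in> generated_submodule scale g V act v"
proof -
  have "lie_submodule scale g V act V"
    using carrier_subspace act_closed by (simp add: lie_submodule_def)
  then have "generated_submodule scale g V act v \<subseteq> V"
    using assms unfolding generated_submodule_def by blast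
  then show "lie_submodule scale g V act (generated_submodule scale g V act v)"
    unfolding lie_submodule_def
    by (auto simp: generated_submodule_def lie_submodule_def intro!: subspace_Inter)
  show "v \<in> generated_submodule scale g V act v" by (simp add: generated_submodule_def)
qed

lemma generated_submodule_minimal:
  "lie_submodule scale g V act W \<Longrightarrow> v \<in> W \<Longrightarrow> generated_submodule scale g V act v \<subseteq> W"
  unfolding generated_submodule_def by blast

lemma lie_module_word_space:
  assumes "g \<subseteq> carrier_mat N N"
  shows "lie_module tensor_scale g (word_space {..<N} d) (derivation N)"
proof unfold_locales
  show "tensor.subspace (word_space {..<N} d)" by (rule subspace_word_space)
  fix X Y :: "complex mat" and c u v
  assume X: "X \<in> g"
  show "derivation N X v \<in> word_space {..<N} d" if "v \<in> word_space {..<N} d"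
    using that by (rule derivation_word_space_full)
  show "derivation N X (u + v) = derivation N X u + derivation N X v" by (rule derivation_add)
  show "derivation N X (tensor_scale c v) = tensor_scale c (derivation N X v)" by (rule derivation_scale)
  show "derivation N (c \<cdot>\<^sub>m X) v = tensor_scale c (derivation N X v)"
    using X assms by (intro derivation_smult) blast
  assume Y: "Y \<in> g"
  show "derivation N (X + Y) v = derivation N X v + derivation N Y v"
    using X Y assms by (intro derivation_mat_add) blast+
  show "derivation N (X * Y - Y * X) v = derivation N X (derivation N Y v) - derivation N Y (derivation N X v)"
    using X Y assms by (intro derivation_bracket) blast+
qed

lemma lie_module_prod:
  assumes "lie_module s1 g V1 a1" "lie_module s2 g V2 a2"
  shows "lie_module (\<lambda>c. map_prod (s1 c) (s2 c)) g (V1 \<times> V2) (\<lambda>X. map_prod (a1 X) (a2 X))"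
proof -
  interpret M1: lie_module s1 g V1 a1 by fact
  interpret M2: lie_module s2 g V2 a2 by fact
  interpret P: vector_space "\<lambda>c. map_prod (s1 c) (s2 c)"
    by unfold_locales
      (auto simp: M1.scale_right_distrib M2.scale_right_distrib M1.scale_left_distrib M2.scale_left_distrib)
  show ?thesis
  proof unfold_locales
    show "P.subspace (V1 \<times> V2)"
      by (rule P.subspaceI)
        (auto simp: zero_prod_def M1.V_zero M2.V_zero
          M1.V_add M2.V_add
          M1.V_scale M2.V_scale)
  qed (auto simp: M1.act_closed M2.act_closed M1.act_add M2.act_add M1.act_scale M2.act_scale
      M1.add_act M2.add_act M1.smult_act M2.smult_act M1.bracket_act M2.bracket_act)
qed

text \<open>Let \<open>G\<close> be generated by \<open>(v, t\<^sub>0)\<close> in the direct sum. Its elements are multiples of \<open>(v, t\<^sub>0)\<close> plus lower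
  eigenvectors, so it does not contain \<open>(v, 0)\<close>, and as \<open>V\<close> is simple it contains no \<open>(x, 0)\<close> with
  \<open>x \<noteq> 0\<close>. The space \<open>K\<close> of all \<open>t\<close> with \<open>(0, t)\<close> in \<open>G\<close> consists of lower eigenvectors, which are
  orthogonal to \<open>t\<^sub>0\<close>; since \<open>K\<close> is stable under \<open>sp\<close> and \<open>sp\<close> is closed under adjoints, \<open>K\<close> is orthogonal
  to the whole module generated by \<open>t\<^sub>0\<close>, to which it belongs. So \<open>K = 0\<close>, and \<open>G\<close> is the graph of
  an injective map.\<close>

lemma highest_weight_isomorphism:
  fixes scale :: "complex \<Rightarrow> 'v::ab_group_add \<Rightarrow> 'v"
  assumes simple: "simple_lie_module scale (sp n) V act"
    and hwv: "highest_weight_vector n scale V act lam v"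
    and hwt: "highest_weight_vector n tensor_scale (word_space {..<2*n+2} d) (derivation (2*n+2)) lam t0"
  obtains M f where
    "lie_submodule tensor_scale (sp n) (word_space {..<2*n+2} d) (derivation (2*n+2)) M" "t0 \<in> M"
    "inj_on f M" "\<And>t. t \<in> M \<Longrightarrow> f t \<in> V" "f t0 = v"
    "\<And>s t. s \<in> M \<Longrightarrow> t \<in> M \<Longrightarrow> f (s + t) = f s + f t"
    "\<And>c t. t \<in> M \<Longrightarrow> f (tensor_scale c t) = scale c (f t)"
    "\<And>X t. X \<in> sp n \<Longrightarrow> t \<in> M \<Longrightarrow> f (derivation (2*n+2) X t) = act X (f t)"
proof -
  let ?N = "2*n+2"
  let ?U = "word_space {..<?N} d" and ?D = "derivation ?N"
  interpret V: lie_module scale "sp n" V act using simple by (simp add: simple_lie_module_def)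
  interpret U: lie_module tensor_scale "sp n" ?U ?D
    by (rule lie_module_word_space) (auto intro: sp_carrier)
  let ?s = "\<lambda>c. map_prod (scale c) (tensor_scale c)" and ?a = "\<lambda>X. map_prod (act X) (?D X)"
  interpret P: lie_module ?s "sp n" "V \<times> ?U" ?a
    by (rule lie_module_prod) (fact V.lie_module_axioms, fact U.lie_module_axioms)
  interpret hV: highest_weight_module scale n V act lam v by unfold_locales (rule hwv)
  interpret hU: highest_weight_module tensor_scale n ?U ?D lam t0 by unfold_locales (rule hwt)
  interpret hP: highest_weight_module ?s n "V \<times> ?U" ?a lam "(v, t0)"
    by unfold_locales (use hwv hwt in \<open>auto simp: highest_weight_vector_def zero_prod_def\<close>)
  have nz: "v \<noteq> 0" "t0 \<noteq> 0" using hwv hwt by (auto simp: highest_weight_vector_def)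
  let ?h = "grading_mat n" and ?c = hV.top_eigenvalue
  define G where "G = generated_submodule ?s (sp n) (V \<times> ?U) ?a (v, t0)"
  have G: "lie_submodule ?s (sp n) (V \<times> ?U) ?a G" "(v, t0) \<in> G"
    unfolding G_def by (rule P.generated_submodule[OF hP.p_mem])+
  have Gsub: "P.subspace G" and GV: "G \<subseteq> V \<times> ?U"
    using G(1) unfolding lie_submodule_def by blast+
  have Gact: "(act X x, ?D X t) \<in> G" if "X \<in> sp n" "(x, t) \<in> G" for X x t
  proof -
    have "?a X (x, t) \<in> G" using G(1) that unfolding lie_submodule_def by blast
    then show ?thesis by (simp only: map_prod_simp)
  qed
  have G0: "(0, 0) \<in> G" using P.subspace_0[OF Gsub] by (simp only: zero_prod_def)
  have Gadd: "(x + y, s + t) \<in> G" if "(x, s) \<in> G" "(y, t) \<in> G" for x y s t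
    using P.subspace_add[OF Gsub that] by (simp only: add_Pair)
  have Gscale: "(scale c x, tensor_scale c t) \<in> G" if "(x, t) \<in> G" for c x t
    using P.subspace_scale[OF Gsub that, of c] by (simp only: map_prod_simp)
  have Gdiff: "(x - y, s - t) \<in> G" if "(x, s) \<in> G" "(y, t) \<in> G" for x y s t
    using P.subspace_diff[OF Gsub that] by (simp only: diff_Pair)
  have decomp: "\<exists>c y z. x = scale c v + y \<and> t = tensor_scale c t0 + z \<and>
      y \<in> lower_eigenvectors scale V (act ?h) ?c \<and> z \<in> lower_eigenvectors tensor_scale ?U (?D ?h) ?c"
    if xt: "(x, t) \<in> G" for x t
  proof -
    obtain c y where y: "(x, t) = ?s c (v, t0) + y" "y \<in> lower_eigenvectors ?s (V \<times> ?U) (?a ?h) ?c"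
      by (rule hP.generated_decomposition[OF xt[unfolded G_def]])
    obtain r zs where zs: "y = (\<Sum>m=1..r. zs m)" "\<And>m::nat. zs m \<in> V \<times> ?U"
      "\<And>m. ?a ?h (zs m) = ?s (?c - 2 * of_nat m) (zs m)"
      using y(2) by (rule lower_eigenvectorsE) blast
    have "fst (zs m) \<in> V \<and> act ?h (fst (zs m)) = scale (?c - 2 * of_nat m) (fst (zs m))" for m
      using zs(2)[of m] arg_cong[OF zs(3)[of m], of fst] by auto
    then have "fst y \<in> lower_eigenvectors scale V (act ?h) ?c"
      unfolding zs(1) fst_sum by (intro lower_eigenvectorsI) blast
    moreover have "snd (zs m) \<in> ?U \<and> ?D ?h (snd (zs m)) = tensor_scale (?c - 2 * of_nat m) (snd (zs m))" for m
      using zs(2)[of m] arg_cong[OF zs(3)[of m], of snd] by auto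
    then have "snd y \<in> lower_eigenvectors tensor_scale ?U (?D ?h) ?c"
      unfolding zs(1) snd_sum by (intro lower_eigenvectorsI) blast
    moreover have "x = scale c v + fst y" "t = tensor_scale c t0 + snd y"
      using arg_cong[OF y(1), of fst] arg_cong[OF y(1), of snd] by (simp_all only: fst_conv snd_conv fst_add snd_add map_prod_simp)
    ultimately show ?thesis by blast
  qed
  have V_coeff: "c = 0" if "0 = scale c v + y" "y \<in> lower_eigenvectors scale V (act ?h) ?c" for c y
  proof -
    have y: "y = scale (- c) v" using that(1) by (simp add: eq_neg_iff_add_eq_0 add.commute)
    then have "act ?h y = scale ?c y"
      using V.act_scale[OF grading_mat_sp hV.p_mem] by (simp only: hV.act_grading_p V.scale_scale mult.commute)
    then have "y = 0" using V.lower_eigenvectors_top[OF grading_mat_sp that(2)] by blast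
    then show ?thesis using y nz by simp
  qed
  have U_coeff: "c = 0" if "0 = tensor_scale c t0 + y" "y \<in> lower_eigenvectors tensor_scale ?U (?D ?h) ?c" for c y
  proof -
    have y: "y = tensor_scale (- c) t0" using that(1) unfolding tensor.scale_minus_left by (metis add.commute eq_neg_iff_add_eq_0)
    have "?D ?h y = tensor_scale (- c) (?D ?h t0)" unfolding y by (rule derivation_scale)
    also have "\<dots> = tensor_scale ?c y"
      unfolding hU.act_grading_p y by (rule tensor.scale_left_commute)
    finally have "?D ?h y = tensor_scale ?c y" .
    then have "y = 0" using U.lower_eigenvectors_top[OF grading_mat_sp that(2)] by blast
    then have "- c = 0" using y nz(2) tensor.scale_eq_0_iff by metis
    then show ?thesis by simp
  qed
  have left: "x = 0" if x0: "(x, 0) \<in> G" for x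
  proof -
    define K where "K = {x. (x, 0) \<in> G}"
    have "lie_submodule scale (sp n) V act K"
      unfolding lie_submodule_def
    proof (intro conjI ballI)
      show "V.subspace K"
      proof (rule V.subspaceI)
        show "0 \<in> K" using G0 by (simp add: K_def)
        show "x + y \<in> K" if "x \<in> K" "y \<in> K" for x y
          using Gadd[of x 0 y 0] that by (simp add: K_def)
        show "scale c x \<in> K" if "x \<in> K" for c x
          using Gscale[of x 0 c] that unfolding K_def tensor.scale_zero_right by simp
      qed
      show "K \<subseteq> V" using GV by (auto simp: K_def)
      show "act X x \<in> K" if "X \<in> sp n" "x \<in> K" for X x
        using Gact[of X x 0] that U.act_zero[of X] unfolding K_def by simp
    qed
    then have "K = {0} \<or> K = V" using simple by (simp add: simple_lie_module_def)
    moreover have "K \<noteq> V"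
    proof
      assume "K = V"
      then have "(v, 0) \<in> G" using hV.p_mem by (auto simp: K_def)
      then obtain c y z where *: "v = scale c v + y" "0 = tensor_scale c t0 + z"
        "y \<in> lower_eigenvectors scale V (act ?h) ?c" "z \<in> lower_eigenvectors tensor_scale ?U (?D ?h) ?c"
        using decomp by blast
      then have "c = 0" using U_coeff by blast
      then have "y = v" using *(1) by simp
      then have "v = 0"
        using V.lower_eigenvectors_top[OF grading_mat_sp *(3)] hV.act_grading_p by blast
      then show False using nz by blast
    qed
    ultimately show ?thesis using x0 by (auto simp: K_def)
  qed
  have right: "t = 0" if t0: "(0, t) \<in> G" for t
  proof -
    define K where "K = {t. (0, t) \<in> G}"
    have KU: "K \<subseteq> ?U" using GV by (auto simp: K_def)
    have Kact: "?D X t \<in> K" if "X \<in> sp n" "t \<in> K" for X t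
      using Gact[of X 0 t] that V.act_zero[of X] by (simp add: K_def)
    have orth: "hermitian ?N d y t0 = 0" if y: "y \<in> K" for y
    proof -
      obtain c x z where *: "0 = scale c v + x" "y = tensor_scale c t0 + z"
        "x \<in> lower_eigenvectors scale V (act ?h) ?c" "z \<in> lower_eigenvectors tensor_scale ?U (?D ?h) ?c"
        using decomp y unfolding K_def by blast
      then have "c = 0" using V_coeff by blast
      then have "y = z" using *(2) unfolding tensor.scale_zero_left by (metis \<open>c = 0\<close> add_0 tensor.scale_zero_left)
      obtain r zs where zs: "z = (\<Sum>m=1..r. zs m)" "\<And>m::nat. zs m \<in> ?U"
        "\<And>m. ?D ?h (zs m) = tensor_scale (?c - 2 * of_nat m) (zs m)"
        using *(4) by (rule lower_eigenvectorsE) blast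
      \<comment> \<open>Eigenvectors of a self-adjoint operator with different eigenvalues are orthogonal.\<close>
      have cr: "cnj ?c = ?c"
        by (simp add: hV.top_eigenvalue_def grading_mat_def)
      have "hermitian ?N d (zs m) t0 = 0" if "m \<in> {1..r}" for m
      proof -
        have "(?c - 2 * of_nat m) * hermitian ?N d (zs m) t0 = hermitian ?N d (?D ?h (zs m)) t0"
          by (simp only: zs(3) hermitian_scale_left)
        also have "\<dots> = hermitian ?N d (zs m) (?D ?h t0)"
          by (simp only: hermitian_derivation mat_star_grading_mat)
        also have "\<dots> = ?c * hermitian ?N d (zs m) t0"
          by (simp only: hU.act_grading_p hermitian_scale_right cr)
        finally have "of_nat m * hermitian ?N d (zs m) t0 = 0" by (simp add: algebra_simps)
        then show ?thesis using that by simp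
      qed
      then show ?thesis unfolding \<open>y = z\<close> zs(1) hermitian_sum_left by (rule sum.neutral[rule_format])
    qed
    \<comment> \<open>A submodule containing \<open>(v, t\<^sub>0)\<close>, hence \<open>G\<close>.\<close>
    define Q where "Q = {(x, z) \<in> V \<times> ?U. \<forall>y\<in>K. hermitian ?N d z y = 0}"
    have "lie_submodule ?s (sp n) (V \<times> ?U) ?a Q"
      unfolding lie_submodule_def
    proof (intro conjI ballI)
      show "P.subspace Q"
      proof (rule P.subspaceI)
        show "0 \<in> Q"
          using V.V_zero U.V_zero
          by (simp add: Q_def zero_prod_def)
        show "x + y \<in> Q" if "x \<in> Q" "y \<in> Q" for x y
          using that V.V_add U.V_add
          by (auto simp: Q_def hermitian_add_left)
        show "?s c x \<in> Q" if "x \<in> Q" for c x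
          using that V.V_scale U.V_scale
          by (auto simp: Q_def hermitian_scale_left)
      qed
      show "Q \<subseteq> V \<times> ?U" by (auto simp: Q_def)
      show "?a X w \<in> Q" if X: "X \<in> sp n" and w: "w \<in> Q" for X w
        using w X V.act_closed[OF X] U.act_closed[OF X] Kact[OF mat_star_sp[OF X]]
        by (auto simp: Q_def hermitian_derivation)
    qed
    moreover have "(v, t0) \<in> Q"
    proof -
      have "hermitian ?N d t0 y = 0" if "y \<in> K" for y
        using orth[OF that] hermitian_cnj[of ?N d y t0] by simp
      then show ?thesis using hV.p_mem hU.p_mem by (simp add: Q_def)
    qed
    ultimately have "G \<subseteq> Q" unfolding G_def by (rule generated_submodule_minimal)
    then have "hermitian ?N d t t = 0" using t0 by (auto simp: Q_def K_def)
    then show ?thesis using t0 KU by (intro hermitian_self_eq_0) (auto simp: K_def)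
  qed
  define f where "f t = (THE x. (x, t) \<in> G)" for t
  have fI: "f t = x" if "(x, t) \<in> G" for x t
    unfolding f_def
  proof (rule the_equality)
    show "(x, t) \<in> G" by (rule that)
    fix y assume "(y, t) \<in> G"
    then have "(y - x, 0) \<in> G" using Gdiff[OF _ that, of y t] by (simp only: diff_self)
    then show "y = x" using left by fastforce
  qed
  have fG: "(f t, t) \<in> G" if "t \<in> snd ` G" for t
    using that fI by force
  have M: "lie_submodule tensor_scale (sp n) ?U ?D (snd ` G)"
    unfolding lie_submodule_def
  proof (intro conjI ballI)
    show "tensor.subspace (snd ` G)"
    proof (rule tensor.subspaceI)
      show "0 \<in> snd ` G" using G0 by force
      show "s + t \<in> snd ` G" if "s \<in> snd ` G" "t \<in> snd ` G" for s t
        using Gadd[OF fG[OF that(1)] fG[OF that(2)]] by force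
      show "tensor_scale c t \<in> snd ` G" if "t \<in> snd ` G" for c t
        using Gscale[OF fG[OF that], of c] by force
    qed
    show "snd ` G \<subseteq> ?U" using GV by auto
    show "?D X t \<in> snd ` G" if "X \<in> sp n" "t \<in> snd ` G" for X t
      using Gact[OF that(1) fG[OF that(2)]] by force
  qed
  show thesis
  proof (rule that[OF M])
    show "t0 \<in> snd ` G" using G(2) by force
    show "f t0 = v" by (rule fI[OF G(2)])
    show "f t \<in> V" if "t \<in> snd ` G" for t using fG[OF that] GV by blast
    show "f (s + t) = f s + f t" if "s \<in> snd ` G" "t \<in> snd ` G" for s t
      by (rule fI[OF Gadd[OF fG[OF that(1)] fG[OF that(2)]]])
    show "f (tensor_scale c t) = scale c (f t)" if "t \<in> snd ` G" for c t
      by (rule fI[OF Gscale[OF fG[OF that]]])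
    show "f (?D X t) = act X (f t)" if "X \<in> sp n" "t \<in> snd ` G" for X t
      by (rule fI[OF Gact[OF that(1) fG[OF that(2)]]])
    show "inj_on f (snd ` G)"
    proof (rule inj_onI)
      fix s t assume st: "s \<in> snd ` G" "t \<in> snd ` G" "f s = f t"
      then have "(0, s - t) \<in> G" using Gdiff[OF fG[OF st(1)] fG[OF st(2)]] by simp
      then have "s - t = 0" by (rule right)
      then show "s = t" by (simp only: right_minus_eq)
    qed
  qed
qed

theorem proposition6p5:
  fixes n :: nat and lam :: "nat list" and T :: "nat \<times> nat \<Rightarrow> nat"
    and scale :: "complex \<Rightarrow> 'v::ab_group_add \<Rightarrow> 'v" and V :: "'v set"
    and act :: "complex mat \<Rightarrow> 'v \<Rightarrow> 'v" and v :: 'v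
  assumes "length lam = n + 1" and "sorted_wrt (\<ge>) lam"
    and "simple_lie_module scale (sp n) V act"
    and "highest_weight_vector n scale V act lam v"
    and "tableau lam T"
  shows "isomorphic_lie_modules (line_stabilizer n)
    tensor_scale (traceless_schur_power (2 * n + 2) (symp_form n) (odd_space n) lam T)
      (\<lambda>X. tensor_derivation n (restriction n X))
    scale (generated_submodule scale (intermediate_sp n) V act v) act"
proof -
  let ?N = "2*n+2" and ?d = "sum_list lam"
  let ?U = "word_space {..<?N} ?d" and ?D = "derivation ?N"
  let ?V' = "generated_submodule scale (intermediate_sp n) V act v"
  interpret numbered_diagram lam T by unfold_locales (fact assms(5), fact assms(2))
  note len = assms(1)
  let ?W = "odd_schur n"
  have inter_sp: "intermediate_sp n \<subseteq> sp n" by (auto simp: intermediate_sp_def)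
  have line_sp: "line_stabilizer n \<subseteq> sp n" by (auto simp: line_stabilizer_sp)
  have inter_line: "intermediate_sp n \<subseteq> line_stabilizer n" by (rule intermediate_line_stabilizer)
  interpret V: lie_module scale "sp n" V act using assms(3) by (simp add: simple_lie_module_def)
  interpret VI: lie_module scale "intermediate_sp n" V act by (rule V.restrict_lie_algebra[OF inter_sp])
  have vV: "v \<in> V" using assms(4) by (simp add: highest_weight_vector_def)
  have V': "lie_submodule scale (intermediate_sp n) V act ?V'" "v \<in> ?V'"
    by (rule VI.generated_submodule[OF vV])+
  have V'_sub: "V.subspace ?V'" and V'_V: "?V' \<subseteq> V"
    and V'_act: "\<And>X x. X \<in> intermediate_sp n \<Longrightarrow> x \<in> ?V' \<Longrightarrow> act X x \<in> ?V'"
    using V'(1) unfolding lie_submodule_def by blast+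
  obtain M f where M: "lie_submodule tensor_scale (sp n) ?U ?D M" and hwM: "hw_tensor \<in> M"
    and inj: "inj_on f M" and fV: "\<And>t. t \<in> M \<Longrightarrow> f t \<in> V" and f_hw: "f hw_tensor = v"
    and f_add: "\<And>s t. s \<in> M \<Longrightarrow> t \<in> M \<Longrightarrow> f (s + t) = f s + f t"
    and f_scale: "\<And>c t. t \<in> M \<Longrightarrow> f (tensor_scale c t) = scale c (f t)"
    and f_act: "\<And>X t. X \<in> sp n \<Longrightarrow> t \<in> M \<Longrightarrow> f (?D X t) = act X (f t)"
    using highest_weight_isomorphism[OF assms(3,4) hw_tensor_highest_weight_vector[OF len]] by blast
  have M_sub: "tensor.subspace M" and M_U: "M \<subseteq> ?U"
    and M_act: "\<And>X t. X \<in> sp n \<Longrightarrow> t \<in> M \<Longrightarrow> ?D X t \<in> M"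
    using M unfolding lie_submodule_def by blast+
  have W_act: "?D X t \<in> ?W" if "X \<in> line_stabilizer n" "t \<in> ?W" for X t
    using that by (intro derivation_odd_schur line_stabilizer_sp line_stabilizer_row)
  have W_M: "?W \<subseteq> M"
    by (rule odd_schur_generated[OF len M_sub M_U _ hwM]) (use M_act inter_sp in blast)
  have f_zero: "f 0 = 0"
    using f_scale[OF hwM, of 0] unfolding tensor.scale_zero_left V.scale_zero_left .
  have image: "f ` ?W = ?V'"
  proof
    \<comment> \<open>The inverse image of \<open>V'\<close> contains \<open>t\<^sub>0\<close> and is stable, hence contains \<open>W\<close>.\<close>
    define Z where "Z = {t \<in> M. f t \<in> ?V'}"
    have "?W \<subseteq> Z"
    proof (rule odd_schur_generated[OF len])
      show "tensor.subspace Z"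
      proof (rule tensor.subspaceI)
        show "0 \<in> Z"
          using tensor.subspace_0[OF M_sub] f_zero V.subspace_0[OF V'_sub] by (simp add: Z_def)
        show "s + t \<in> Z" if "s \<in> Z" "t \<in> Z" for s t
          using that tensor.subspace_add[OF M_sub, of s t] f_add[of s t] V.subspace_add[OF V'_sub]
          unfolding Z_def mem_Collect_eq by metis
        show "tensor_scale c t \<in> Z" if "t \<in> Z" for c t
          using that tensor.subspace_scale[OF M_sub, of t c] f_scale[of t c] V.subspace_scale[OF V'_sub]
          unfolding Z_def mem_Collect_eq by metis
      qed
      show "Z \<subseteq> ?U" using M_U by (auto simp: Z_def)
      show "?D X z \<in> Z" if X: "X \<in> intermediate_sp n" and z: "z \<in> Z" for X z
      proof -
        have Xsp: "X \<in> sp n" using X inter_sp by blast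
        show ?thesis
          using z M_act[OF Xsp] f_act[OF Xsp] V'_act[OF X] by (simp add: Z_def)
      qed
      show "hw_tensor \<in> Z" using hwM f_hw V'(2) by (simp add: Z_def)
    qed
    then show "f ` ?W \<subseteq> ?V'" by (auto simp: Z_def)
    show "?V' \<subseteq> f ` ?W"
    proof (rule generated_submodule_minimal)
      show "v \<in> f ` ?W" using hw_tensor_odd_schur[OF len] f_hw by blast
      show "lie_submodule scale (intermediate_sp n) V act (f ` ?W)"
        unfolding lie_submodule_def
      proof (intro conjI ballI)
        show "V.subspace (f ` ?W)"
        proof (rule V.subspaceI)
          show "0 \<in> f ` ?W" using f_zero tensor.subspace_0[OF subspace_odd_schur] by (metis imageI)
          show "x + y \<in> f ` ?W" if xy: "x \<in> f ` ?W" "y \<in> f ` ?W" for x y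
          proof -
            obtain s t where st: "s \<in> ?W" "t \<in> ?W" "x = f s" "y = f t" using xy by blast
            have "x + y = f (s + t)" using st W_M f_add by (metis subsetD)
            then show ?thesis using tensor.subspace_add[OF subspace_odd_schur st(1,2)] by blast
          qed
          show "scale c x \<in> f ` ?W" if x: "x \<in> f ` ?W" for c x
          proof -
            obtain s where s: "s \<in> ?W" "x = f s" using x by blast
            have "scale c x = f (tensor_scale c s)" using s W_M f_scale by (metis subsetD)
            then show ?thesis using tensor.subspace_scale[OF subspace_odd_schur s(1)] by blast
          qed
        qed
        show "f ` ?W \<subseteq> V" using fV W_M by blast
        show "act X x \<in> f ` ?W" if X: "X \<in> intermediate_sp n" and x: "x \<in> f ` ?W" for X x
        proof -
          obtain s where s: "s \<in> ?W" "x = f s" using x by blast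
          have "act X x = f (?D X s)"
            unfolding s(2) using X inter_sp s(1) W_M by (intro f_act[symmetric]) blast+
          moreover have "?D X s \<in> ?W" using X inter_line s(1) by (intro W_act) blast+
          ultimately show ?thesis by simp
        qed
      qed
    qed
  qed
  have act_W: "tensor_derivation n (restriction n X) t = ?D X t" if "X \<in> carrier_mat ?N ?N" "t \<in> ?W" for X t
    using tensor_derivation_restriction[OF that(1)] that(2) odd_schur_word_space by blast
  have carr: "X \<in> carrier_mat ?N ?N" if "X \<in> line_stabilizer n" for X
    using that by (intro sp_carrier line_stabilizer_sp)
  have sub: "u + w \<in> ?W" "tensor_scale c w \<in> ?W" if "u \<in> ?W" "w \<in> ?W" for c u w
    using that by (simp_all add: tensor.subspace_add tensor.subspace_scale subspace_odd_schur)
  have XY: "X * Y - Y * X \<in> carrier_mat ?N ?N"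
    if "X \<in> line_stabilizer n" "Y \<in> line_stabilizer n" for X Y
    using carr that by (intro minus_carrier_mat mult_carrier_mat)
  have W_module: "lie_module tensor_scale (line_stabilizer n) ?W (\<lambda>X. tensor_derivation n (restriction n X))"
  proof unfold_locales
    show "tensor.subspace ?W" by (rule subspace_odd_schur)
  qed (simp_all add: act_W carr W_act sub XY derivation_add derivation_scale derivation_mat_add
      derivation_smult derivation_bracket)
  have V'_line: "act X x \<in> ?V'" if X: "X \<in> line_stabilizer n" and x: "x \<in> ?V'" for X x
  proof -
    have "x \<in> f ` ?W" using x by (simp only: image)
    then obtain s where s: "s \<in> ?W" "x = f s" by (elim imageE)
    have "act X x = f (?D X s)"
      unfolding s(2) using X line_sp s(1) W_M by (intro f_act[symmetric]) blast+
    moreover have "f (?D X s) \<in> f ` ?W" by (rule imageI[OF W_act[OF X s(1)]])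
    ultimately show ?thesis by (simp only: image)
  qed
  have V'_module: "lie_module scale (line_stabilizer n) ?V' act"
  proof -
    interpret VL: lie_module scale "line_stabilizer n" V act by (rule V.restrict_lie_algebra[OF line_sp])
    show ?thesis
    proof unfold_locales
      show "V.subspace ?V'" by (rule V'_sub)
    qed (use V'_line V'_V in \<open>auto simp: VL.act_add VL.act_scale VL.add_act VL.smult_act VL.bracket_act subset_iff\<close>)
  qed
  have "bij_betw f ?W ?V'"
    unfolding bij_betw_def using image inj_on_subset[OF inj W_M] by blast
  moreover have "f (tensor_derivation n (restriction n X) t) = act X (f t)"
    if X: "X \<in> line_stabilizer n" and t: "t \<in> ?W" for X t
    unfolding act_W[OF carr[OF X] t] using X line_sp t W_M by (intro f_act) blast+
  ultimately show ?thesis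
    unfolding isomorphic_lie_modules_def traceless_schur_power_eq
    using W_module V'_module f_add f_scale W_M
    by (intro conjI exI[of _ f]) (auto simp: subset_iff)
qed

end
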